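(* Let $\nu>0$, $\lambda\in\mathbb{R}$, $\mu\in\mathcal{M}_H(\mathbb{R})$, and let $u$ be the solution to $$\Big(\frac{\partial}{\partial t}-\frac{\nu}{2}\frac{\partial^2}{\partial x^2}\Big)u(t,x)=\lambda u(t,x)\,\dot W(t,x),\quad x\in\mathbb{R},\ t>0,\qquad u(0,\cdot)=\mu(\cdot).$$ Then for all $t>0$ and $x_1,x_2\in\mathbb{R}$, $$\mathbb{E}[u(t,x_1)u(t,x_2)]=\iint_{\mathbb{R}^2}\mu(dz_1)\mu(dz_2)\,\mathcal{K}^*(t,x_1-z_1,x_2-z_2,x_1-x_2;\lambda),$$ or, equivalently, $$\mathbb{E}[u(t,x_1)u(t,x_2)]=J_0(t,x_1)J_0(t,x_2)+\iint_{\mathbb{R}^2}\mu(dz_1)\mu(dz_2)\,\mathcal{K}^\dagger(t,x_1-z_1,x_2-z_2,x_1-x_2;\lambda),$$ where $$\mathcal{K}^\dagger(t,z_1,z_2,y;\lambda)=\frac{\lambda^2}{2\nu}\,G_{\nu/2}\Big(t,\frac{z_1+z_2}{2}\Big)\exp\Big(\frac{\lambda^2}{4\nu}\big[\lambda^2t-2(|y|+|y-(z_1-z_2)|)\big]\Big)\,\Phi\Big(\frac{\lambda^2t-(|y|+|y-(z_1-z_2)|)}{\sqrt{2\nu t}}\Big)$$ and $$\begin{aligned}\mathcal{K}^*(t,z_1,z_2,y;\lambda)&=G_\nu(t,z_1)G_\nu(t,z_2)+\mathcal{K}^\dagger(t,z_1,z_2,y;\lambda)\\&=G_{\nu/2}\Big(t,\frac{z_1+z_2}{2}\Big)\Big[G_{2\nu}(t,z_1-z_2)+\frac{\lambda^2}{2\nu}\exp\Big(\frac{\lambda^2}{4\nu}\big[\lambda^2t-2(|y|+|y-(z_1-z_2)|)\big]\Big)\Phi\Big(\frac{\lambda^2t-(|y|+|y-(z_1-z_2)|)}{\sqrt{2\nu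 t}}\Big)\Big].\end{aligned}$$ In particular, for all $t>0$ and $x\in\mathbb{R}$, $$\|u(t,x)\|_2^2=\iint_{\mathbb{R}^2}\mu(dz_1)\mu(dz_2)\,\mathcal{K}^*(t,x-z_1,x-z_2,0;\lambda).$$
   Context: $\dot W$ is a space-time white noise on $\mathbb{R}_+\times\mathbb{R}$. $\|\cdot\|_p$ denotes the $L^p(\Omega)$ norm. $\mathcal{M}_H(\mathbb{R})$ is the set of signed Borel measures $\mu$ on $\mathbb{R}$ such that $\int_{\mathbb{R}}e^{-ax^2}|\mu|(dx)<+\infty$ for all $a>0$, where $|\mu|=\mu_++\mu_-$ and $\mu=\mu_+-\mu_-$ is the Jordan decomposition of $\mu$ into non-negative Borel measures with disjoint support. $G_\nu(t,x)=\frac{1}{\sqrt{2\pi\nu t}}\exp\big(-\frac{x^2}{2\nu t}\big)$ for $t>0$, $x\in\mathbb{R}$ (and similarly with $\nu$ replaced by $\nu/2$, $2\nu$). $\Phi(x)=\int_{-\infty}^x(2\pi)^{-1/2}e^{-y^2/2}\,dy$. $J_0(t,x)=\int_{\mathbb{R}}G_\nu(t,x-y)\,\mu(dy)$. The solution is the (unique) adapted random field (mild) solution in the Walsh sense, $u(t,x)=J_0(t,x)+\int_0^t\int_{\mathbb{R}}G_\nu(t-s,x-y)\,\lambda u(s,y)\,W(ds,dy)$ for $t>0$, $x\in\mathbb{R}$; the initial condition is understood as $\lim_{t\downarrow0}u(t,\cdot)=\mu$ in the sense of distributions. *)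

theory Defs
  imports "HOL-Probability.Probability"
begin

section \<open>Signed Borel measures on the line\<close>

text \<open>
  The measures in question need not be finite, and both parts of the Jordan decomposition may have
  infinite total mass, so a signed measure is represented by its Jordan decomposition
  \<open>(\<mu>\<^sub>+, \<mu>\<^sub>-)\<close>. ``Disjoint support'' is mutual singularity: the two parts are carried by
  complementary Borel sets (their topological supports may meet).
\<close>

type_synonym signed_measure = "real measure \<times> real measure"

definition jordan_pair :: "signed_measure \<Rightarrow> bool" where
  "jordan_pair \<mu> \<longleftrightarrow>
     sets (fst \<mu>) = sets borel \<and> sets (snd \<mu>) = sets borel \<and>
     (\<exists>S\<in>sets borel. emeasure (fst \<mu>) (- S) = 0 \<and> emeasure (snd \<mu>) S = 0)"

definition variation_nn_integral :: "signed_measure \<Rightarrow> (real \<Rightarrow> ennreal) \<Rightarrow> ennreal" where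
  "variation_nn_integral \<mu> f = (\<integral>\<^sup>+ x. f x \<partial>fst \<mu>) + (\<integral>\<^sup>+ x. f x \<partial>snd \<mu>)"

definition M_H :: "signed_measure set" where
  "M_H = {\<mu>. jordan_pair \<mu> \<and>
            (\<forall>a>0. variation_nn_integral \<mu> (\<lambda>x. ennreal (exp (- a * x\<^sup>2))) < \<infinity>)}"

definition signed_integral :: "signed_measure \<Rightarrow> (real \<Rightarrow> real) \<Rightarrow> real" where
  "signed_integral \<mu> f = (\<integral>x. f x \<partial>fst \<mu>) - (\<integral>x. f x \<partial>snd \<mu>)"

text \<open>Integrals over the plane against \<open>\<mu>(dz\<^sub>1) \<mu>(dz\<^sub>2)\<close>; integrability is meant with respect to
  \<open>|\<mu>| \<otimes> |\<mu>|\<close>.\<close>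

definition signed_integrable2 :: "signed_measure \<Rightarrow> (real \<Rightarrow> real \<Rightarrow> real) \<Rightarrow> bool" where
  "signed_integrable2 \<mu> f \<longleftrightarrow>
     (\<forall>m\<in>{fst \<mu>, snd \<mu>}. \<forall>m'\<in>{fst \<mu>, snd \<mu>}. integrable (m \<Otimes>\<^sub>M m') (\<lambda>(z1, z2). f z1 z2))"

definition signed_integral2 :: "signed_measure \<Rightarrow> (real \<Rightarrow> real \<Rightarrow> real) \<Rightarrow> real" where
  "signed_integral2 \<mu> f =
       (\<integral>(z1, z2). f z1 z2 \<partial>(fst \<mu> \<Otimes>\<^sub>M fst \<mu>)) + (\<integral>(z1, z2). f z1 z2 \<partial>(snd \<mu> \<Otimes>\<^sub>M snd \<mu>))
     - (\<integral>(z1, z2). f z1 z2 \<partial>(fst \<mu> \<Otimes>\<^sub>M snd \<mu>)) - (\<integral>(z1, z2). f z1 z2 \<partial>(snd \<mu> \<Otimes>\<^sub>M fst \<mu>))"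

section \<open>Kernels\<close>

definition heat_kernel :: "real \<Rightarrow> real \<Rightarrow> real \<Rightarrow> real" where
  "heat_kernel \<nu> t x = 1 / sqrt (2 * pi * \<nu> * t) * exp (- (x\<^sup>2 / (2 * \<nu> * t)))"

definition Phi :: "real \<Rightarrow> real" where
  "Phi x = (LBINT y:{..x}. (2 * pi) powr (-1/2) * exp (- y\<^sup>2 / 2))"

definition J0 :: "real \<Rightarrow> signed_measure \<Rightarrow> real \<Rightarrow> real \<Rightarrow> real" where
  "J0 \<nu> \<mu> t x = signed_integral \<mu> (\<lambda>y. heat_kernel \<nu> t (x - y))"

definition K_dag :: "real \<Rightarrow> real \<Rightarrow> real \<Rightarrow> real \<Rightarrow> real \<Rightarrow> real \<Rightarrow> real" where
  "K_dag \<nu> lam t z1 z2 y =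
     lam^2 / (2 * \<nu>) * heat_kernel (\<nu> / 2) t ((z1 + z2) / 2)
     * exp (lam^2 / (4 * \<nu>) * (lam^2 * t - 2 * (\<bar>y\<bar> + \<bar>y - (z1 - z2)\<bar>)))
     * Phi ((lam^2 * t - (\<bar>y\<bar> + \<bar>y - (z1 - z2)\<bar>)) / sqrt (2 * \<nu> * t))"

definition K_star :: "real \<Rightarrow> real \<Rightarrow> real \<Rightarrow> real \<Rightarrow> real \<Rightarrow> real \<Rightarrow> real" where
  "K_star \<nu> lam t z1 z2 y = heat_kernel \<nu> t z1 * heat_kernel \<nu> t z2 + K_dag \<nu> lam t z1 z2 y"

section \<open>Space-time white noise\<close>

definition centered_normal :: "'a measure \<Rightarrow> ('a \<Rightarrow> real) \<Rightarrow> real \<Rightarrow> bool" where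
  "centered_normal M X v \<longleftrightarrow>
     (if v = 0 then AE \<omega> in M. X \<omega> = 0 else distributed M lborel X (normal_density 0 (sqrt v)))"

definition noise_sets :: "(real \<times> real) set set" where
  "noise_sets = {A \<in> sets borel. A \<subseteq> {0..} \<times> UNIV \<and> emeasure lborel A < \<infinity>}"

text \<open>
  A centred Gaussian family indexed by the Borel sets of finite area in \<open>\<real>\<^sub>+ \<times> \<real>\<close>, with covariance
  \<open>E[W(A) W(B)] = |A \<inter> B|\<close>, adapted to a filtration whose past is independent of the future
  increments of the noise. The (augmented) filtration generated by \<open>W\<close> is a particular case.
  Only \<open>F t\<close> with \<open>t \<ge> 0\<close> matters; a filtration indexed by \<open>t \<ge> 0\<close> extends by \<open>F t = F 0\<close>.
\<close>

locale white_noise = prob_space M + filtration "space M" F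
  for M :: "'a measure" and F :: "real \<Rightarrow> 'a measure" +
  fixes W :: "(real \<times> real) set \<Rightarrow> 'a \<Rightarrow> real"
  assumes filtration_subalgebra: "\<And>t. subalgebra M (F t)"
    and noise_measurable: "\<And>A. A \<in> noise_sets \<Longrightarrow> random_variable borel (W A)"
    and noise_gaussian:
      "\<And>\<A> c. finite \<A> \<Longrightarrow> \<A> \<subseteq> noise_sets \<Longrightarrow>
         centered_normal M (\<lambda>\<omega>. \<Sum>A\<in>\<A>. c A * W A \<omega>)
           (\<Sum>A\<in>\<A>. \<Sum>B\<in>\<A>. c A * c B * measure lborel (A \<inter> B))"
    and noise_adapted:
      "\<And>t A. 0 \<le> t \<Longrightarrow> A \<in> noise_sets \<Longrightarrow> A \<subseteq> {0..t} \<times> UNIV \<Longrightarrow> W A \<in> borel_measurable (F t)"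
    and noise_independent:
      "\<And>t. 0 \<le> t \<Longrightarrow> indep_set (sets (F t))
         (sigma_sets (space M)
            {W A -` B \<inter> space M | A B. A \<in> noise_sets \<and> A \<subseteq> {t<..} \<times> UNIV \<and> B \<in> sets borel})"

section \<open>Walsh integral\<close>

text \<open>
  The list \<open>[(X\<^sub>i, a\<^sub>i, b\<^sub>i, A\<^sub>i)]\<close> stands for the simple random field
  \<open>(s, y, \<omega>) \<mapsto> \<Sum>\<^sub>i X\<^sub>i(\<omega>) 1\<^bsub>(a\<^sub>i, b\<^sub>i]\<^esub>(s) 1\<^bsub>A\<^sub>i\<^esub>(y)\<close>.
\<close>

type_synonym 'a simple_field = "(('a \<Rightarrow> real) \<times> real \<times> real \<times> real set) list"

definition simple_predictable :: "'a measure \<Rightarrow> (real \<Rightarrow> 'a measure) \<Rightarrow> 'a simple_field \<Rightarrow> bool" where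
  "simple_predictable M F \<phi> \<longleftrightarrow>
     (\<forall>(X, a, b, A) \<in> set \<phi>. 0 \<le> a \<and> a < b \<and> A \<in> sets borel \<and> emeasure lborel A < \<infinity> \<and>
        X \<in> borel_measurable (F a) \<and> (\<exists>C. \<forall>\<omega>\<in>space M. \<bar>X \<omega>\<bar> \<le> C))"

definition simple_value :: "'a simple_field \<Rightarrow> real \<Rightarrow> real \<Rightarrow> 'a \<Rightarrow> real" where
  "simple_value \<phi> s y \<omega> = (\<Sum>(X, a, b, A)\<leftarrow>\<phi>. X \<omega> * indicator {a<..b} s * indicator A y)"

definition simple_integral_W ::
    "((real \<times> real) set \<Rightarrow> 'a \<Rightarrow> real) \<Rightarrow> 'a simple_field \<Rightarrow> 'a \<Rightarrow> real" where
  "simple_integral_W W \<phi> \<omega> = (\<Sum>(X, a, b, A)\<leftarrow>\<phi>. X \<omega> * W ({a<..b} \<times> A) \<omega>)"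

definition open_half_plane :: "(real \<times> real) measure" where
  "open_half_plane = restrict_space lborel ({0<..} \<times> UNIV)"

text \<open>
  \<open>I\<close> is (a version of) the integral of \<open>f\<close> over \<open>\<real>\<^sub>+ \<times> \<real>\<close> against \<open>W\<close>: the \<open>L\<^sup>2(\<Omega>)\<close>-limit of the
  integrals of simple predictable fields converging to \<open>f\<close> in \<open>L\<^sup>2(ds dy dP)\<close>.
\<close>

definition has_walsh_integral ::
    "'a measure \<Rightarrow> (real \<Rightarrow> 'a measure) \<Rightarrow> ((real \<times> real) set \<Rightarrow> 'a \<Rightarrow> real) \<Rightarrow>
     (real \<Rightarrow> real \<Rightarrow> 'a \<Rightarrow> real) \<Rightarrow> ('a \<Rightarrow> real) \<Rightarrow> bool" where
  "has_walsh_integral M F W f I \<longleftrightarrow>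
     (\<lambda>((s, y), \<omega>). f s y \<omega>) \<in> borel_measurable (open_half_plane \<Otimes>\<^sub>M M) \<and>
     I \<in> borel_measurable M \<and>
     (\<exists>\<phi> :: nat \<Rightarrow> 'a simple_field.
        (\<forall>n. simple_predictable M F (\<phi> n)) \<and>
        (\<lambda>n. \<integral>\<^sup>+ ((s, y), \<omega>). ennreal ((simple_value (\<phi> n) s y \<omega> - f s y \<omega>)\<^sup>2)
               \<partial>(open_half_plane \<Otimes>\<^sub>M M)) \<longlonglongrightarrow> 0 \<and>
        (\<lambda>n. \<integral>\<^sup>+ \<omega>. ennreal ((simple_integral_W W (\<phi> n) \<omega> - I \<omega>)\<^sup>2) \<partial>M) \<longlonglongrightarrow> 0)"

section \<open>Mild solutions of the stochastic heat equation\<close>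

text \<open>
  The initial condition enters through \<open>J0\<close>, which encodes \<open>u(t, \<cdot>) \<rightarrow> \<mu>\<close> in the sense of
  distributions as \<open>t\<close> decreases to \<open>0\<close>. Values of \<open>u\<close> at times \<open>t \<le> 0\<close> play no role.
\<close>

definition mild_solution ::
    "'a measure \<Rightarrow> (real \<Rightarrow> 'a measure) \<Rightarrow> ((real \<times> real) set \<Rightarrow> 'a \<Rightarrow> real) \<Rightarrow>
     real \<Rightarrow> real \<Rightarrow> signed_measure \<Rightarrow> (real \<Rightarrow> real \<Rightarrow> 'a \<Rightarrow> real) \<Rightarrow> bool" where
  "mild_solution M F W \<nu> lam \<mu> u \<longleftrightarrow>
     (\<lambda>((t, x), \<omega>). u t x \<omega>) \<in> borel_measurable (open_half_plane \<Otimes>\<^sub>M M) \<and>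
     (\<forall>t>0. \<forall>x. u t x \<in> borel_measurable (F t)) \<and>
     (\<forall>t>0. \<forall>x. \<exists>I.
        has_walsh_integral M F W
          (\<lambda>s y \<omega>. indicator {0<..<t} s * (heat_kernel \<nu> (t - s) (x - y) * (lam * u s y \<omega>))) I \<and>
        (AE \<omega> in M. u t x \<omega> = J0 \<nu> \<mu> t x + I \<omega>))"

definition Lp_norm :: "'a measure \<Rightarrow> real \<Rightarrow> ('a \<Rightarrow> real) \<Rightarrow> real" where
  "Lp_norm M p X = (\<integral>\<omega>. \<bar>X \<omega>\<bar> powr p \<partial>M) powr (1 / p)"

end

theory Submission
  imports Defs "HOL-Real_Asymp.Real_Asymp"
begin

text \<open>
  Write \<open>\<lambda>\<close> for \<open>lam\<close>, and \<open>G\<close>, \<open>q\<close>, \<open>p\<close> for the heat kernels with parameter \<open>\<nu>\<close>, \<open>2\<nu>\<close>, \<open>\<nu>/2\<close>. By the isometry of the Walsh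
  integral, the mild formulation turns into an equation for second moments:
  \<open>E[u(t,x\<^sub>1)u(t,x\<^sub>2)] = J\<^sub>0(t,x\<^sub>1)J\<^sub>0(t,x\<^sub>2) + \<lambda>\<^sup>2 \<integral>\<integral> G(t-s,x\<^sub>1-y) G(t-s,x\<^sub>2-y) E[u(s,y)\<^sup>2] dy ds\<close>
  (\<open>mild_solution_Duhamel\<close>). For \<open>x\<^sub>1 = x\<^sub>2\<close> it is a closed linear Volterra equation for \<open>E[u\<^sup>2]\<close>, and its
  solution determines the right-hand side for all \<open>x\<^sub>1, x\<^sub>2\<close>. So it suffices to know that the equation
  has at most one solution, and that the proposed kernel solves it.

  The kernel solves it (\<open>K_star_Duhamel\<close>). Since \<open>G(t,a)G(t,b) = q(t,a-b) p(t,(a+b)/2)\<close>, the integral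
  over \<open>y\<close> is a convolution of two \<open>p\<close>'s, and only an identity in time is left: with \<open>\<kappa> = \<lambda>\<^sup>2/(2\<nu>)\<close> and
  \<open>H(t,w) = \<integral>\<^bsub>v \<ge> w\<^esub> exp(\<kappa>(v-w)) q(t,v) dv\<close>, which is the exponential times \<open>\<Phi>\<close> in \<open>K\<^sup>\<dagger>\<close>,
  \<open>\<integral>\<^sub>0\<^sup>t q(t-s,a) (q(s,b) + \<kappa> H(s,b)) ds = H(t,a+b)/(2\<nu>)\<close> for \<open>a, b \<ge> 0\<close> (\<open>renewal_tilted_tail\<close>).
  Integrating by parts, \<open>q(s,b) + \<kappa> H(s,b)\<close> is an exponential mixture over \<open>v \<ge> b\<close> of \<open>v/(2\<nu>s) q(s,v)\<close>,
  that is, of \<open>1/(2\<nu>)\<close> times the density of the first time at which a Brownian motion reaches the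
  level \<open>v\<close>. By the strong Markov property such a density convolved with \<open>q(\<sqdot>,a)\<close> gives \<open>q(t,a+v)\<close>
  (\<open>hitting_time_convolution\<close>); integrating over \<open>v\<close> gives \<open>H(t,a+b)/(2\<nu>)\<close>.

  Uniqueness (\<open>Volterra_inequality_imp_zero\<close>) requires only that the integral in the equation is
  finite. For \<open>E[u\<^sup>2]\<close> this is part of the existence of the stochastic integral in the mild
  formulation; for the candidate it follows from \<open>K\<^sup>\<dagger>(t,z\<^sub>1,z\<^sub>2,y) \<le> C\<^sub>t G(t,z\<^sub>1) G(t,z\<^sub>2)\<close>
  (\<open>K_dag_le\<close>) and the growth condition on \<open>\<mu>\<close>. A signed \<open>\<mu>\<close> is treated by applying the results for
  non-negative kernels to the four pairs of parts of the Jordan decomposition.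
\<close>

section \<open>The normal distribution function\<close>

lemma std_normal_density_eq: "(2 * pi) powr (-1/2) * exp (- y\<^sup>2 / 2) = std_normal_density y"
  by (simp add: std_normal_density_def powr_minus powr_half_sqrt[symmetric] divide_simps)

lemma set_integrable_std_normal: "A \<in> sets borel \<Longrightarrow> set_integrable lborel A std_normal_density"
  unfolding set_integrable_def
  by (rule integrable_mult_indicator) auto

lemma Phi_eq_cdf: "Phi x = cdf std_normal_distribution x"
proof -
  have i: "integrable lborel (\<lambda>y. indicator {..x} y *\<^sub>R std_normal_density y)"
    using set_integrable_std_normal[of "{..x}"] by (simp add: set_integrable_def)
  have "emeasure std_normal_distribution {..x} = (\<integral>\<^sup>+y. ennreal (indicator {..x} y *\<^sub>R std_normal_density y) \<partial>lborel)"
    by (subst emeasure_density) (auto intro!: nn_integral_cong simp: indicator_def)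
  also have "\<dots> = ennreal (LBINT y:{..x}. std_normal_density y)"
    unfolding set_lebesgue_integral_def
    by (rule nn_integral_eq_integral[OF i]) auto
  finally show ?thesis
    unfolding Phi_def cdf_def measure_def std_normal_density_eq
    by (simp add: set_lebesgue_integral_def integral_nonneg_AE)
qed

lemma Phi_at_top: "(Phi \<longlongrightarrow> 1) at_top"
  unfolding Phi_eq_cdf[abs_def]
  using real_distribution.cdf_lim_at_top_prob[OF real_dist_normal_dist] by simp

lemma Phi_at_bot: "(Phi \<longlongrightarrow> 0) at_bot"
  unfolding Phi_eq_cdf[abs_def]
  using finite_borel_measure.cdf_lim_at_bot[of std_normal_distribution] real_dist_normal_dist
  by (simp add: real_distribution.finite_borel_measure_M)

lemma mono_Phi: "mono Phi"
  unfolding Phi_eq_cdf[abs_def] mono_def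
  using finite_borel_measure.cdf_nondecreasing[of std_normal_distribution] real_dist_normal_dist
  by (auto simp add: real_distribution.finite_borel_measure_M)

lemma Phi_nonneg: "0 \<le> Phi x"
  unfolding Phi_eq_cdf cdf_def by simp

lemma measurable_Phi [measurable]: "Phi \<in> borel_measurable borel"
  by (rule borel_measurable_mono[OF mono_Phi])

lemma DERIV_Phi: "(Phi has_real_derivative std_normal_density x) (at x)"
proof -
  define a where "a = x - 1"
  have c: "continuous_on {a..x+1} std_normal_density"
    unfolding std_normal_density_def by (intro continuous_intros) auto
  have eq: "Phi z = Phi a + integral {a..z} std_normal_density" if "z \<ge> a" for z
  proof -
    have *: "{..z} = {..a} \<union> {a<..z}" using that by auto
    have "Phi z = (LBINT y:{..z}. std_normal_density y)"
      unfolding Phi_def std_normal_density_eq ..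
    also have "\<dots> = (LBINT y:{..a}. std_normal_density y) + (LBINT y:{a<..z}. std_normal_density y)"
      unfolding * by (rule set_integral_Un) (auto intro: set_integrable_std_normal)
    also have "(LBINT y:{a<..z}. std_normal_density y) = (LBINT y:{a..z}. std_normal_density y)"
      by (rule set_integral_cong_set)
        (auto simp: set_borel_measurable_def intro!: AE_I[where N="{a}"] split: split_indicator)
    also have "\<dots> = integral {a..z} std_normal_density"
      by (rule set_borel_integral_eq_integral) (auto intro: set_integrable_std_normal)
    finally show ?thesis
      unfolding Phi_def std_normal_density_eq .
  qed
  have "((\<lambda>z. integral {a..z} std_normal_density) has_real_derivative std_normal_density x) (at x within {a..x+1})"
    by (rule integral_has_real_derivative[OF c]) (auto simp: a_def)
  hence "((\<lambda>z. Phi a + integral {a..z} std_normal_density) has_real_derivative std_normal_density x) (at x within {a..x+1})"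
    using DERIV_add[OF DERIV_const] by fastforce
  hence "((\<lambda>z. Phi a + integral {a..z} std_normal_density) has_real_derivative std_normal_density x) (at x)"
    by (subst (asm) at_within_interior) (auto simp: a_def)
  moreover have "\<forall>\<^sub>F z in nhds x. Phi z = Phi a + integral {a..z} std_normal_density"
  proof (rule eventually_mono)
    show "\<forall>\<^sub>F z in nhds x. z \<in> {a<..}"
      by (rule eventually_nhds_in_open) (auto simp: a_def)
  qed (rule eq, simp)
  ultimately show ?thesis
    by (subst DERIV_cong_ev[OF refl _ refl])
qed

lemmas DERIV_Phi_chain = DERIV_chain2[OF DERIV_Phi]

lemma Phi_uminus: "Phi (- x) = 1 - Phi x"
proof -
  have "((\<lambda>x. Phi x + Phi (- x)) has_real_derivative 0) (at y)" for y
    by (rule derivative_eq_intros DERIV_Phi_chain | simp add: std_normal_density_def)+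
  hence c: "Phi y + Phi (- y) = Phi x + Phi (- x)" for y
    using DERIV_isconst_all[of "\<lambda>x. Phi x + Phi (- x)"] by blast
  have "((\<lambda>y. Phi y + Phi (- y)) \<longlongrightarrow> 1 + 0) at_top"
    by (intro tendsto_add Phi_at_top filterlim_compose[OF Phi_at_bot] filterlim_uminus_at_bot_at_top)
  hence "((\<lambda>y. Phi x + Phi (- x)) \<longlongrightarrow> 1) (at_top :: real filter)"
    unfolding add_0_right by (rule Lim_transform_eventually) (auto intro!: always_eventually c)
  hence "Phi x + Phi (- x) = 1" by (simp add: tendsto_const_iff)
  thus ?thesis by simp
qed

section \<open>The heat kernel\<close>

lemma heat_kernel_eq_normal:
  "0 < \<nu> \<Longrightarrow> 0 < t \<Longrightarrow> heat_kernel \<nu> t x = normal_density 0 (sqrt (\<nu> * t)) x"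
  by (simp add: heat_kernel_def normal_density_def mult.assoc)

lemma measurable_heat_kernel [measurable (raw)]:
  assumes [measurable]: "f \<in> borel_measurable M" "g \<in> borel_measurable M"
  shows "(\<lambda>x. heat_kernel \<nu> (f x) (g x)) \<in> borel_measurable M"
  unfolding heat_kernel_def by (intro borel_measurable_times borel_measurable_divide measurable_compose[OF _ borel_measurable_exp] borel_measurable_uminus borel_measurable_power measurable_compose[OF _ borel_measurable_sqrt] borel_measurable_const assms)

lemma heat_kernel_nonneg: "0 \<le> \<nu> \<Longrightarrow> 0 \<le> t \<Longrightarrow> 0 \<le> heat_kernel \<nu> t x"
  unfolding heat_kernel_def by simp

text \<open>
  For independent centred Gaussians of equal variance, the difference and the mean are independent;
  this separates the two-point problem into a relative motion and a centre of mass.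
\<close>

lemma heat_kernel_mult:
  assumes "0 < \<nu>" "0 < t"
  shows "heat_kernel \<nu> t a * heat_kernel \<nu> t b
    = heat_kernel (2 * \<nu>) t (a - b) * heat_kernel (\<nu> / 2) t ((a + b) / 2)"
proof -
  have "a\<^sup>2 / (2 * \<nu> * t) + b\<^sup>2 / (2 * \<nu> * t)
    = (a - b)\<^sup>2 / (2 * (2 * \<nu>) * t) + ((a + b) / 2)\<^sup>2 / (2 * (\<nu> / 2) * t)"
    using assms by (simp add: field_simps power2_eq_square)
  moreover have "sqrt (2 * pi * \<nu> * t) * sqrt (2 * pi * \<nu> * t)
     = sqrt (2 * pi * (2 * \<nu>) * t) * sqrt (2 * pi * (\<nu> / 2) * t)"
    unfolding real_sqrt_mult[symmetric] by (simp add: algebra_simps)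
  ultimately show ?thesis
    unfolding heat_kernel_def by (simp add: exp_add[symmetric] del: real_sqrt_mult_self)
qed

lemma heat_kernel_convolution:
  assumes "0 < \<nu>" "0 < s" "0 < r"
  shows "(\<integral>\<^sup>+y. ennreal (heat_kernel \<nu> s (x - y) * heat_kernel \<nu> r (y - z)) \<partial>lborel)
    = ennreal (heat_kernel \<nu> (s + r) (x - z))"
proof -
  have "(\<integral>\<^sup>+y. ennreal (heat_kernel \<nu> s (x - y) * heat_kernel \<nu> r (y - z)) \<partial>lborel)
    = (\<integral>\<^sup>+y. ennreal (heat_kernel \<nu> s (x - z - y) * heat_kernel \<nu> r y) \<partial>lborel)"
    by (subst nn_integral_real_affine[where c=1 and t=z]) (auto simp: algebra_simps)
  also have "\<dots> = ennreal (heat_kernel \<nu> (s + r) (x - z))"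
    using assms conv_normal_density_zero_mean[of "sqrt (\<nu> * s)" "sqrt (\<nu> * r)", THEN fun_cong, of "x - z"]
    by (simp add: heat_kernel_eq_normal distrib_left)
  finally show ?thesis .
qed


section \<open>First passage times and tilted Gaussian tails\<close>

lemma nn_integral_FTC_open:
  fixes F f :: "real \<Rightarrow> real"
  assumes "a < b"
    and D: "\<And>x. a < x \<Longrightarrow> x < b \<Longrightarrow> (F has_real_derivative f x) (at x)"
    and C: "\<And>x. a < x \<Longrightarrow> x < b \<Longrightarrow> isCont f x"
    and N: "\<And>x. a < x \<Longrightarrow> x < b \<Longrightarrow> 0 \<le> f x"
    and A: "(F \<longlongrightarrow> A) (at_right a)" and B: "(F \<longlongrightarrow> B) (at_left b)"
  shows "(\<integral>\<^sup>+x\<in>{a<..<b}. ennreal (f x) \<partial>lborel) = ennreal (B - A)"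
proof -
  have l: "((F \<circ> real_of_ereal) \<longlongrightarrow> A) (at_right (ereal a))" "((F \<circ> real_of_ereal) \<longlongrightarrow> B) (at_left (ereal b))"
    using A B by (simp_all add: ereal_tendsto_simps)
  have ab: "ereal a < ereal b" using \<open>a < b\<close> by simp
  have i: "set_integrable lborel {a<..<b} f"
    using interval_integral_FTC_nonneg(1)[OF ab _ _ _ l] D C N by simp
  have v: "(LBINT x=ereal a..ereal b. f x) = B - A"
    using interval_integral_FTC_nonneg(2)[OF ab _ _ _ l] D C N by simp
  have "(\<integral>\<^sup>+x\<in>{a<..<b}. ennreal (f x) \<partial>lborel) = (\<integral>\<^sup>+x. ennreal (indicator {a<..<b} x *\<^sub>R f x) \<partial>lborel)"
    by (intro nn_integral_cong) (auto simp: indicator_def)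
  also have "\<dots> = ennreal (\<integral>x. indicator {a<..<b} x *\<^sub>R f x \<partial>lborel)"
    using i N by (intro nn_integral_eq_integral) (auto simp: set_integrable_def indicator_def)
  also have "(\<integral>x. indicator {a<..<b} x *\<^sub>R f x \<partial>lborel) = B - A"
    using v ab by (simp add: interval_lebesgue_integral_def set_lebesgue_integral_def)
  finally show ?thesis .
qed

text \<open>
  For a Brownian motion with variance rate \<open>c\<close>, \<open>v / s * heat_kernel c s v\<close> is the density of the
  first passage time of the level \<open>v > 0\<close>. Reaching \<open>v + a\<close> at time \<open>t\<close> forces a passage through \<open>v\<close>
  at some \<open>s < t\<close>, which is the identity below. The proof exhibits a primitive of the integrand. With
  \<open>p = sqrt ((t - s) / s)\<close> the quadratic form in the exponent is
  \<open>a\<^sup>2/(t-s) + v\<^sup>2/s = (a+v)\<^sup>2/t + (vp - a/p)\<^sup>2/t\<close>, and \<open>exp (2av/\<sigma>\<^sup>2)\<close> times the Gaussian at \<open>(vp + a/p)/\<sigma>\<close>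
  equals the Gaussian at \<open>(vp - a/p)/\<sigma>\<close>; in the derivative of the combination \<open>F\<close> the terms with \<open>a/p\<^sup>2\<close>
  therefore cancel.
\<close>

lemma hitting_time_convolution:
  assumes c: "0 < c" and t: "0 < t" and a: "0 \<le> a" and v: "0 < v"
  shows "(\<integral>\<^sup>+s\<in>{0<..<t}. ennreal (heat_kernel c (t - s) a * (v / s * heat_kernel c s v)) \<partial>lborel)
    = ennreal (heat_kernel c t (a + v))"
proof -
  define \<sigma> where "\<sigma> = sqrt (c * t)"
  have \<sigma>: "0 < \<sigma>" "\<sigma>\<^sup>2 = c * t" using c t by (auto simp: \<sigma>_def)
  define p where "p = (\<lambda>s. sqrt ((t - s) / s))"
  define F where "F = (\<lambda>s. exp (2 * a * v / \<sigma>\<^sup>2) * Phi (- ((v * p s + a / p s) / \<sigma>)) - Phi ((v * p s - a / p s) / \<sigma>))"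
  define f where "f = (\<lambda>s. heat_kernel c (t - s) a * (v / s * heat_kernel c s v))"
  let ?q = "heat_kernel c t (a + v)"
  have D: "((\<lambda>s. ?q * F s) has_real_derivative f s) (at s)" if s: "0 < s" "s < t" for s
  proof -
    have p: "0 < p s" and p2: "(p s)\<^sup>2 = (t - s) / s" using s by (auto simp: p_def)
    define p' where "p' = - t / (2 * p s * s\<^sup>2)"
    have dp: "(p has_real_derivative p') (at s)"
    proof -
      have "((\<lambda>s. (t - s) / s) has_real_derivative - t / s\<^sup>2) (at s)"
        using s by (auto intro!: derivative_eq_intros simp: field_simps power2_eq_square)
      from DERIV_chain2[OF DERIV_real_sqrt this] s show ?thesis
        unfolding p_def p'_def by (simp add: field_simps)
    qed
    let ?g = "std_normal_density ((v * p s - a / p s) / \<sigma>)"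
    have g: "exp (2 * a * v / \<sigma>\<^sup>2) * std_normal_density (- ((v * p s + a / p s) / \<sigma>)) = ?g"
    proof -
      have "2 * a * v / \<sigma>\<^sup>2 + (- ((v * p s + a / p s) / \<sigma>)\<^sup>2 / 2) = - ((v * p s - a / p s) / \<sigma>)\<^sup>2 / 2"
        using p \<sigma>(1) by (simp add: field_simps power2_eq_square)
      thus ?thesis unfolding std_normal_density_def by (simp add: exp_add[symmetric])
    qed
    have "(F has_real_derivative exp (2 * a * v / \<sigma>\<^sup>2) * (std_normal_density (- ((v * p s + a / p s) / \<sigma>)) * (- ((v * p' - a * p' / (p s)\<^sup>2) / \<sigma>)))
        - ?g * ((v * p' + a * p' / (p s)\<^sup>2) / \<sigma>)) (at s)"
      unfolding F_def using p \<sigma>(1)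
      by (auto intro!: derivative_eq_intros DERIV_Phi_chain dp simp: power2_eq_square mult_ac)
    also have "exp (2 * a * v / \<sigma>\<^sup>2) * (std_normal_density (- ((v * p s + a / p s) / \<sigma>)) * (- ((v * p' - a * p' / (p s)\<^sup>2) / \<sigma>)))
        - ?g * ((v * p' + a * p' / (p s)\<^sup>2) / \<sigma>) = - 2 * v * p' / \<sigma> * ?g"
      unfolding mult.assoc[symmetric] g using \<sigma> by (simp add: field_simps)
    finally have F: "(F has_real_derivative - 2 * v * p' / \<sigma> * ?g) (at s)" .
    have "?q * (- 2 * v * p' / \<sigma> * ?g) = f s"
    proof -
      have ps: "p s * s = sqrt (t - s) * sqrt s"
        using s by (simp add: p_def real_sqrt_divide field_simps)
      have e: "- ((a + v)\<^sup>2 / (2 * c * t)) + (- ((v * p s - a / p s) / \<sigma>)\<^sup>2 / 2)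
        = - (a\<^sup>2 / (2 * c * (t - s))) + (- (v\<^sup>2 / (2 * c * s)))"
      proof -
        have "((v * p s - a / p s) / \<sigma>)\<^sup>2 = (v\<^sup>2 * (p s)\<^sup>2 - 2 * a * v + a\<^sup>2 / (p s)\<^sup>2) / (c * t)"
          using p unfolding \<sigma>(2)[symmetric] by (simp add: field_simps power2_eq_square)
        also have "\<dots> = (v\<^sup>2 * ((t - s) / s) - 2 * a * v + a\<^sup>2 / ((t - s) / s)) / (c * t)"
          unfolding p2 ..
        finally have Y: "((v * p s - a / p s) / \<sigma>)\<^sup>2 = (v\<^sup>2 * ((t - s) / s) - 2 * a * v + a\<^sup>2 / ((t - s) / s)) / (c * t)" .
        show ?thesis unfolding Y using s c t by (simp add: divide_simps) (simp add: algebra_simps power2_eq_square)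
      qed
      have "?q * (- 2 * v * p' / \<sigma> * ?g) =
        (1 / sqrt (2 * pi * c * t) * (- 2 * v * p' / \<sigma>) * (1 / sqrt (2 * pi))) *
        exp (- ((a + v)\<^sup>2 / (2 * c * t)) + (- ((v * p s - a / p s) / \<sigma>)\<^sup>2 / 2))"
        unfolding heat_kernel_def std_normal_density_def exp_add by (simp only: mult_ac)
      also have "1 / sqrt (2 * pi * c * t) * (- 2 * v * p' / \<sigma>) * (1 / sqrt (2 * pi))
        = 1 / sqrt (2 * pi * c * (t - s)) * (v / s * (1 / sqrt (2 * pi * c * s)))" (is "?L = _")
      proof -
        have "1 / sqrt (2 * pi * c * t) * (- 2 * v * p' / \<sigma>) * (1 / sqrt (2 * pi))
          = v * t / ((p s * s) * s * (sqrt (2 * pi) * sqrt (2 * pi)) * (sqrt (c * t) * sqrt (c * t)))"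
        proof -
          have "1 / (A * B) * (- 2 * v * (- t / (2 * P * s\<^sup>2)) / B) * (1 / A) = v * t / ((P * s) * s * (A * A) * (B * B))"
            if "A \<noteq> 0" "B \<noteq> 0" "P \<noteq> 0" for A B P :: real
            using that s by (simp add: field_simps power2_eq_square)
          from this[of "sqrt (2 * pi)" "sqrt (c * t)" "p s"] show ?thesis
            unfolding p'_def \<sigma>_def using p c t by (simp only: real_sqrt_mult mult.assoc) simp
        qed
        also have "\<dots> = v / (p s * s * s * (2 * pi * c))"
          using s c t by simp
        also have "\<dots> = v / (sqrt (t - s) * sqrt s * s * (sqrt (2 * pi * c) * sqrt (2 * pi * c)))"
          unfolding ps using c by simp
        finally have Z: "?L = v / (sqrt (t - s) * sqrt s * s * (sqrt (2 * pi * c) * sqrt (2 * pi * c)))" .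
        have "v / (A * B * s * (C * C)) = 1 / (C * A) * (v / s * (1 / (C * B)))" for A B C :: real
          by (simp add: mult_ac)
        thus ?thesis unfolding Z unfolding real_sqrt_mult[of "2 * pi * c"] by (simp only:)
      qed
      finally show ?thesis unfolding e unfolding f_def heat_kernel_def exp_add by (simp only: mult_ac)
    qed
    thus ?thesis using DERIV_cmult[OF F, of ?q] by simp
  qed
  have C: "isCont f s" if "0 < s" "s < t" for s
    unfolding f_def heat_kernel_def using that c by (auto intro!: continuous_intros)
  have N: "0 \<le> f s" if "0 < s" "s < t" for s
    unfolding f_def using that c v by (intro mult_nonneg_nonneg divide_nonneg_nonneg heat_kernel_nonneg) auto
  have p0: "filterlim p at_top (at_right 0)" unfolding p_def using t by real_asymp
  have pt: "filterlim p (at_right 0) (at_left t)" unfolding p_def using t by real_asymp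
  have L: "(F \<longlongrightarrow> exp (2 * a * v / \<sigma>\<^sup>2) * 0 - 1) (at_right 0)"
  proof -
    have 1: "filterlim (\<lambda>p. (v * p - a / p) / \<sigma>) at_top at_top" using v \<sigma>(1) by real_asymp
    have 2: "filterlim (\<lambda>p. - ((v * p + a / p) / \<sigma>)) at_bot at_top" using v \<sigma>(1) by real_asymp
    show ?thesis unfolding F_def
      by (intro tendsto_diff tendsto_mult tendsto_const filterlim_compose[OF Phi_at_bot] filterlim_compose[OF Phi_at_top]
         filterlim_compose[OF 1 p0] filterlim_compose[OF 2 p0])
  qed
  \<comment> \<open>For \<open>a = 0\<close> both arguments of \<open>Phi\<close> tend to \<open>0\<close>, otherwise both tend to \<open>-\<infinity>\<close>.\<close>
  have R: "(F \<longlongrightarrow> 0) (at_left t)"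
  proof (cases "a = 0")
    case True
    have "((\<lambda>p. (v * p) / \<sigma>) \<longlongrightarrow> 0) (at_right 0)" "((\<lambda>p. - (v * p) / \<sigma>) \<longlongrightarrow> 0) (at_right 0)"
      using \<sigma>(1) by real_asymp+
    note * = this[THEN filterlim_compose, OF pt]
    have "((\<lambda>s. Phi (- (v * p s) / \<sigma>) - Phi ((v * p s) / \<sigma>)) \<longlongrightarrow> Phi 0 - Phi 0) (at_left t)"
      by (intro tendsto_diff isCont_tendsto_compose[OF DERIV_isCont[OF DERIV_Phi]] *)
    hence "(F \<longlongrightarrow> Phi 0 - Phi 0) (at_left t)"
      unfolding F_def using True by simp
    thus ?thesis by simp
  next
    case False
    with a have a: "0 < a" by simp
    have 1: "filterlim (\<lambda>p. (v * p - a / p) / \<sigma>) at_bot (at_right 0)" using a v \<sigma>(1) by real_asymp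
    have 2: "filterlim (\<lambda>p. - ((v * p + a / p) / \<sigma>)) at_bot (at_right 0)" using a v \<sigma>(1) by real_asymp
    have "(F \<longlongrightarrow> exp (2 * a * v / \<sigma>\<^sup>2) * 0 - 0) (at_left t)" unfolding F_def
      by (intro tendsto_diff tendsto_mult tendsto_const filterlim_compose[OF Phi_at_bot]
         filterlim_compose[OF 1 pt] filterlim_compose[OF 2 pt])
    thus ?thesis by simp
  qed
  have "(\<integral>\<^sup>+s\<in>{0<..<t}. ennreal (f s) \<partial>lborel) = ennreal (?q * 0 - ?q * (exp (2 * a * v / \<sigma>\<^sup>2) * 0 - 1))"
    by (rule nn_integral_FTC_open[OF t D C N tendsto_mult_left[OF L] tendsto_mult_left[OF R]])
  thus ?thesis unfolding f_def by simp
qed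

text \<open>
  With \<open>q = heat_kernel c t\<close>, this is the exponentially tilted tail \<open>\<integral>\<^bsub>v \<ge> w\<^esub> exp (\<kappa> (v - w)) q v dv\<close> with
  the square completed (\<open>nn_integral_tilted_tail\<close>). For \<open>c = 2\<nu>\<close> and \<open>\<kappa> = \<lambda>\<^sup>2/(2\<nu>)\<close> it is the product of the
  exponential and \<open>\<Phi>\<close> in \<open>K_dag\<close>.
\<close>

definition tilted_tail :: "real \<Rightarrow> real \<Rightarrow> real \<Rightarrow> real \<Rightarrow> real" where
  "tilted_tail c \<kappa> t w = exp (\<kappa>\<^sup>2 * c * t / 2 - \<kappa> * w) * Phi ((\<kappa> * c * t - w) / sqrt (c * t))"

lemma tilted_tail_nonneg: "0 \<le> tilted_tail c \<kappa> t w"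
  by (simp add: tilted_tail_def Phi_nonneg)

lemma measurable_tilted_tail [measurable (raw)]:
  assumes [measurable]: "f \<in> borel_measurable M" "g \<in> borel_measurable M"
  shows "(\<lambda>x. tilted_tail c \<kappa> (f x) (g x)) \<in> borel_measurable M"
  unfolding tilted_tail_def by measurable

text \<open>
  Completing the square turns the tilted Gaussian into \<open>exp (\<kappa>\<^sup>2 c t/2 - \<kappa> w)\<close> times the Gaussian of
  variance \<open>c t\<close> centred at \<open>\<kappa> c t\<close>, so a primitive is a multiple of \<open>Phi\<close>.
\<close>

lemma
  assumes c: "0 < c" and t: "0 < t"
  shows DERIV_tilted_tail: "((\<lambda>v. exp (\<kappa>\<^sup>2 * c * t / 2 - \<kappa> * w) * Phi ((v - \<kappa> * c * t) / sqrt (c * t)))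
    has_real_derivative exp (\<kappa> * (v - w)) * heat_kernel c t v) (at v)"
    and tilted_tail_lim: "((\<lambda>v. exp (\<kappa>\<^sup>2 * c * t / 2 - \<kappa> * w) * Phi ((v - \<kappa> * c * t) / sqrt (c * t)))
      \<longlongrightarrow> exp (\<kappa>\<^sup>2 * c * t / 2 - \<kappa> * w)) at_top"
    and tilted_tail_diff: "exp (\<kappa>\<^sup>2 * c * t / 2 - \<kappa> * w) - exp (\<kappa>\<^sup>2 * c * t / 2 - \<kappa> * w) * Phi ((w - \<kappa> * c * t) / sqrt (c * t))
      = tilted_tail c \<kappa> t w"
proof -
  define \<sigma> where "\<sigma> = sqrt (c * t)"
  have \<sigma>: "0 < \<sigma>" "\<sigma>\<^sup>2 = c * t" using c t by (auto simp: \<sigma>_def)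
  have e: "\<kappa>\<^sup>2 * c * t / 2 - \<kappa> * w + (- ((v - \<kappa> * c * t) / \<sigma>)\<^sup>2 / 2) = \<kappa> * (v - w) + (- (v\<^sup>2 / (2 * c * t)))"
    unfolding power_divide \<sigma>(2) using c t by (simp add: divide_simps) (simp add: algebra_simps power2_eq_square)
  have *: "exp (\<kappa>\<^sup>2 * c * t / 2 - \<kappa> * w) * (std_normal_density ((v - \<kappa> * c * t) / \<sigma>) * (1 / \<sigma>)) = exp (\<kappa> * (v - w)) * heat_kernel c t v"
  proof -
    have "exp (\<kappa>\<^sup>2 * c * t / 2 - \<kappa> * w) * (std_normal_density ((v - \<kappa> * c * t) / \<sigma>) * (1 / \<sigma>))
      = (1 / sqrt (2 * pi) * (1 / \<sigma>)) * exp (\<kappa>\<^sup>2 * c * t / 2 - \<kappa> * w + (- ((v - \<kappa> * c * t) / \<sigma>)\<^sup>2 / 2))"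
      unfolding std_normal_density_def exp_add by (simp only: mult_ac)
    also have "1 / sqrt (2 * pi) * (1 / \<sigma>) = 1 / sqrt (2 * pi * c * t)"
      by (simp add: \<sigma>_def real_sqrt_mult)
    finally show ?thesis unfolding e unfolding heat_kernel_def exp_add by (simp only: mult_ac)
  qed
  show "((\<lambda>v. exp (\<kappa>\<^sup>2 * c * t / 2 - \<kappa> * w) * Phi ((v - \<kappa> * c * t) / sqrt (c * t)))
    has_real_derivative exp (\<kappa> * (v - w)) * heat_kernel c t v) (at v)"
    unfolding \<sigma>_def[symmetric] unfolding *[symmetric]
    by (intro DERIV_cmult DERIV_Phi_chain) (use \<sigma> in \<open>auto intro!: derivative_eq_intros\<close>)
  have "filterlim (\<lambda>v. (v - \<kappa> * c * t) / \<sigma>) at_top at_top" using \<sigma>(1) by real_asymp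
  from tendsto_mult_left[OF filterlim_compose[OF Phi_at_top this], of "exp (\<kappa>\<^sup>2 * c * t / 2 - \<kappa> * w)"]
  show "((\<lambda>v. exp (\<kappa>\<^sup>2 * c * t / 2 - \<kappa> * w) * Phi ((v - \<kappa> * c * t) / sqrt (c * t)))
      \<longlongrightarrow> exp (\<kappa>\<^sup>2 * c * t / 2 - \<kappa> * w)) at_top"
    by (simp add: \<sigma>_def)
  have "Phi ((\<kappa> * c * t - w) / sqrt (c * t)) = 1 - Phi ((w - \<kappa> * c * t) / sqrt (c * t))"
    unfolding Phi_uminus[symmetric] by (simp add: minus_divide_left)
  note P = this
  show "exp (\<kappa>\<^sup>2 * c * t / 2 - \<kappa> * w) - exp (\<kappa>\<^sup>2 * c * t / 2 - \<kappa> * w) * Phi ((w - \<kappa> * c * t) / sqrt (c * t))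
      = tilted_tail c \<kappa> t w"
    unfolding tilted_tail_def P by (simp only: right_diff_distrib mult_1_right)
qed

lemma nn_integral_tilted_tail:
  assumes c: "0 < c" and t: "0 < t"
  shows "(\<integral>\<^sup>+v\<in>{w..}. ennreal (exp (\<kappa> * (v - w)) * heat_kernel c t v) \<partial>lborel) = ennreal (tilted_tail c \<kappa> t w)"
proof -
  let ?E = "exp (\<kappa>\<^sup>2 * c * t / 2 - \<kappa> * w)"
  have "(\<integral>\<^sup>+v\<in>{w..}. ennreal (exp (\<kappa> * (v - w)) * heat_kernel c t v) \<partial>lborel)
    = ennreal (?E - ?E * Phi ((w - \<kappa> * c * t) / sqrt (c * t)))"
  proof (rule nn_integral_FTC_atLeast[where F="\<lambda>v. ?E * Phi ((v - \<kappa> * c * t) / sqrt (c * t))" and T="?E"])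
    show "((\<lambda>v. ?E * Phi ((v - \<kappa> * c * t) / sqrt (c * t))) \<longlongrightarrow> ?E) at_top"
      by (rule tilted_tail_lim[OF c t])
    show "((\<lambda>v. ?E * Phi ((v - \<kappa> * c * t) / sqrt (c * t))) has_real_derivative exp (\<kappa> * (x - w)) * heat_kernel c t x) (at x)" for x
      by (rule DERIV_tilted_tail[OF c t])
    show "0 \<le> exp (\<kappa> * (x - w)) * heat_kernel c t x" for x
      using c t by (intro mult_nonneg_nonneg heat_kernel_nonneg) auto
  qed measurable
  thus ?thesis unfolding tilted_tail_diff[OF c t] .
qed

text \<open>
  Integration by parts: \<open>v / (c * t) * q v\<close> is \<open>- q'\<close>, so the tilt contributes the boundary value
  \<open>q w\<close> and \<open>\<kappa>\<close> times the tilted tail. The right-hand side is the time factor of \<open>K_star\<close>; on the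
  left it appears as a mixture of first passage densities.
\<close>

lemma nn_integral_tilted_hitting_density:
  assumes c: "0 < c" and t: "0 < t" and \<kappa>: "0 \<le> \<kappa>" and w: "0 \<le> w"
  shows "(\<integral>\<^sup>+v\<in>{w..}. ennreal (exp (\<kappa> * (v - w)) * (v / (c * t) * heat_kernel c t v)) \<partial>lborel)
    = ennreal (heat_kernel c t w + \<kappa> * tilted_tail c \<kappa> t w)"
proof -
  let ?E = "exp (\<kappa>\<^sup>2 * c * t / 2 - \<kappa> * w)"
  let ?P = "\<lambda>v. ?E * Phi ((v - \<kappa> * c * t) / sqrt (c * t))"
  let ?F = "\<lambda>v. \<kappa> * ?P v - exp (\<kappa> * (v - w)) * heat_kernel c t v"
  have D: "(?F has_real_derivative exp (\<kappa> * (v - w)) * (v / (c * t) * heat_kernel c t v)) (at v)" for v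
  proof -
    have "(heat_kernel c t has_real_derivative - (v / (c * t)) * heat_kernel c t v) (at v)"
    proof -
      have "((\<lambda>v. C * exp (- (v\<^sup>2 / (2 * c * t)))) has_real_derivative - (v / (c * t)) * (C * exp (- (v\<^sup>2 / (2 * c * t))))) (at v)" for C
        using c t by (auto intro!: derivative_eq_intros)
      thus ?thesis unfolding heat_kernel_def[abs_def] .
    qed
    note dq = this
    have dE: "((\<lambda>v. exp (\<kappa> * (v - w))) has_real_derivative \<kappa> * exp (\<kappa> * (v - w))) (at v)"
      by (auto intro!: derivative_eq_intros)
    from DERIV_diff[OF DERIV_cmult[OF DERIV_tilted_tail[OF c t], of \<kappa>] DERIV_mult[OF dE dq]]
    show ?thesis
      by (rule DERIV_cong) (simp add: algebra_simps)
  qed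
  have L: "(?F \<longlongrightarrow> \<kappa> * ?E - 0) at_top"
  proof (intro tendsto_diff tendsto_mult_left tilted_tail_lim[OF c t])
    show "((\<lambda>v. exp (\<kappa> * (v - w)) * heat_kernel c t v) \<longlongrightarrow> 0) at_top"
    proof -
      have "((\<lambda>v. exp (\<kappa> * (v - w)) * (C * exp (- (v\<^sup>2 / D)))) \<longlongrightarrow> 0) at_top" if "0 < D" for C D :: real
      proof -
        have "filterlim (\<lambda>v. \<kappa> * (v - w) - v\<^sup>2 / D) at_bot at_top"
          using that \<kappa> by (cases "\<kappa> = 0") (simp, real_asymp, real_asymp)
        from tendsto_mult_right_zero[OF filterlim_compose[OF exp_at_bot this], of C] show ?thesis
          by (simp add: exp_diff exp_minus divide_inverse mult_ac)
      qed
      from this[of "2 * c * t" "1 / sqrt (2 * pi * c * t)"] show ?thesis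
        unfolding heat_kernel_def using c t by simp
    qed
  qed
  have "(\<integral>\<^sup>+v\<in>{w..}. ennreal (exp (\<kappa> * (v - w)) * (v / (c * t) * heat_kernel c t v)) \<partial>lborel) = ennreal ((\<kappa> * ?E - 0) - ?F w)"
  proof (rule nn_integral_FTC_atLeast[OF _ D _ L])
    show "0 \<le> exp (\<kappa> * (v - w)) * (v / (c * t) * heat_kernel c t v)" if "w \<le> v" for v
      using c t w that by (intro mult_nonneg_nonneg divide_nonneg_nonneg heat_kernel_nonneg) auto
  qed measurable
  also have "(\<kappa> * ?E - 0) - ?F w = heat_kernel c t w + \<kappa> * tilted_tail c \<kappa> t w"
    unfolding tilted_tail_diff[OF c t, symmetric] by (simp add: algebra_simps)
  finally show ?thesis .
qed

text \<open>
  Write the second factor as a mixture of first passage densities over the levels \<open>v \<ge> b\<close>; each of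
  them convolves to \<open>heat_kernel c t (a + v)\<close>, and the mixture of these is the tilted tail from \<open>a + b\<close>.
\<close>

lemma renewal_tilted_tail:
  assumes c: "0 < c" and t: "0 < t" and \<kappa>: "0 \<le> \<kappa>" and a: "0 \<le> a" and b: "0 \<le> b"
  shows "(\<integral>\<^sup>+s\<in>{0<..<t}. ennreal (heat_kernel c (t - s) a * (heat_kernel c s b + \<kappa> * tilted_tail c \<kappa> s b)) \<partial>lborel)
    = ennreal (tilted_tail c \<kappa> t (a + b) / c)"
proof -
  let ?E = "\<lambda>v. exp (\<kappa> * (v - b))"
  let ?h = "\<lambda>s v. ennreal (?E v / c) * ennreal (heat_kernel c (t - s) a * (v / s * heat_kernel c s v))"
  have "(\<integral>\<^sup>+s\<in>{0<..<t}. ennreal (heat_kernel c (t - s) a * (heat_kernel c s b + \<kappa> * tilted_tail c \<kappa> s b)) \<partial>lborel)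
    = (\<integral>\<^sup>+s. \<integral>\<^sup>+v. ?h s v * indicator {b..} v * indicator {0<..<t} s \<partial>lborel \<partial>lborel)"
  proof (rule nn_integral_cong)
    fix s :: real
    show "ennreal (heat_kernel c (t - s) a * (heat_kernel c s b + \<kappa> * tilted_tail c \<kappa> s b)) * indicator {0<..<t} s =
      (\<integral>\<^sup>+v. ?h s v * indicator {b..} v * indicator {0<..<t} s \<partial>lborel)"
    proof (cases "s \<in> {0<..<t}")
      case True
      hence s: "0 < s" "s < t" by auto
      have "(\<integral>\<^sup>+v. ?h s v * indicator {b..} v \<partial>lborel) =
         (\<integral>\<^sup>+v. ennreal (heat_kernel c (t - s) a) * (ennreal (?E v * (v / (c * s) * heat_kernel c s v)) * indicator {b..} v) \<partial>lborel)"
        using s c b heat_kernel_nonneg[of c "t - s" a] heat_kernel_nonneg[of c s]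
        by (intro nn_integral_cong) (auto simp: ennreal_mult[symmetric] mult_ac indicator_def)
      also have "\<dots> = ennreal (heat_kernel c (t - s) a) * ennreal (heat_kernel c s b + \<kappa> * tilted_tail c \<kappa> s b)"
        by (subst nn_integral_cmult) (use nn_integral_tilted_hitting_density[OF c s(1) \<kappa> b] in auto)
      finally show ?thesis using True s c \<kappa>
        by (simp add: ennreal_mult heat_kernel_nonneg tilted_tail_nonneg)
    qed simp
  qed
  also have "\<dots> = (\<integral>\<^sup>+v. \<integral>\<^sup>+s. ?h s v * indicator {b..} v * indicator {0<..<t} s \<partial>lborel \<partial>lborel)"
    by (rule lborel_pair.Fubini') measurable
  also have "\<dots> = (\<integral>\<^sup>+v. ennreal (?E v / c * heat_kernel c t (a + v)) * indicator {b..} v \<partial>lborel)"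
  \<comment> \<open>The passage identity needs a level \<open>v > 0\<close>; for \<open>b = 0\<close> the point \<open>v = 0\<close> is discarded as a null set.\<close>
  proof (rule nn_integral_cong_AE, rule AE_mp[OF AE_lborel_singleton[of 0]], intro AE_I2 impI)
    fix v :: real assume "v \<noteq> 0"
    show "(\<integral>\<^sup>+s. ?h s v * indicator {b..} v * indicator {0<..<t} s \<partial>lborel) =
      ennreal (?E v / c * heat_kernel c t (a + v)) * indicator {b..} v"
    proof (cases "v \<in> {b..}")
      case True
      with b \<open>v \<noteq> 0\<close> have v: "0 < v" by auto
      have "(\<integral>\<^sup>+s. ?h s v * indicator {0<..<t} s \<partial>lborel) = ennreal (?E v / c) * ennreal (heat_kernel c t (a + v))"
        unfolding mult.assoc
        by (subst nn_integral_cmult) (use hitting_time_convolution[OF c t a v] in \<open>auto simp: mult.assoc\<close>)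
      with True show ?thesis using c t by (simp add: ennreal_mult[symmetric] heat_kernel_nonneg mult.assoc)
    qed simp
  qed
  also have "\<dots> = (\<integral>\<^sup>+v. ennreal (?E (v - a) / c * heat_kernel c t v) * indicator {b..} (v - a) \<partial>lborel)"
    by (subst nn_integral_real_affine[where c=1 and t="-a"]) (auto simp: algebra_simps)
  also have "\<dots> = (\<integral>\<^sup>+v. ennreal (1 / c) * (ennreal (exp (\<kappa> * (v - (a + b))) * heat_kernel c t v) * indicator {a + b..} v) \<partial>lborel)"
    using c t by (intro nn_integral_cong) (auto simp: indicator_def ennreal_mult[symmetric] heat_kernel_nonneg algebra_simps)
  also have "\<dots> = ennreal (1 / c) * ennreal (tilted_tail c \<kappa> t (a + b))"
    by (subst nn_integral_cmult) (use nn_integral_tilted_tail[OF c t] in auto)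
  also have "\<dots> = ennreal (tilted_tail c \<kappa> t (a + b) / c)"
    using c by (simp add: ennreal_mult[symmetric] tilted_tail_nonneg)
  finally show ?thesis .
qed

text \<open>
  For \<open>v, w \<ge> 0\<close> one has \<open>(w + v)\<^sup>2 \<ge> w\<^sup>2 + v\<^sup>2\<close>, so moving the starting point of the tail from \<open>0\<close> to \<open>w\<close>
  costs at least a Gaussian factor in \<open>w\<close>.
\<close>

lemma tilted_tail_le:
  assumes c: "0 < c" and t: "0 < t" and w: "0 \<le> w"
  shows "tilted_tail c \<kappa> t w \<le> exp (- (w\<^sup>2 / (2 * c * t))) * tilted_tail c \<kappa> t 0"
proof -
  have "ennreal (tilted_tail c \<kappa> t w) = (\<integral>\<^sup>+v. ennreal (exp (\<kappa> * v) * heat_kernel c t (w + v)) * indicator {0..} v \<partial>lborel)"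
    unfolding nn_integral_tilted_tail[OF c t, symmetric]
    by (subst nn_integral_real_affine[where c=1 and t="w"]) (auto simp: indicator_def intro!: nn_integral_cong)
  also have "\<dots> \<le> (\<integral>\<^sup>+v. ennreal (exp (- (w\<^sup>2 / (2 * c * t)))) * (ennreal (exp (\<kappa> * (v - 0)) * heat_kernel c t v) * indicator {0..} v) \<partial>lborel)"
  proof (intro nn_integral_mono)
    fix v :: real
    have "heat_kernel c t (w + v) \<le> exp (- (w\<^sup>2 / (2 * c * t))) * heat_kernel c t v" if "0 \<le> v"
    proof -
      have "w\<^sup>2 / (2 * c * t) + v\<^sup>2 / (2 * c * t) \<le> (w + v)\<^sup>2 / (2 * c * t)"
        unfolding add_divide_distrib[symmetric]
        using c t that w by (intro divide_right_mono) (auto simp: power2_sum)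
      hence "exp (- ((w + v)\<^sup>2 / (2 * c * t))) \<le> exp (- (w\<^sup>2 / (2 * c * t))) * exp (- (v\<^sup>2 / (2 * c * t)))"
        unfolding exp_add[symmetric] by simp
      from mult_left_mono[OF this, of "1 / sqrt (2 * pi * c * t)"] show ?thesis
        using c t unfolding heat_kernel_def by (simp add: mult_ac)
    qed
    thus "ennreal (exp (\<kappa> * v) * heat_kernel c t (w + v)) * indicator {0..} v
      \<le> ennreal (exp (- (w\<^sup>2 / (2 * c * t)))) * (ennreal (exp (\<kappa> * (v - 0)) * heat_kernel c t v) * indicator {0..} v)"
      using c t heat_kernel_nonneg[of c t v]
      by (auto simp: indicator_def ennreal_mult[symmetric] mult_ac intro!: ennreal_leI mult_left_mono)
  qed
  also have "\<dots> = ennreal (exp (- (w\<^sup>2 / (2 * c * t)))) * ennreal (tilted_tail c \<kappa> t 0)"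
    by (subst nn_integral_cmult) (use nn_integral_tilted_tail[OF c t, where w=0] in auto)
  finally show ?thesis by (simp add: ennreal_mult[symmetric] tilted_tail_nonneg)
qed

section \<open>The kernels of the second moment\<close>

lemma K_dag_eq_tilted_tail:
  assumes "0 < \<nu>"
  shows "K_dag \<nu> lam t z1 z2 y = lam\<^sup>2 / (2 * \<nu>) * heat_kernel (\<nu> / 2) t ((z1 + z2) / 2)
    * tilted_tail (2 * \<nu>) (lam\<^sup>2 / (2 * \<nu>)) t (\<bar>y\<bar> + \<bar>y - (z1 - z2)\<bar>)"
proof -
  have 1: "lam\<^sup>2 / (2 * \<nu>) * (2 * \<nu>) * t = lam\<^sup>2 * t" using assms by simp
  have 2: "(lam\<^sup>2 / (2 * \<nu>))\<^sup>2 * (2 * \<nu>) * t / 2 - lam\<^sup>2 / (2 * \<nu>) * w = lam\<^sup>2 / (4 * \<nu>) * (lam\<^sup>2 * t - 2 * w)" for w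
    using assms by (simp add: field_simps power2_eq_square)
  show ?thesis unfolding K_dag_def tilted_tail_def 1 2 by (simp only: mult_ac)
qed

lemma K_star_eq_tilted_tail:
  assumes "0 < \<nu>" "0 < t"
  shows "K_star \<nu> lam t z1 z2 y = heat_kernel (\<nu> / 2) t ((z1 + z2) / 2) *
     (heat_kernel (2 * \<nu>) t (z1 - z2) + lam\<^sup>2 / (2 * \<nu>) * tilted_tail (2 * \<nu>) (lam\<^sup>2 / (2 * \<nu>)) t (\<bar>y\<bar> + \<bar>y - (z1 - z2)\<bar>))"
  unfolding K_star_def K_dag_eq_tilted_tail[OF assms(1)] heat_kernel_mult[OF assms] by (simp add: algebra_simps)

lemma K_dag_nonneg: "0 < \<nu> \<Longrightarrow> 0 < t \<Longrightarrow> 0 \<le> K_dag \<nu> lam t z1 z2 y"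
  unfolding K_dag_eq_tilted_tail by (intro mult_nonneg_nonneg heat_kernel_nonneg tilted_tail_nonneg) auto

lemma K_star_nonneg: "0 < \<nu> \<Longrightarrow> 0 < t \<Longrightarrow> 0 \<le> K_star \<nu> lam t z1 z2 y"
  by (auto simp: K_star_def intro!: mult_nonneg_nonneg add_nonneg_nonneg heat_kernel_nonneg K_dag_nonneg)

lemma measurable_K_dag [measurable (raw)]:
  assumes [measurable]: "f \<in> borel_measurable M" "g1 \<in> borel_measurable M" "g2 \<in> borel_measurable M" "h \<in> borel_measurable M"
  shows "(\<lambda>x. K_dag \<nu> lam (f x) (g1 x) (g2 x) (h x)) \<in> borel_measurable M"
  unfolding K_dag_def by measurable

lemma measurable_K_star [measurable (raw)]:
  assumes [measurable]: "f \<in> borel_measurable M" "g1 \<in> borel_measurable M" "g2 \<in> borel_measurable M" "h \<in> borel_measurable M"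
  shows "(\<lambda>x. K_star \<nu> lam (f x) (g1 x) (g2 x) (h x)) \<in> borel_measurable M"
  unfolding K_star_def by measurable

text \<open>
  By the triangle inequality the tail in \<open>K_dag\<close> starts at a point at least \<open>\<bar>z1 - z2\<bar>\<close>. Its Gaussian
  decay therefore supplies the factor in \<open>z1 - z2\<close>, and together with the factor in the mean
  \<open>(z1 + z2) / 2\<close> it recombines to a product of heat kernels. This makes \<open>K_dag\<close> integrable against
  every measure that integrates Gaussians.
\<close>

lemma K_dag_le:
  assumes "0 < \<nu>" "0 < t"
  obtains C where "0 \<le> C"
    "\<And>z1 z2 y. K_dag \<nu> lam t z1 z2 y \<le> C * (heat_kernel \<nu> t z1 * heat_kernel \<nu> t z2)"
proof
  let ?\<kappa> = "lam\<^sup>2 / (2 * \<nu>)"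
  let ?T = "tilted_tail (2 * \<nu>) ?\<kappa> t"
  let ?C = "?\<kappa> * (sqrt (2 * pi * (2 * \<nu>) * t) * ?T 0)"
  show "0 \<le> ?C" using assms by (simp add: tilted_tail_nonneg)
  fix z1 z2 y :: real
  let ?w = "\<bar>y\<bar> + \<bar>y - (z1 - z2)\<bar>"
  have "?T ?w \<le> exp (- (?w\<^sup>2 / (2 * (2 * \<nu>) * t))) * ?T 0"
    using assms by (intro tilted_tail_le) auto
  also have "\<dots> \<le> exp (- ((z1 - z2)\<^sup>2 / (2 * (2 * \<nu>) * t))) * ?T 0"
  proof (intro mult_right_mono tilted_tail_nonneg)
    have "(z1 - z2)\<^sup>2 \<le> ?w\<^sup>2" by (rule power2_le_iff_abs_le[THEN iffD2]) auto
    thus "exp (- (?w\<^sup>2 / (2 * (2 * \<nu>) * t))) \<le> exp (- ((z1 - z2)\<^sup>2 / (2 * (2 * \<nu>) * t)))"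
      using assms by (simp add: divide_right_mono)
  qed
  also have "\<dots> = heat_kernel (2 * \<nu>) t (z1 - z2) * (sqrt (2 * pi * (2 * \<nu>) * t) * ?T 0)"
    using assms by (simp add: heat_kernel_def)
  finally have *: "?T ?w \<le> heat_kernel (2 * \<nu>) t (z1 - z2) * (sqrt (2 * pi * (2 * \<nu>) * t) * ?T 0)" .
  have "?\<kappa> * heat_kernel (\<nu> / 2) t ((z1 + z2) / 2) * ?T ?w \<le>
    ?\<kappa> * heat_kernel (\<nu> / 2) t ((z1 + z2) / 2) * (heat_kernel (2 * \<nu>) t (z1 - z2) * (sqrt (2 * pi * (2 * \<nu>) * t) * ?T 0))"
    by (rule mult_left_mono[OF *], intro mult_nonneg_nonneg heat_kernel_nonneg) (use assms in auto)
  also have "\<dots> = ?C * (heat_kernel \<nu> t z1 * heat_kernel \<nu> t z2)"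
    unfolding heat_kernel_mult[OF assms] by (simp only: mult_ac)
  finally show "K_dag \<nu> lam t z1 z2 y \<le> ?C * (heat_kernel \<nu> t z1 * heat_kernel \<nu> t z2)"
    unfolding K_dag_eq_tilted_tail[OF assms(1)] .
qed

text \<open>
  On the diagonal the space variable \<open>y\<close> enters only through the centre of mass.
\<close>

lemma K_star_diag:
  assumes "0 < \<nu>" "0 < t"
  shows "K_star \<nu> lam t (y - z1) (y - z2) 0 = heat_kernel (\<nu> / 2) t (y - (z1 + z2) / 2) *
     (heat_kernel (2 * \<nu>) t \<bar>z1 - z2\<bar> + lam\<^sup>2 / (2 * \<nu>) * tilted_tail (2 * \<nu>) (lam\<^sup>2 / (2 * \<nu>)) t \<bar>z1 - z2\<bar>)"
proof -
  have 1: "(y - z1 + (y - z2)) / 2 = y - (z1 + z2) / 2" by (simp add: field_simps)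
  have 2: "\<bar>0\<bar> + \<bar>0 - (y - z1 - (y - z2))\<bar> = \<bar>z1 - z2\<bar>" by simp
  have 3: "heat_kernel (2 * \<nu>) t (y - z1 - (y - z2)) = heat_kernel (2 * \<nu>) t \<bar>z1 - z2\<bar>"
    by (simp add: heat_kernel_def power2_commute)
  show ?thesis unfolding K_star_eq_tilted_tail[OF assms] 1 2 3 ..
qed

text \<open>
  The second-moment equation for the kernel, for an initial condition made of point masses at \<open>z1\<close>
  and \<open>z2\<close>. The centre of mass part integrates out by the semigroup property, whatever the
  intermediate time, and the rest is the renewal identity with \<open>a = \<bar>x1 - x2\<bar>\<close> and \<open>b = \<bar>z1 - z2\<bar>\<close>.
\<close>

lemma K_star_Duhamel:
  assumes \<nu>: "0 < \<nu>" and t: "0 < t"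
  shows "(\<integral>\<^sup>+s\<in>{0<..<t}. (\<integral>\<^sup>+y. ennreal (heat_kernel \<nu> (t - s) (x1 - y) * heat_kernel \<nu> (t - s) (x2 - y)
       * (lam\<^sup>2 * K_star \<nu> lam s (y - z1) (y - z2) 0)) \<partial>lborel) \<partial>lborel)
     = ennreal (K_dag \<nu> lam t (x1 - z1) (x2 - z2) (x1 - x2))"
proof -
  let ?c = "2 * \<nu>" and ?\<kappa> = "lam\<^sup>2 / (2 * \<nu>)" and ?a = "\<bar>x1 - x2\<bar>" and ?b = "\<bar>z1 - z2\<bar>"
  let ?X = "(x1 + x2) / 2" and ?Z = "(z1 + z2) / 2"
  let ?R = "\<lambda>s. heat_kernel ?c s ?b + ?\<kappa> * tilted_tail ?c ?\<kappa> s ?b"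
  have c: "0 < ?c" and \<kappa>: "0 \<le> ?\<kappa>" and \<nu>2: "0 < \<nu> / 2" using \<nu> by auto
  have R: "0 \<le> ?R s" if "0 < s" for s
    using that \<nu> by (intro add_nonneg_nonneg mult_nonneg_nonneg heat_kernel_nonneg tilted_tail_nonneg) auto
  have "(\<integral>\<^sup>+s\<in>{0<..<t}. (\<integral>\<^sup>+y. ennreal (heat_kernel \<nu> (t - s) (x1 - y) * heat_kernel \<nu> (t - s) (x2 - y)
       * (lam\<^sup>2 * K_star \<nu> lam s (y - z1) (y - z2) 0)) \<partial>lborel) \<partial>lborel)
    = (\<integral>\<^sup>+s. ennreal (lam\<^sup>2 * heat_kernel (\<nu> / 2) t (?X - ?Z)) * (ennreal (heat_kernel ?c (t - s) ?a * ?R s) * indicator {0<..<t} s) \<partial>lborel)"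
  proof (intro nn_integral_cong)
    fix s :: real
    have "(\<integral>\<^sup>+y. ennreal (heat_kernel \<nu> (t - s) (x1 - y) * heat_kernel \<nu> (t - s) (x2 - y)
       * (lam\<^sup>2 * K_star \<nu> lam s (y - z1) (y - z2) 0)) \<partial>lborel) = ennreal (lam\<^sup>2 * heat_kernel (\<nu> / 2) t (?X - ?Z)) * ennreal (heat_kernel ?c (t - s) ?a * ?R s)"
      if s: "0 < s" "s < t"
    proof -
      have *: "heat_kernel \<nu> (t - s) (x1 - y) * heat_kernel \<nu> (t - s) (x2 - y) = heat_kernel ?c (t - s) ?a * heat_kernel (\<nu> / 2) (t - s) (?X - y)" for y
      proof -
        have 1: "(x1 - y + (x2 - y)) / 2 = ?X - y" by (simp add: field_simps)
        have 2: "heat_kernel ?c (t - s) (x1 - y - (x2 - y)) = heat_kernel ?c (t - s) ?a" by (simp add: heat_kernel_def)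
        have "0 < t - s" using s by simp
        from heat_kernel_mult[OF \<nu> this, of "x1 - y" "x2 - y"] show ?thesis unfolding 1 2 .
      qed
      have "(\<integral>\<^sup>+y. ennreal (heat_kernel \<nu> (t - s) (x1 - y) * heat_kernel \<nu> (t - s) (x2 - y)
       * (lam\<^sup>2 * K_star \<nu> lam s (y - z1) (y - z2) 0)) \<partial>lborel) =
       (\<integral>\<^sup>+y. ennreal (lam\<^sup>2 * heat_kernel ?c (t - s) ?a * ?R s) * ennreal (heat_kernel (\<nu> / 2) (t - s) (?X - y) * heat_kernel (\<nu> / 2) s (y - ?Z)) \<partial>lborel)"
        unfolding * K_star_diag[OF \<nu> s(1)]
        using R[OF s(1)] s \<nu>
        by (intro nn_integral_cong, subst ennreal_mult[symmetric])
          (auto simp: heat_kernel_nonneg mult_ac)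
      also have "\<dots> = ennreal (lam\<^sup>2 * heat_kernel ?c (t - s) ?a * ?R s) * ennreal (heat_kernel (\<nu> / 2) (t - s + s) (?X - ?Z))"
        by (subst nn_integral_cmult) (use heat_kernel_convolution[OF \<nu>2, of "t - s" s] s in auto)
      also have "\<dots> = ennreal (lam\<^sup>2 * heat_kernel (\<nu> / 2) t (?X - ?Z)) * ennreal (heat_kernel ?c (t - s) ?a * ?R s)"
        using R[OF s(1)] s \<nu> by (simp add: ennreal_mult[symmetric] heat_kernel_nonneg mult_ac)
      finally show ?thesis .
    qed
    thus "(\<integral>\<^sup>+y. ennreal (heat_kernel \<nu> (t - s) (x1 - y) * heat_kernel \<nu> (t - s) (x2 - y)
       * (lam\<^sup>2 * K_star \<nu> lam s (y - z1) (y - z2) 0)) \<partial>lborel) * indicator {0<..<t} s = ennreal (lam\<^sup>2 * heat_kernel (\<nu> / 2) t (?X - ?Z)) * (ennreal (heat_kernel ?c (t - s) ?a * ?R s) * indicator {0<..<t} s)"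
      by (cases "s \<in> {0<..<t}") auto
  qed
  also have "\<dots> = ennreal (lam\<^sup>2 * heat_kernel (\<nu> / 2) t (?X - ?Z)) * ennreal (tilted_tail ?c ?\<kappa> t (?a + ?b) / ?c)"
    by (subst nn_integral_cmult) (use renewal_tilted_tail[OF c t \<kappa>, of ?a ?b] in auto)
  also have "\<dots> = ennreal (K_dag \<nu> lam t (x1 - z1) (x2 - z2) (x1 - x2))"
  proof -
    have 1: "(x1 - z1 + (x2 - z2)) / 2 = ?X - ?Z" by (simp add: field_simps)
    have 2: "\<bar>x1 - x2\<bar> + \<bar>x1 - x2 - (x1 - z1 - (x2 - z2))\<bar> = ?a + ?b" by simp
    show ?thesis unfolding K_dag_eq_tilted_tail[OF \<nu>] 1 2 using \<nu> t
      by (simp add: ennreal_mult[symmetric] heat_kernel_nonneg tilted_tail_nonneg mult_ac)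
  qed
  finally show ?thesis .
qed

section \<open>Uniqueness for the Volterra equation\<close>

lemma nn_integral_open_half_plane:
  assumes f: "f \<in> borel_measurable open_half_plane"
  shows "(\<integral>\<^sup>+z. f z \<partial>open_half_plane) = (\<integral>\<^sup>+s\<in>{0<..}. (\<integral>\<^sup>+y. f (s, y) \<partial>lborel) \<partial>lborel)"
proof -
  have S: "{0<..} \<times> UNIV \<in> sets (borel :: (real \<times> real) measure)"
    unfolding borel_prod[symmetric] by measurable
  have m: "(\<lambda>z. f z * indicator ({0<..} \<times> UNIV) z) \<in> borel_measurable (lborel \<Otimes>\<^sub>M lborel)"
    using f S unfolding open_half_plane_def lborel_prod
    by (subst (asm) borel_measurable_restrict_space_iff_ennreal) auto
  have "(\<integral>\<^sup>+z. f z \<partial>open_half_plane) = (\<integral>\<^sup>+z. f z * indicator ({0<..} \<times> UNIV) z \<partial>lborel)"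
    unfolding open_half_plane_def using S by (subst nn_integral_restrict_space) auto
  also have "\<dots> = (\<integral>\<^sup>+s. \<integral>\<^sup>+y. f (s, y) * indicator ({0<..} \<times> UNIV) (s, y) \<partial>lborel \<partial>lborel)"
    unfolding lborel_prod[symmetric] by (rule lborel.nn_integral_fst[OF m, symmetric])
  also have "\<dots> = (\<integral>\<^sup>+s\<in>{0<..}. (\<integral>\<^sup>+y. f (s, y) \<partial>lborel) \<partial>lborel)"
    by (intro nn_integral_cong) (auto simp: indicator_def)
  finally show ?thesis .
qed

lemma measurable_open_half_plane:
  "f \<in> borel_measurable (borel \<Otimes>\<^sub>M borel) \<Longrightarrow> f \<in> borel_measurable open_half_plane"
  unfolding open_half_plane_def borel_prod by (intro measurable_restrict_space1) simp

lemma sigma_finite_half_plane: "sigma_finite_measure open_half_plane"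
proof -
  have "{0<..} \<times> UNIV \<in> sets (lborel :: (real \<times> real) measure)"
    unfolding lborel_prod[symmetric] by measurable
  thus ?thesis unfolding open_half_plane_def
    by (intro sigma_finite_measure_restrict_space lborel.sigma_finite_measure_axioms)
qed

text \<open>
  The product of two heat kernels that appears in the covariance of the stochastic integrals defining
  the solution at \<open>(t, x1)\<close> and \<open>(t, x2)\<close>. The indicator keeps the time argument \<open>t - s\<close> positive.
\<close>

definition joint_kernel :: "real \<Rightarrow> real \<Rightarrow> real \<Rightarrow> real \<Rightarrow> real \<Rightarrow> real \<Rightarrow> real" where
  "joint_kernel \<nu> t x1 x2 s y = indicator {0<..<t} s * (heat_kernel \<nu> (t - s) (x1 - y) * heat_kernel \<nu> (t - s) (x2 - y))"

lemma joint_kernel_nonneg: "0 < \<nu> \<Longrightarrow> 0 \<le> joint_kernel \<nu> t x1 x2 s y"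
  unfolding joint_kernel_def by (cases "s \<in> {0<..<t}") (auto intro!: mult_nonneg_nonneg heat_kernel_nonneg)

lemma measurable_joint_kernel [measurable (raw)]:
  assumes [measurable]: "f \<in> borel_measurable M" "g \<in> borel_measurable M"
  shows "(\<lambda>x. joint_kernel \<nu> t x1 x2 (f x) (g x)) \<in> borel_measurable M"
  unfolding joint_kernel_def by measurable

lemma joint_kernel_diag:
  assumes "0 < \<nu>"
  shows "joint_kernel \<nu> t x x s y = indicator {0<..<t} s * (heat_kernel (2 * \<nu>) (t - s) 0 * heat_kernel (\<nu> / 2) (t - s) (x - y))"
proof (cases "s \<in> {0<..<t}")
  case True
  have "(x - y + (x - y)) / 2 = x - y" by simp
  with True heat_kernel_mult[OF assms, of "t - s" "x - y" "x - y"] show ?thesis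
    by (simp only: joint_kernel_def) simp
qed (simp add: joint_kernel_def)

lemma K_star_Duhamel_half_plane:
  assumes \<nu>: "0 < \<nu>" and t: "0 < t"
  shows "(\<integral>\<^sup>+(s, y). ennreal (lam\<^sup>2 * joint_kernel \<nu> t x1 x2 s y * K_star \<nu> lam s (y - z1) (y - z2) 0) \<partial>open_half_plane)
     = ennreal (K_dag \<nu> lam t (x1 - z1) (x2 - z2) (x1 - x2))"
proof -
  have "(\<integral>\<^sup>+(s, y). ennreal (lam\<^sup>2 * joint_kernel \<nu> t x1 x2 s y * K_star \<nu> lam s (y - z1) (y - z2) 0) \<partial>open_half_plane)
    = (\<integral>\<^sup>+s\<in>{0<..}. (\<integral>\<^sup>+y. ennreal (lam\<^sup>2 * joint_kernel \<nu> t x1 x2 s y * K_star \<nu> lam s (y - z1) (y - z2) 0) \<partial>lborel) \<partial>lborel)"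
    by (subst nn_integral_open_half_plane, intro measurable_open_half_plane) auto
  also have "\<dots> = (\<integral>\<^sup>+s\<in>{0<..<t}. (\<integral>\<^sup>+y. ennreal (heat_kernel \<nu> (t - s) (x1 - y) * heat_kernel \<nu> (t - s) (x2 - y)
       * (lam\<^sup>2 * K_star \<nu> lam s (y - z1) (y - z2) 0)) \<partial>lborel) \<partial>lborel)"
    by (intro nn_integral_cong) (auto simp: joint_kernel_def indicator_def mult_ac)
  finally show ?thesis unfolding K_star_Duhamel[OF \<nu> t] .
qed

text \<open>
  The Laplace transform in time of the heat kernel at the origin is \<open>1 / sqrt (2 * \<Lambda> * c)\<close>. What matters
  is that it vanishes as \<open>\<Lambda>\<close> grows.
\<close>

lemma heat_kernel_Laplace_le:
  assumes c: "0 < c" and \<Lambda>: "0 < \<Lambda>"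
  shows "(\<integral>\<^sup>+s\<in>{0<..<t}. ennreal (exp (- \<Lambda> * s) * heat_kernel c s 0) \<partial>lborel) \<le> ennreal (1 / sqrt (2 * \<Lambda> * c))"
proof (cases "0 < t")
  case True
  let ?A = "2 / sqrt (2 * \<Lambda> * c)"
  let ?F = "\<lambda>s. ?A * Phi (sqrt (2 * \<Lambda> * s))"
  have "(\<integral>\<^sup>+s\<in>{0<..<t}. ennreal (exp (- \<Lambda> * s) * heat_kernel c s 0) \<partial>lborel) = ennreal (?F t - ?F 0)"
  proof (rule nn_integral_FTC_open[OF True])
    fix s :: real assume s: "0 < s" "s < t"
    have d: "((\<lambda>s. sqrt (2 * \<Lambda> * s)) has_real_derivative \<Lambda> / sqrt (2 * \<Lambda> * s)) (at s)"
    proof -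
      have "0 < \<Lambda> * s" using s \<Lambda> by simp
      thus ?thesis by (auto intro!: derivative_eq_intros simp: divide_simps)
    qed
    have sq: "(sqrt (2 * \<Lambda> * s))\<^sup>2 = 2 * \<Lambda> * s" using s \<Lambda> by simp
    \<comment> \<open>The constant in front of \<open>Phi\<close> is chosen so that the derivative is exactly the integrand.\<close>
    have "?A * (std_normal_density (sqrt (2 * \<Lambda> * s)) * (\<Lambda> / sqrt (2 * \<Lambda> * s))) = exp (- \<Lambda> * s) * heat_kernel c s 0"
    proof -
      have a: "2 / (A * C) * (1 / P * (\<Lambda> / (A * S))) = 1 / (P * C * S)" if "A * A = 2 * \<Lambda>" "A \<noteq> 0" for A C P S
      proof -
        have "2 / (A * C) * (1 / P * (\<Lambda> / (A * S))) = (2 * \<Lambda>) / ((A * A) * (P * C * S))"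
          by (simp add: mult_ac)
        thus ?thesis unfolding that(1) using \<Lambda> by simp
      qed
      have A: "sqrt (2 * \<Lambda>) * sqrt (2 * \<Lambda>) = 2 * \<Lambda>" "sqrt (2 * \<Lambda>) \<noteq> 0" using \<Lambda> by auto
      have "?A * (std_normal_density (sqrt (2 * \<Lambda> * s)) * (\<Lambda> / sqrt (2 * \<Lambda> * s)))
        = exp (- \<Lambda> * s) * (2 / (sqrt (2 * \<Lambda>) * sqrt c) * (1 / sqrt (2 * pi) * (\<Lambda> / (sqrt (2 * \<Lambda>) * sqrt s))))"
        unfolding std_normal_density_def sq unfolding real_sqrt_mult[of "2 * \<Lambda>"] by simp
      also have "\<dots> = exp (- \<Lambda> * s) * (1 / (sqrt (2 * pi) * sqrt c * sqrt s))"
        unfolding a[OF A] ..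
      also have "\<dots> = exp (- \<Lambda> * s) * heat_kernel c s 0"
        unfolding heat_kernel_def real_sqrt_mult[of "2 * pi * c"] real_sqrt_mult[of "2 * pi"] by simp
      finally show ?thesis .
    qed
    with DERIV_cmult[OF DERIV_Phi_chain[OF d], of ?A]
    show "(?F has_real_derivative exp (- \<Lambda> * s) * heat_kernel c s 0) (at s)" by simp
    show "isCont (\<lambda>s. exp (- \<Lambda> * s) * heat_kernel c s 0) s"
      unfolding heat_kernel_def using s c by (auto intro!: continuous_intros)
    show "0 \<le> exp (- \<Lambda> * s) * heat_kernel c s 0"
      using s c by (simp add: heat_kernel_nonneg)
  next
    have cont: "isCont ?F s" for s
      by (intro continuous_intros continuous_within_compose3[OF DERIV_isCont[OF DERIV_Phi]])
    show "(?F \<longlongrightarrow> ?F 0) (at_right 0)" "(?F \<longlongrightarrow> ?F t) (at_left t)"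
      using continuous_at_imp_continuous_at_within[OF cont] unfolding continuous_within by blast+
  qed
  also have "\<dots> \<le> ennreal (1 / sqrt (2 * \<Lambda> * c))"
  proof (rule ennreal_leI)
    have "Phi 0 = 1 / 2" using Phi_uminus[of 0] by simp
    moreover have "Phi x \<le> 1" for x
      using Phi_uminus[of "-x"] Phi_nonneg[of "-x"] by simp
    ultimately have "?A * Phi (sqrt (2 * \<Lambda> * t)) - ?A * Phi 0 \<le> ?A * 1 - ?A * (1 / 2)"
      using c \<Lambda> by (intro diff_mono mult_left_mono) auto
    thus "?F t - ?F 0 \<le> 1 / sqrt (2 * \<Lambda> * c)" by simp
  qed
  finally show ?thesis .
qed simp

text \<open>
  A non-negative solution of the homogeneous inequality vanishes as soon as the integral in it is
  finite. Fix \<open>(T, x)\<close> and let \<open>\<phi> s\<close> be the average of \<open>D s\<close> against \<open>heat_kernel (\<nu> / 2) (T - s) (x - \<sqdot>)\<close>.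
  The space part of \<open>joint_kernel\<close> on the diagonal is the same semigroup, so averaging the inequality
  leaves one in time alone, \<open>\<phi> s \<le> \<lambda>\<^sup>2 \<integral>\<^sub>0\<^sup>s q(s - r) \<phi> r dr\<close> with \<open>q = heat_kernel (2\<nu>) \<sqdot> 0\<close>. With the
  weight \<open>exp (- \<Lambda> s)\<close> and \<open>\<Lambda>\<close> large, the total mass \<open>X\<close> of \<open>\<phi>\<close> on \<open>(0, T)\<close> satisfies \<open>X \<le> X / 2\<close>, and \<open>X\<close>
  is finite because \<open>q(T - s) \<ge> q(T)\<close> there. So \<open>\<phi> = 0\<close> almost everywhere, and the inequality at
  \<open>(T, x)\<close>, whose right-hand side depends on \<open>D\<close> only through \<open>\<phi>\<close>, gives \<open>D T x = 0\<close>.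
\<close>

lemma Volterra_inequality_imp_zero:
  fixes D :: "real \<Rightarrow> real \<Rightarrow> ennreal"
  assumes \<nu>: "0 < \<nu>"
    and D0: "(\<lambda>(s, y). D s y) \<in> borel_measurable open_half_plane"
    and le0: "\<And>t x. 0 < t \<Longrightarrow> D t x \<le> (\<integral>\<^sup>+(s, y). ennreal (lam\<^sup>2 * joint_kernel \<nu> t x x s y) * D s y \<partial>open_half_plane)"
    and fin0: "\<And>t x. 0 < t \<Longrightarrow> (\<integral>\<^sup>+(s, y). ennreal (lam\<^sup>2 * joint_kernel \<nu> t x x s y) * D s y \<partial>open_half_plane) < \<infinity>"
    and T: "0 < T"
  shows "D T x = 0"
proof (cases "lam = 0")
  case True
  with le0[OF T, of x] show ?thesis by (simp add: case_prod_beta')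
next
  case lam: False
  \<comment> \<open>Extension by zero to negative times, which is measurable on the whole plane.\<close>
  define E where "E = (\<lambda>s y. D s y * indicator {0<..} s)"
  have S: "{0<..} \<times> UNIV \<in> sets (borel :: (real \<times> real) measure)"
    unfolding borel_prod[symmetric] by measurable
  have "(\<lambda>z. (case z of (s, y) \<Rightarrow> D s y) * indicator ({0<..} \<times> UNIV) z) \<in> borel_measurable (borel \<Otimes>\<^sub>M borel)"
    using D0 S unfolding open_half_plane_def borel_prod
    by (subst (asm) borel_measurable_restrict_space_iff_ennreal) auto
  also have "(\<lambda>z. (case z of (s, y) \<Rightarrow> D s y) * indicator ({0<..} \<times> UNIV) z) = (\<lambda>(s, y). E s y)"
    by (auto simp: E_def indicator_def fun_eq_iff)
  finally have E: "(\<lambda>(s, y). E s y) \<in> borel_measurable (borel \<Otimes>\<^sub>M borel)" .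
  have [measurable (raw)]: "(\<lambda>x. E (f x) (g x)) \<in> borel_measurable M"
    if "f \<in> borel_measurable M" "g \<in> borel_measurable M" for f g and M :: "'m measure"
    using measurable_compose[OF measurable_Pair[OF that] E] by simp
  let ?q = "\<lambda>s. heat_kernel (2 * \<nu>) s 0" and ?p = "heat_kernel (\<nu> / 2)"
  have \<nu>2: "0 < \<nu> / 2" using \<nu> by simp
  have int_eq: "(\<integral>\<^sup>+(s, y). ennreal (a * joint_kernel \<nu> t x x s y) * D s y \<partial>open_half_plane)
     = (\<integral>\<^sup>+s\<in>{0<..<t}. (\<integral>\<^sup>+y. ennreal (a * ?q (t - s)) * (ennreal (?p (t - s) (x - y)) * E s y) \<partial>lborel) \<partial>lborel)" (is "?L = _")
    if a: "0 \<le> a" for a t x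
  proof -
    have "?L = (\<integral>\<^sup>+s\<in>{0<..}. (\<integral>\<^sup>+y. ennreal (a * joint_kernel \<nu> t x x s y) * D s y \<partial>lborel) \<partial>lborel)"
    proof (subst nn_integral_open_half_plane)
      have "(\<lambda>z. ennreal (a * joint_kernel \<nu> t x x (fst z) (snd z)) * (case z of (s, y) \<Rightarrow> D s y)) \<in> borel_measurable open_half_plane"
        by (rule borel_measurable_times_ennreal[OF measurable_open_half_plane D0]) measurable
      thus "(\<lambda>(s, y). ennreal (a * joint_kernel \<nu> t x x s y) * D s y) \<in> borel_measurable open_half_plane"
        by (simp add: case_prod_beta)
    qed simp
    also have "\<dots> = (\<integral>\<^sup>+s\<in>{0<..<t}. (\<integral>\<^sup>+y. ennreal (a * ?q (t - s)) * (ennreal (?p (t - s) (x - y)) * E s y) \<partial>lborel) \<partial>lborel)"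
    proof (intro nn_integral_cong)
      fix s :: real
      show "(\<integral>\<^sup>+y. ennreal (a * joint_kernel \<nu> t x x s y) * D s y \<partial>lborel) * indicator {0<..} s
        = (\<integral>\<^sup>+y. ennreal (a * ?q (t - s)) * (ennreal (?p (t - s) (x - y)) * E s y) \<partial>lborel) * indicator {0<..<t} s"
      proof (cases "s \<in> {0<..<t}")
        case True
        hence "ennreal (a * joint_kernel \<nu> t x x s y) * D s y = ennreal (a * ?q (t - s)) * (ennreal (?p (t - s) (x - y)) * E s y)" for y
          using \<nu> a by (simp add: joint_kernel_diag E_def ennreal_mult[symmetric] mult.assoc[symmetric] heat_kernel_nonneg)
        with True show ?thesis by simp
      qed (auto simp: joint_kernel_def indicator_def)
    qed
    finally show ?thesis .
  qed
  define \<phi> where "\<phi> = (\<lambda>s. \<integral>\<^sup>+y. ennreal (?p (T - s) (x - y)) * E s y \<partial>lborel)"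
  have [measurable]: "\<phi> \<in> borel_measurable borel" unfolding \<phi>_def by measurable
  have final: "(\<integral>\<^sup>+(s, y). ennreal (a * joint_kernel \<nu> T x x s y) * D s y \<partial>open_half_plane)
     = (\<integral>\<^sup>+s\<in>{0<..<T}. ennreal (a * ?q (T - s)) * \<phi> s \<partial>lborel)" if "0 \<le> a" for a
    unfolding int_eq[OF that] \<phi>_def by (subst nn_integral_cmult) auto
  have step: "\<phi> s \<le> (\<integral>\<^sup>+r\<in>{0<..<s}. ennreal (lam\<^sup>2 * ?q (s - r)) * \<phi> r \<partial>lborel)" if s: "0 < s" "s < T" for s
  proof -
    have "\<phi> s \<le> (\<integral>\<^sup>+y. ennreal (?p (T - s) (x - y)) * (\<integral>\<^sup>+r\<in>{0<..<s}. (\<integral>\<^sup>+z. ennreal (lam\<^sup>2 * ?q (s - r)) * (ennreal (?p (s - r) (y - z)) * E r z) \<partial>lborel) \<partial>lborel) \<partial>lborel)"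
      unfolding \<phi>_def
    proof (intro nn_integral_mono mult_left_mono)
      fix y
      show "E s y \<le> (\<integral>\<^sup>+r\<in>{0<..<s}. (\<integral>\<^sup>+z. ennreal (lam\<^sup>2 * ?q (s - r)) * (ennreal (?p (s - r) (y - z)) * E r z) \<partial>lborel) \<partial>lborel)"
        using le0[OF s(1), of y] s(1) unfolding int_eq[OF zero_le_power2] E_def by simp
    qed simp
    also have "\<dots> = (\<integral>\<^sup>+y. \<integral>\<^sup>+r. \<integral>\<^sup>+z. ennreal (lam\<^sup>2 * ?q (s - r)) * (ennreal (?p (T - s) (x - y)) * ennreal (?p (s - r) (y - z)) * E r z) * indicator {0<..<s} r \<partial>lborel \<partial>lborel \<partial>lborel)"
      by (simp add: nn_integral_cmult[symmetric] nn_integral_multc[symmetric] mult_ac)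
    also have "\<dots> = (\<integral>\<^sup>+r. \<integral>\<^sup>+y. \<integral>\<^sup>+z. ennreal (lam\<^sup>2 * ?q (s - r)) * (ennreal (?p (T - s) (x - y)) * ennreal (?p (s - r) (y - z)) * E r z) * indicator {0<..<s} r \<partial>lborel \<partial>lborel \<partial>lborel)"
      by (rule lborel_pair.Fubini') measurable
    also have "\<dots> = (\<integral>\<^sup>+r. \<integral>\<^sup>+z. \<integral>\<^sup>+y. ennreal (lam\<^sup>2 * ?q (s - r)) * (ennreal (?p (T - s) (x - y)) * ennreal (?p (s - r) (y - z)) * E r z) * indicator {0<..<s} r \<partial>lborel \<partial>lborel \<partial>lborel)"
      by (intro nn_integral_cong lborel_pair.Fubini') measurable
    also have "\<dots> = (\<integral>\<^sup>+r\<in>{0<..<s}. ennreal (lam\<^sup>2 * ?q (s - r)) * \<phi> r \<partial>lborel)"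
    proof (intro nn_integral_cong)
      fix r :: real
      show "(\<integral>\<^sup>+z. \<integral>\<^sup>+y. ennreal (lam\<^sup>2 * ?q (s - r)) * (ennreal (?p (T - s) (x - y)) * ennreal (?p (s - r) (y - z)) * E r z) * indicator {0<..<s} r \<partial>lborel \<partial>lborel)
        = ennreal (lam\<^sup>2 * ?q (s - r)) * \<phi> r * indicator {0<..<s} r"
      proof (cases "r \<in> {0<..<s}")
        case True
        have "(\<integral>\<^sup>+y. ennreal (?p (T - s) (x - y)) * ennreal (?p (s - r) (y - z)) \<partial>lborel) = ennreal (?p (T - r) (x - z))" for z
          using heat_kernel_convolution[OF \<nu>2, of "T - s" "s - r" x z] s True \<nu>
          by (simp add: ennreal_mult[symmetric] heat_kernel_nonneg)
        with True show ?thesis unfolding \<phi>_def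
          by (simp add: nn_integral_cmult nn_integral_multc)
      qed simp
    qed
    finally show ?thesis .
  qed
  \<comment> \<open>Large enough that \<open>\<lambda>\<^sup>2\<close> times the Laplace transform of \<open>q\<close> is at most \<open>1/2\<close>.\<close>
  define \<Lambda> where "\<Lambda> = (lam\<^sup>2 * lam\<^sup>2 + 1) / \<nu>"
  have \<Lambda>: "0 < \<Lambda>" unfolding \<Lambda>_def using \<nu> by (auto intro!: divide_pos_pos add_nonneg_pos)
  have half: "lam\<^sup>2 * (1 / sqrt (2 * \<Lambda> * (2 * \<nu>))) \<le> 1 / 2"
  proof -
    have "sqrt (2 * \<Lambda> * (2 * \<nu>)) = 2 * sqrt (lam\<^sup>2 * lam\<^sup>2 + 1)"
    proof -
      have "2 * \<Lambda> * (2 * \<nu>) = 4 * (lam\<^sup>2 * lam\<^sup>2 + 1)" using \<nu> by (simp add: \<Lambda>_def)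
      thus ?thesis by (simp only: real_sqrt_mult real_sqrt_four)
    qed
    moreover have "lam\<^sup>2 \<le> sqrt (lam\<^sup>2 * lam\<^sup>2 + 1)" by (rule real_le_rsqrt) (simp add: power2_eq_square)
    moreover have "0 < sqrt (lam\<^sup>2 * lam\<^sup>2 + 1)" by (simp add: add_nonneg_pos)
    ultimately show ?thesis by (simp add: divide_simps)
  qed
  define X where "X = (\<integral>\<^sup>+s\<in>{0<..<T}. ennreal (exp (- \<Lambda> * s)) * \<phi> s \<partial>lborel)"
  have "X \<le> (\<integral>\<^sup>+s. (\<integral>\<^sup>+r. ennreal (exp (- \<Lambda> * s)) * ennreal (lam\<^sup>2 * ?q (s - r)) * \<phi> r * indicator {0<..<T} s * indicator {0<..<s} r \<partial>lborel) \<partial>lborel)"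
    unfolding X_def
  proof (intro nn_integral_mono)
    fix s :: real
    show "ennreal (exp (- \<Lambda> * s)) * \<phi> s * indicator {0<..<T} s \<le> (\<integral>\<^sup>+r. ennreal (exp (- \<Lambda> * s)) * ennreal (lam\<^sup>2 * ?q (s - r)) * \<phi> r * indicator {0<..<T} s * indicator {0<..<s} r \<partial>lborel)"
    proof (cases "s \<in> {0<..<T}")
      case True
      have "(\<integral>\<^sup>+r. ennreal (exp (- \<Lambda> * s)) * ennreal (lam\<^sup>2 * ?q (s - r)) * \<phi> r * indicator {0<..<T} s * indicator {0<..<s} r \<partial>lborel)
        = ennreal (exp (- \<Lambda> * s)) * (\<integral>\<^sup>+r\<in>{0<..<s}. ennreal (lam\<^sup>2 * ?q (s - r)) * \<phi> r \<partial>lborel)"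
        using True by (subst nn_integral_cmult[symmetric]) (auto simp: mult_ac)
      with step[of s] True show ?thesis by (auto intro!: mult_left_mono)
    qed simp
  qed
  also have "\<dots> = (\<integral>\<^sup>+r. (\<integral>\<^sup>+s. ennreal (exp (- \<Lambda> * s)) * ennreal (lam\<^sup>2 * ?q (s - r)) * \<phi> r * indicator {0<..<T} s * indicator {0<..<s} r \<partial>lborel) \<partial>lborel)"
    by (rule lborel_pair.Fubini') (simp add: greaterThanLessThan_def greaterThan_def lessThan_def indicator_def, measurable)
  also have "\<dots> \<le> (\<integral>\<^sup>+r. ennreal (1 / 2) * (ennreal (exp (- \<Lambda> * r)) * \<phi> r * indicator {0<..<T} r) \<partial>lborel)"
  proof (intro nn_integral_mono)
    fix r :: real
    show "(\<integral>\<^sup>+s. ennreal (exp (- \<Lambda> * s)) * ennreal (lam\<^sup>2 * ?q (s - r)) * \<phi> r * indicator {0<..<T} s * indicator {0<..<s} r \<partial>lborel)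
      \<le> ennreal (1 / 2) * (ennreal (exp (- \<Lambda> * r)) * \<phi> r * indicator {0<..<T} r)" (is "?I \<le> _")
    proof (cases "r \<in> {0<..<T}")
      case True
      have "?I = (\<integral>\<^sup>+s. \<phi> r * ennreal (lam\<^sup>2) * ennreal (exp (- \<Lambda> * r)) * (ennreal (exp (- \<Lambda> * (s - r)) * ?q (s - r)) * indicator {0<..<T - r} (s - r)) \<partial>lborel)"
      proof (intro nn_integral_cong)
        fix s :: real
        show "ennreal (exp (- \<Lambda> * s)) * ennreal (lam\<^sup>2 * ?q (s - r)) * \<phi> r * indicator {0<..<T} s * indicator {0<..<s} r
          = \<phi> r * ennreal (lam\<^sup>2) * ennreal (exp (- \<Lambda> * r)) * (ennreal (exp (- \<Lambda> * (s - r)) * ?q (s - r)) * indicator {0<..<T - r} (s - r))"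
        proof (cases "r < s \<and> s < T")
          case True': True
          have "exp (- \<Lambda> * s) = exp (- \<Lambda> * r) * exp (- \<Lambda> * (s - r))"
            by (simp add: exp_add[symmetric] algebra_simps)
          with True' True \<nu> show ?thesis
            by (simp add: ennreal_mult heat_kernel_nonneg mult_ac)
        qed (auto simp: indicator_def)
      qed
      also have "\<dots> = \<phi> r * ennreal (lam\<^sup>2) * ennreal (exp (- \<Lambda> * r)) * (\<integral>\<^sup>+s\<in>{0<..<T - r}. ennreal (exp (- \<Lambda> * s) * ?q s) \<partial>lborel)"
        by (subst nn_integral_cmult, measurable, subst (2) nn_integral_real_affine[where c=1 and t="-r"]) (auto simp: algebra_simps)
      also have "\<dots> \<le> \<phi> r * ennreal (lam\<^sup>2) * ennreal (exp (- \<Lambda> * r)) * ennreal (1 / sqrt (2 * \<Lambda> * (2 * \<nu>)))"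
        using \<nu> \<Lambda> by (intro mult_left_mono heat_kernel_Laplace_le) auto
      also have "\<dots> = \<phi> r * ennreal (exp (- \<Lambda> * r)) * ennreal (lam\<^sup>2 * (1 / sqrt (2 * \<Lambda> * (2 * \<nu>))))"
        using \<nu> \<Lambda> by (subst ennreal_mult) (auto simp: mult_ac)
      also have "\<dots> \<le> \<phi> r * ennreal (exp (- \<Lambda> * r)) * ennreal (1 / 2)"
        by (intro mult_left_mono ennreal_leI half) auto
      finally show ?thesis using True by (simp add: mult_ac)
    next
      case False
      hence "?I = (\<integral>\<^sup>+s. 0 \<partial>(lborel :: real measure))"
        by (intro nn_integral_cong) (auto simp: indicator_def)
      thus ?thesis by simp
    qed
  qed
  also have "\<dots> = ennreal (1 / 2) * X"
    unfolding X_def by (rule nn_integral_cmult) measurable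
  finally have X: "X \<le> ennreal (1 / 2) * X" .
  have "X < \<infinity>"
  proof -
    have "X \<le> (\<integral>\<^sup>+s. ennreal (1 / (lam\<^sup>2 * ?q T)) * (ennreal (lam\<^sup>2 * ?q (T - s)) * \<phi> s * indicator {0<..<T} s) \<partial>lborel)"
      unfolding X_def
    proof (intro nn_integral_mono)
      fix s :: real
      show "ennreal (exp (- \<Lambda> * s)) * \<phi> s * indicator {0<..<T} s \<le> ennreal (1 / (lam\<^sup>2 * ?q T)) * (ennreal (lam\<^sup>2 * ?q (T - s)) * \<phi> s * indicator {0<..<T} s)"
      proof (cases "s \<in> {0<..<T}")
        case True
        have q: "?q T \<le> ?q (T - s)" "0 < ?q T"
          unfolding heat_kernel_def using True \<nu> T by (auto intro!: divide_left_mono mult_pos_pos)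
        have "exp (- \<Lambda> * s) \<le> 1" using True \<Lambda> by simp
        also have "1 \<le> 1 / (lam\<^sup>2 * ?q T) * (lam\<^sup>2 * ?q (T - s))" using q lam by simp
        finally have "ennreal (exp (- \<Lambda> * s)) * \<phi> s \<le> ennreal (1 / (lam\<^sup>2 * ?q T) * (lam\<^sup>2 * ?q (T - s))) * \<phi> s"
          by (intro mult_right_mono ennreal_leI) auto
        also have "ennreal (1 / (lam\<^sup>2 * ?q T) * (lam\<^sup>2 * ?q (T - s))) = ennreal (1 / (lam\<^sup>2 * ?q T)) * ennreal (lam\<^sup>2 * ?q (T - s))"
          using q by (intro ennreal_mult) auto
        finally show ?thesis using True by (simp add: mult.assoc)
      qed simp
    qed
    also have "\<dots> = ennreal (1 / (lam\<^sup>2 * ?q T)) * (\<integral>\<^sup>+(s, y). ennreal (lam\<^sup>2 * joint_kernel \<nu> T x x s y) * D s y \<partial>open_half_plane)"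
      unfolding final[OF zero_le_power2] by (rule nn_integral_cmult) measurable
    also have "\<dots> < \<infinity>" using fin0[OF T, of x] by (simp add: ennreal_mult_less_top)
    finally show ?thesis .
  qed
  hence "X = 0"
    using X by (cases X) (auto simp: ennreal_mult[symmetric] simp del: ennreal_half)
  hence "AE s in lborel. ennreal (exp (- \<Lambda> * s)) * \<phi> s * indicator {0<..<T} s = 0"
    unfolding X_def by (subst (asm) nn_integral_0_iff_AE) measurable
  hence "AE s in lborel. ennreal (lam\<^sup>2 * ?q (T - s)) * \<phi> s * indicator {0<..<T} s = 0"
    by eventually_elim auto
  hence "(\<integral>\<^sup>+s\<in>{0<..<T}. ennreal (lam\<^sup>2 * ?q (T - s)) * \<phi> s \<partial>lborel) = 0"
    by (subst nn_integral_0_iff_AE) measurable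
  with le0[OF T, of x] show ?thesis
    unfolding final[OF zero_le_power2] by simp
qed

section \<open>Second moments of white noise\<close>

lemma integrable_mult_square_integrable:
  fixes X Y :: "'b \<Rightarrow> real"
  assumes [measurable]: "X \<in> borel_measurable N" "Y \<in> borel_measurable N"
    and i: "integrable N (\<lambda>z. (X z)\<^sup>2)" "integrable N (\<lambda>z. (Y z)\<^sup>2)"
  shows "integrable N (\<lambda>z. X z * Y z)"
proof (rule Bochner_Integration.integrable_bound)
  show "integrable N (\<lambda>z. (X z)\<^sup>2 + (Y z)\<^sup>2)" using i by simp
  show "AE z in N. norm (X z * Y z) \<le> norm ((X z)\<^sup>2 + (Y z)\<^sup>2)"
  proof (intro AE_I2)
    fix z
    have "2 * \<bar>X z\<bar> * \<bar>Y z\<bar> \<le> \<bar>X z\<bar>\<^sup>2 + \<bar>Y z\<bar>\<^sup>2" by (rule sum_squares_bound)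
    moreover have "0 \<le> \<bar>X z\<bar> * \<bar>Y z\<bar>" by simp
    ultimately have "\<bar>X z\<bar> * \<bar>Y z\<bar> \<le> (X z)\<^sup>2 + (Y z)\<^sup>2"
      unfolding mult.assoc power2_abs by linarith
    thus "norm (X z * Y z) \<le> norm ((X z)\<^sup>2 + (Y z)\<^sup>2)" by (simp add: abs_mult)
  qed
qed measurable

lemma (in pair_sigma_finite) has_bochner_integral_product:
  fixes f :: "'a \<Rightarrow> real" and g :: "'b \<Rightarrow> real"
  assumes f: "integrable M1 f" and g: "integrable M2 g"
  shows "has_bochner_integral (M1 \<Otimes>\<^sub>M M2) (\<lambda>z. f (fst z) * g (snd z)) ((\<integral>x. f x \<partial>M1) * (\<integral>y. g y \<partial>M2))"
proof -
  have [measurable]: "f \<in> borel_measurable M1" "g \<in> borel_measurable M2" using f g by auto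
  have i: "integrable (M1 \<Otimes>\<^sub>M M2) (\<lambda>z. f (fst z) * g (snd z))"
    by (rule Fubini_integrable) (use f g in \<open>auto simp: abs_mult\<close>)
  moreover have "(\<integral>z. f (fst z) * g (snd z) \<partial>(M1 \<Otimes>\<^sub>M M2)) = (\<integral>x. f x \<partial>M1) * (\<integral>y. g y \<partial>M2)"
    using integral_fst'[OF i] by simp
  ultimately show ?thesis by (simp add: has_bochner_integral_iff)
qed

lemma centered_normal_moments:
  assumes "prob_space M" and X: "X \<in> borel_measurable M" and N: "centered_normal M X v" and v: "0 \<le> v"
  shows "integrable M (\<lambda>\<omega>. (X \<omega>)\<^sup>2)" "integrable M X" "(\<integral>\<omega>. X \<omega> \<partial>M) = 0" "(\<integral>\<omega>. (X \<omega>)\<^sup>2 \<partial>M) = v"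
proof -
  interpret prob_space M by fact
  have "integrable M (\<lambda>\<omega>. (X \<omega>)\<^sup>2) \<and> integrable M X \<and> (\<integral>\<omega>. X \<omega> \<partial>M) = 0 \<and> (\<integral>\<omega>. (X \<omega>)\<^sup>2 \<partial>M) = v"
  proof (cases "v = 0")
    case True
    hence z: "AE \<omega> in M. X \<omega> = 0" using N by (simp add: centered_normal_def)
    hence "AE \<omega> in M. (X \<omega>)\<^sup>2 = 0" by eventually_elim simp
    with z True show ?thesis using X
      by (simp add: integrable_cong_AE[of X M "\<lambda>_. 0"] integral_cong_AE[of X M "\<lambda>_. 0"]
        integrable_cong_AE[of "\<lambda>\<omega>. (X \<omega>)\<^sup>2" M "\<lambda>_. 0"] integral_cong_AE[of "\<lambda>\<omega>. (X \<omega>)\<^sup>2" M "\<lambda>_. 0"])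
  next
    case False
    hence d: "distributed M lborel X (normal_density 0 (sqrt v))" and \<sigma>: "0 < sqrt v"
      using N v by (auto simp: centered_normal_def)
    have nn: "\<And>x. x \<in> space lborel \<Longrightarrow> 0 \<le> normal_density 0 (sqrt v) x" by simp
    have b: "has_bochner_integral lborel (\<lambda>x. normal_density 0 (sqrt v) x * x\<^sup>2) v"
      using normal_moment_even[OF \<sigma>, of 0 1] v by (simp add: power2_eq_square)
    have b1: "has_bochner_integral lborel (\<lambda>x. normal_density 0 (sqrt v) x * x) 0"
      using normal_moment_odd[OF \<sigma>, of 0 0] by simp
    show ?thesis
      using b b1 distributed_integrable[OF d _ nn, of "\<lambda>x. x\<^sup>2"] distributed_integral[OF d _ nn, of "\<lambda>x. x\<^sup>2"]
       distributed_integrable[OF d _ nn, of "\<lambda>x. x"] distributed_integral[OF d _ nn, of "\<lambda>x. x"]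
      by (simp add: has_bochner_integral_iff)
  qed
  thus "integrable M (\<lambda>\<omega>. (X \<omega>)\<^sup>2)" "integrable M X" "(\<integral>\<omega>. X \<omega> \<partial>M) = 0" "(\<integral>\<omega>. (X \<omega>)\<^sup>2 \<partial>M) = v" by auto
qed

lemma noise_sets_subset: "A \<in> noise_sets \<Longrightarrow> B \<subseteq> A \<Longrightarrow> B \<in> sets borel \<Longrightarrow> B \<in> noise_sets"
  unfolding noise_sets_def by (auto intro: order.strict_trans1[OF emeasure_mono])

lemma rectangle_noise_sets:
  assumes "0 \<le> a" "A \<in> sets borel" "emeasure lborel A < \<infinity>"
  shows "{a<..b} \<times> A \<in> noise_sets"
proof -
  have "{a<..b} \<times> A \<in> sets borel" using assms unfolding borel_prod[symmetric] by auto
  moreover have "emeasure lborel ({a<..b} \<times> A) = emeasure lborel {a<..b} * emeasure lborel A"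
    unfolding lborel_prod[symmetric] using assms by (intro lborel.emeasure_pair_measure_Times) auto
  hence "emeasure lborel ({a<..b} \<times> A) < \<infinity>" using assms
    by (cases "a \<le> b") (auto simp: ennreal_mult_less_top)
  ultimately show ?thesis unfolding noise_sets_def using assms by auto
qed

context white_noise
begin

lemma noise_moments:
  assumes A: "A \<in> noise_sets"
  shows "integrable M (\<lambda>\<omega>. (W A \<omega>)\<^sup>2)" "integrable M (W A)" "expectation (W A) = 0"
    "expectation (\<lambda>\<omega>. (W A \<omega>)\<^sup>2) = measure lborel A"
proof -
  have "centered_normal M (W A) (measure lborel A)"
    using noise_gaussian[of "{A}" "\<lambda>_. 1"] A by simp
  note * = centered_normal_moments[OF prob_space_axioms noise_measurable[OF A] this]
  show "integrable M (\<lambda>\<omega>. (W A \<omega>)\<^sup>2)" "integrable M (W A)" "expectation (W A) = 0"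
    "expectation (\<lambda>\<omega>. (W A \<omega>)\<^sup>2) = measure lborel A" using * by auto
qed

lemma noise_mult_integrable: "A \<in> noise_sets \<Longrightarrow> B \<in> noise_sets \<Longrightarrow> integrable M (\<lambda>\<omega>. W A \<omega> * W B \<omega>)"
  by (intro integrable_mult_square_integrable noise_moments noise_measurable)

lemma noise_covariance:
  assumes A: "A \<in> noise_sets" and B: "B \<in> noise_sets"
  shows "expectation (\<lambda>\<omega>. W A \<omega> * W B \<omega>) = measure lborel (A \<inter> B)"
proof (cases "A = B")
  case True
  thus ?thesis using noise_moments(4)[OF A] by (simp add: power2_eq_square)
next
  case False
  let ?v = "measure lborel A + measure lborel B + 2 * measure lborel (A \<inter> B)"
  have [measurable]: "W A \<in> borel_measurable M" "W B \<in> borel_measurable M" by (intro noise_measurable A B)+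
  have "centered_normal M (\<lambda>\<omega>. W A \<omega> + W B \<omega>) ?v"
    using noise_gaussian[of "{A, B}" "\<lambda>_. 1"] A B False
    by (simp add: Int_commute algebra_simps)
  from centered_normal_moments(4)[OF prob_space_axioms _ this]
  have "expectation (\<lambda>\<omega>. (W A \<omega> + W B \<omega>)\<^sup>2) = ?v" by simp
  moreover have "expectation (\<lambda>\<omega>. (W A \<omega> + W B \<omega>)\<^sup>2) =
    expectation (\<lambda>\<omega>. (W A \<omega>)\<^sup>2) + expectation (\<lambda>\<omega>. (W B \<omega>)\<^sup>2) + 2 * expectation (\<lambda>\<omega>. W A \<omega> * W B \<omega>)"
    using noise_moments(1)[OF A] noise_moments(1)[OF B] noise_mult_integrable[OF A B]
    by (simp add: power2_sum mult.assoc)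
  ultimately show ?thesis using noise_moments(4)[OF A] noise_moments(4)[OF B] by simp
qed

text \<open>
  The second moment of \<open>W (A \<union> B) - W A - W B\<close> vanishes by the covariance formula.
\<close>

lemma noise_additive:
  assumes A: "A \<in> noise_sets" and B: "B \<in> noise_sets" and AB: "A \<union> B \<in> noise_sets" and d: "A \<inter> B = {}"
  shows "AE \<omega> in M. W (A \<union> B) \<omega> = W A \<omega> + W B \<omega>"
proof -
  let ?C = "A \<union> B"
  have [measurable]: "W A \<in> borel_measurable M" "W B \<in> borel_measurable M" "W ?C \<in> borel_measurable M"
    by (intro noise_measurable A B AB)+
  have fin: "emeasure lborel A \<noteq> \<infinity>" "emeasure lborel B \<noteq> \<infinity>" "A \<in> sets lborel" "B \<in> sets lborel"
    using A B by (auto simp: noise_sets_def)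
  have m: "measure lborel ?C = measure lborel A + measure lborel B"
    using fin by (intro measure_Union d) auto
  have s: "?C \<inter> A = A" "?C \<inter> B = B" by auto
  have eq: "(W ?C \<omega> - W A \<omega> - W B \<omega>)\<^sup>2 = (W ?C \<omega>)\<^sup>2 + (W A \<omega>)\<^sup>2 + (W B \<omega>)\<^sup>2
      - 2 * (W ?C \<omega> * W A \<omega>) - 2 * (W ?C \<omega> * W B \<omega>) + 2 * (W A \<omega> * W B \<omega>)" for \<omega>
    by (simp add: power2_eq_square algebra_simps)
  note i = noise_moments(1)[OF A] noise_moments(1)[OF B] noise_moments(1)[OF AB]
    noise_mult_integrable[OF AB A] noise_mult_integrable[OF AB B] noise_mult_integrable[OF A B]
  have int: "integrable M (\<lambda>\<omega>. (W ?C \<omega> - W A \<omega> - W B \<omega>)\<^sup>2)" unfolding eq using i by simp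
  have "expectation (\<lambda>\<omega>. (W ?C \<omega> - W A \<omega> - W B \<omega>)\<^sup>2) = 0" unfolding eq using i
    noise_moments(4)[OF A] noise_moments(4)[OF B] noise_moments(4)[OF AB]
    noise_covariance[OF AB A] noise_covariance[OF AB B] noise_covariance[OF A B] m
    unfolding s d by simp
  hence "AE \<omega> in M. (W ?C \<omega> - W A \<omega> - W B \<omega>)\<^sup>2 = 0"
    by (subst (asm) integral_nonneg_eq_0_iff_AE[OF int]) auto
  thus ?thesis by eventually_elim simp
qed

text \<open>
  The \<open>\<sigma>\<close>-algebra generated by the noise after time \<open>t\<close>, which is independent of \<open>F t\<close>. As a measure space
  it carries no mass; only its measurable sets are used.
\<close>

definition noise_after :: "real \<Rightarrow> 'a measure" where
  "noise_after t = sigma (space M) {W A -` B \<inter> space M | A B. A \<in> noise_sets \<and> A \<subseteq> {t<..} \<times> UNIV \<and> B \<in> sets borel}"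

lemma measurable_noise_after:
  assumes "A \<in> noise_sets" "A \<subseteq> {t<..} \<times> UNIV"
  shows "W A \<in> borel_measurable (noise_after t)"
proof (rule measurableI)
  fix B :: "real set" assume "B \<in> sets borel"
  thus "W A -` B \<inter> space (noise_after t) \<in> sets (noise_after t)"
    unfolding noise_after_def using assms
    by (subst sets_measure_of, blast, subst space_measure_of, blast) (auto intro!: sigma_sets.Basic)
qed simp

lemma past_measurable: "X \<in> borel_measurable (F t) \<Longrightarrow> X \<in> borel_measurable M"
  using measurable_from_subalg[OF filtration_subalgebra] .

lemma expectation_past_times_future:
  fixes X Y :: "'a \<Rightarrow> real"
  assumes t: "0 \<le> t" and X: "X \<in> borel_measurable (F t)" "integrable M X"
    and Y: "Y \<in> borel_measurable (noise_after t)" "integrable M Y"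
  shows "integrable M (\<lambda>\<omega>. X \<omega> * Y \<omega>)" "expectation (\<lambda>\<omega>. X \<omega> * Y \<omega>) = expectation X * expectation Y"
proof -
  have spF: "space (F t) = space M" using filtration_subalgebra[of t] by (simp add: subalgebra_def)
  have spN: "space (noise_after t) = space M"
    unfolding noise_after_def by (subst space_measure_of) auto
  have stN: "sets (noise_after t) = sigma_sets (space M) {W A -` B \<inter> space M | A B. A \<in> noise_sets \<and> A \<subseteq> {t<..} \<times> UNIV \<and> B \<in> sets borel}"
    unfolding noise_after_def by (subst sets_measure_of) auto
  have 1: "sigma_sets (space M) {X -` A \<inter> space M |A. A \<in> sets borel} \<subseteq> sets (F t)"
    using sets.sigma_sets_subset[of "{X -` A \<inter> space M |A. A \<in> sets borel}" "F t"] measurable_sets[OF X(1)]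
    unfolding spF by blast
  have 2: "sigma_sets (space M) {Y -` A \<inter> space M |A. A \<in> sets borel} \<subseteq> sets (noise_after t)"
    using sets.sigma_sets_subset[of "{Y -` A \<inter> space M |A. A \<in> sets borel}" "noise_after t"] measurable_sets[OF Y(1)]
    unfolding spN by blast
  have "indep_set (sigma_sets (space M) {X -` A \<inter> space M |A. A \<in> sets borel}) (sigma_sets (space M) {Y -` A \<inter> space M |A. A \<in> sets borel})"
    using noise_independent[OF t] 1 2 unfolding stN[symmetric] indep_set_def
    by (elim indep_sets_mono_sets) (auto split: bool.split)
  hence "indep_var borel X borel Y"
    unfolding indep_var_eq using X(2) Y(2) by auto
  from indep_var_integrable[OF this X(2) Y(2)] indep_var_lebesgue_integral[OF this X(2) Y(2)]
  show "integrable M (\<lambda>\<omega>. X \<omega> * Y \<omega>)" "expectation (\<lambda>\<omega>. X \<omega> * Y \<omega>) = expectation X * expectation Y" by auto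
qed

lemma F_mono_measurable:
  fixes X :: "'a \<Rightarrow> real"
  assumes "s \<le> t" "X \<in> borel_measurable (F s)" shows "X \<in> borel_measurable (F t)"
proof -
  have "sets (F s) \<subseteq> sets (F t)" using sets_F_mono[OF assms(1)] .
  moreover have "space (F s) = space (F t)" using filtration_subalgebra[of s] filtration_subalgebra[of t]
    by (simp add: subalgebra_def)
  ultimately show ?thesis using assms(2) unfolding measurable_def by auto
qed

lemma integrable_bounded_mult:
  fixes X Y :: "'a \<Rightarrow> real"
  assumes "X \<in> borel_measurable M" "\<And>\<omega>. \<omega> \<in> space M \<Longrightarrow> \<bar>X \<omega>\<bar> \<le> C" "integrable M Y"
  shows "integrable M (\<lambda>\<omega>. X \<omega> * Y \<omega>)"
proof (rule Bochner_Integration.integrable_bound)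
  show "integrable M (\<lambda>\<omega>. C * Y \<omega>)" using assms by simp
  show "AE \<omega> in M. norm (X \<omega> * Y \<omega>) \<le> norm (C * Y \<omega>)"
  proof (intro AE_I2)
    fix \<omega> assume "\<omega> \<in> space M"
    hence "\<bar>X \<omega>\<bar> \<le> \<bar>C\<bar>" using assms(2) by fastforce
    thus "norm (X \<omega> * Y \<omega>) \<le> norm (C * Y \<omega>)" by (simp add: abs_mult mult_right_mono)
  qed
qed (use assms in auto)

text \<open>
  The condition that \<open>simple_predictable\<close> puts on each entry of the list.
\<close>

definition valid_term :: "(('a \<Rightarrow> real) \<times> real \<times> real \<times> real set) \<Rightarrow> bool" where
  "valid_term = (\<lambda>(X, a, b, A). 0 \<le> a \<and> a < b \<and> A \<in> sets borel \<and> emeasure lborel A < \<infinity> \<and>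
        X \<in> borel_measurable (F a) \<and> (\<exists>C. \<forall>\<omega>\<in>space M. \<bar>X \<omega>\<bar> \<le> C))"

text \<open>
  Split the earlier rectangle \<open>R = (a, b] \<times> A\<close> at the time \<open>a'\<close> at which the later one \<open>S\<close> starts. The
  part \<open>R\<^sub>1\<close> before \<open>a'\<close> is in the past of \<open>S\<close> together with \<open>X\<close> and \<open>Y\<close>, so it contributes
  \<open>E[X Y W(R\<^sub>1)] E[W(S)] = 0\<close>. The part \<open>R\<^sub>2\<close> after \<open>a'\<close> is, like \<open>S\<close>, independent of \<open>X Y\<close>, and contributes
  \<open>E[X Y] \<bar>R\<^sub>2 \<inter> S\<bar>\<close>.
\<close>

lemma noise_term_covariance_ordered:
  assumes 1: "valid_term (X, a, b, A)" and 2: "valid_term (Y, a', b', B)" and le: "a \<le> a'"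
  shows "integrable M (\<lambda>\<omega>. (X \<omega> * W ({a<..b} \<times> A) \<omega>) * (Y \<omega> * W ({a'<..b'} \<times> B) \<omega>))"
    and "expectation (\<lambda>\<omega>. (X \<omega> * W ({a<..b} \<times> A) \<omega>) * (Y \<omega> * W ({a'<..b'} \<times> B) \<omega>))
      = expectation (\<lambda>\<omega>. X \<omega> * Y \<omega>) * measure lborel (({a<..b} \<times> A) \<inter> ({a'<..b'} \<times> B))"
proof -
  let ?R = "{a<..b} \<times> A" and ?S = "{a'<..b'} \<times> B"
  let ?R1 = "{a<..min b a'} \<times> A" and ?R2 = "{max a a'<..b} \<times> A"
  obtain C D where C: "\<And>\<omega>. \<omega> \<in> space M \<Longrightarrow> \<bar>X \<omega>\<bar> \<le> C" and D: "\<And>\<omega>. \<omega> \<in> space M \<Longrightarrow> \<bar>Y \<omega>\<bar> \<le> D"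
    using 1 2 by (auto simp: valid_term_def)
  have a': "0 \<le> a'" using 2 by (simp add: valid_term_def)
  have R: "?R \<in> noise_sets" "?R1 \<in> noise_sets" "?R2 \<in> noise_sets" and S: "?S \<in> noise_sets"
    using 1 2 by (auto simp: valid_term_def intro!: rectangle_noise_sets)
  have "{a<..min b a'} \<union> {max a a'<..b} = {a<..b}" using le by auto
  hence un1: "?R1 \<union> ?R2 = ?R" by (simp only: Sigma_Un_distrib1[symmetric])
  have un2: "?R1 \<inter> ?R2 = {}" by auto
  have ae: "AE \<omega> in M. W ?R \<omega> = W ?R1 \<omega> + W ?R2 \<omega>"
    by (rule noise_additive[OF R(2,3), unfolded un1, OF R(1) un2])
  have XF: "X \<in> borel_measurable (F a')" by (rule F_mono_measurable[OF le]) (use 1 in \<open>simp add: valid_term_def\<close>)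
  have YF: "Y \<in> borel_measurable (F a')" using 2 by (simp add: valid_term_def)
  have [measurable]: "X \<in> borel_measurable M" "Y \<in> borel_measurable M" by (rule past_measurable[OF XF] past_measurable[OF YF])+
  have [measurable]: "W ?R \<in> borel_measurable M" "W ?R1 \<in> borel_measurable M" "W ?R2 \<in> borel_measurable M" "W ?S \<in> borel_measurable M"
    by (intro noise_measurable R S)+
  have R1F: "W ?R1 \<in> borel_measurable (F a')" using 1 a' by (intro noise_adapted R) (auto simp: valid_term_def)
  have R2N: "W ?R2 \<in> borel_measurable (noise_after a')" by (intro measurable_noise_after R) auto
  have SN: "W ?S \<in> borel_measurable (noise_after a')" by (intro measurable_noise_after S) auto
  have XY: "\<bar>X \<omega> * Y \<omega>\<bar> \<le> C * D" if "\<omega> \<in> space M" for \<omega>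
    unfolding abs_mult using C[OF that] D[OF that] by (intro mult_mono) auto
  have iXY: "integrable M (\<lambda>\<omega>. X \<omega> * Y \<omega>)"
    using integrable_bounded_mult[of "\<lambda>\<omega>. X \<omega> * Y \<omega>" "C * D" "\<lambda>_. 1"] XY by simp
  have P: "integrable M (\<lambda>\<omega>. X \<omega> * Y \<omega> * W ?R1 \<omega>)"
    by (rule integrable_bounded_mult[OF _ XY noise_moments(2)[OF R(2)]]) auto
  have PF: "(\<lambda>\<omega>. X \<omega> * Y \<omega> * W ?R1 \<omega>) \<in> borel_measurable (F a')"
    using XF YF R1F by measurable
  have XYF: "(\<lambda>\<omega>. X \<omega> * Y \<omega>) \<in> borel_measurable (F a')"
    using XF YF by measurable
  have QN: "(\<lambda>\<omega>. W ?R2 \<omega> * W ?S \<omega>) \<in> borel_measurable (noise_after a')"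
    using R2N SN by measurable
  note e1 = expectation_past_times_future[OF a' PF P SN noise_moments(2)[OF S]]
  note e2 = expectation_past_times_future[OF a' XYF iXY QN noise_mult_integrable[OF R(3) S]]
  have eq: "AE \<omega> in M. (X \<omega> * W ?R \<omega>) * (Y \<omega> * W ?S \<omega>) = X \<omega> * Y \<omega> * W ?R1 \<omega> * W ?S \<omega> + X \<omega> * Y \<omega> * (W ?R2 \<omega> * W ?S \<omega>)"
    using ae by eventually_elim (simp add: algebra_simps)
  have int: "?R2 \<inter> ?S = ?R \<inter> ?S" using le by auto
  show "integrable M (\<lambda>\<omega>. (X \<omega> * W ?R \<omega>) * (Y \<omega> * W ?S \<omega>))"
    by (subst integrable_cong_AE[OF _ _ eq]) (use e1 e2 in auto)
  have "expectation (\<lambda>\<omega>. (X \<omega> * W ?R \<omega>) * (Y \<omega> * W ?S \<omega>))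
    = expectation (\<lambda>\<omega>. X \<omega> * Y \<omega> * W ?R1 \<omega> * W ?S \<omega> + X \<omega> * Y \<omega> * (W ?R2 \<omega> * W ?S \<omega>))"
    by (rule integral_cong_AE[OF _ _ eq]) auto
  also have "\<dots> = expectation (\<lambda>\<omega>. X \<omega> * Y \<omega>) * measure lborel (?R \<inter> ?S)"
    using e1 e2 noise_moments(3)[OF S] noise_covariance[OF R(3) S] unfolding int by simp
  finally show "expectation (\<lambda>\<omega>. (X \<omega> * W ?R \<omega>) * (Y \<omega> * W ?S \<omega>))
      = expectation (\<lambda>\<omega>. X \<omega> * Y \<omega>) * measure lborel (?R \<inter> ?S)" .
qed

lemma noise_term_covariance:
  assumes 1: "valid_term (X, a, b, A)" and 2: "valid_term (Y, a', b', B)"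
  shows "has_bochner_integral M (\<lambda>\<omega>. (X \<omega> * W ({a<..b} \<times> A) \<omega>) * (Y \<omega> * W ({a'<..b'} \<times> B) \<omega>))
      (expectation (\<lambda>\<omega>. X \<omega> * Y \<omega>) * measure lborel (({a<..b} \<times> A) \<inter> ({a'<..b'} \<times> B)))"
  using noise_term_covariance_ordered[OF 1 2] noise_term_covariance_ordered[OF 2 1] linear[of a a']
  by (auto simp: has_bochner_integral_iff mult.commute Int_commute)

end

section \<open>The isometry of the Walsh integral\<close>

lemma has_bochner_integral_sum_list:
  fixes f :: "'i \<Rightarrow> 'b \<Rightarrow> real"
  assumes "\<And>x. x \<in> set xs \<Longrightarrow> has_bochner_integral N (f x) (c x)"
  shows "has_bochner_integral N (\<lambda>\<omega>. \<Sum>x\<leftarrow>xs. f x \<omega>) (\<Sum>x\<leftarrow>xs. c x)"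
  using assms by (induction xs) (auto intro: has_bochner_integral_add has_bochner_integral_zero)

lemma has_bochner_integral_sum_list_mult:
  fixes f :: "'i \<Rightarrow> 'b \<Rightarrow> real"
  assumes "\<And>x y. x \<in> set xs \<Longrightarrow> y \<in> set ys \<Longrightarrow> has_bochner_integral N (\<lambda>\<omega>. f x \<omega> * f y \<omega>) (c x y)"
  shows "has_bochner_integral N (\<lambda>\<omega>. (\<Sum>x\<leftarrow>xs. f x \<omega>) * (\<Sum>y\<leftarrow>ys. f y \<omega>)) (\<Sum>x\<leftarrow>xs. \<Sum>y\<leftarrow>ys. c x y)"
  unfolding sum_list_mult_const[symmetric] unfolding sum_list_const_mult[symmetric]
  by (intro has_bochner_integral_sum_list assms)

text \<open>
  Used in both directions, this carries an equality of \<open>L\<^sup>2\<close> norms on two different spaces over to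
  the \<open>L\<^sup>2\<close> limits. In extended arithmetic the triangle inequality for the norms is replaced by \<open>f\<^sup>2 \<le> (1 + \<epsilon>) g\<^sup>2 + (1 + 1/\<epsilon>) (f - g)\<^sup>2\<close>, which is linear in the squares.
\<close>

lemma nn_integral_square_limit_le:
  fixes a :: "'b \<Rightarrow> real" and b :: "'c \<Rightarrow> real"
  assumes [measurable]: "a \<in> borel_measurable N" "\<And>n. an n \<in> borel_measurable N"
      "b \<in> borel_measurable N'" "\<And>n. bn n \<in> borel_measurable N'"
    and eq: "\<And>n. (\<integral>\<^sup>+z. ennreal ((an n z)\<^sup>2) \<partial>N) = (\<integral>\<^sup>+z. ennreal ((bn n z)\<^sup>2) \<partial>N')"
    and a: "(\<lambda>n. \<integral>\<^sup>+z. ennreal ((an n z - a z)\<^sup>2) \<partial>N) \<longlonglongrightarrow> 0"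
    and b: "(\<lambda>n. \<integral>\<^sup>+z. ennreal ((bn n z - b z)\<^sup>2) \<partial>N') \<longlonglongrightarrow> 0"
  shows "(\<integral>\<^sup>+z. ennreal ((a z)\<^sup>2) \<partial>N) \<le> (\<integral>\<^sup>+z. ennreal ((b z)\<^sup>2) \<partial>N')"
proof -
  have young: "(\<integral>\<^sup>+z. ennreal ((f z)\<^sup>2) \<partial>L) \<le> ennreal (1 + \<epsilon>) * (\<integral>\<^sup>+z. ennreal ((g z)\<^sup>2) \<partial>L)
      + ennreal (1 + 1 / \<epsilon>) * (\<integral>\<^sup>+z. ennreal ((f z - g z)\<^sup>2) \<partial>L)"
    if [measurable]: "f \<in> borel_measurable L" "g \<in> borel_measurable L" and \<epsilon>: "0 < \<epsilon>"
    for f g :: "'d \<Rightarrow> real" and L \<epsilon>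
  proof -
    have "(\<integral>\<^sup>+z. ennreal ((f z)\<^sup>2) \<partial>L) \<le> (\<integral>\<^sup>+z. ennreal (1 + \<epsilon>) * ennreal ((g z)\<^sup>2) + ennreal (1 + 1 / \<epsilon>) * ennreal ((f z - g z)\<^sup>2) \<partial>L)"
    proof (intro nn_integral_mono)
      fix z
      \<comment> \<open>The difference of the two sides is this square divided by \<open>\<epsilon>\<close>.\<close>
      have "0 \<le> (\<epsilon> * g z - (f z - g z))\<^sup>2 / \<epsilon>" using \<epsilon> by simp
      also have "\<dots> = (1 + \<epsilon>) * (g z)\<^sup>2 + (1 + 1 / \<epsilon>) * (f z - g z)\<^sup>2 - (f z)\<^sup>2"
        using \<epsilon> by (simp add: field_simps power2_eq_square)
      finally have "(f z)\<^sup>2 \<le> (1 + \<epsilon>) * (g z)\<^sup>2 + (1 + 1 / \<epsilon>) * (f z - g z)\<^sup>2" by simp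
      hence "ennreal ((f z)\<^sup>2) \<le> ennreal ((1 + \<epsilon>) * (g z)\<^sup>2 + (1 + 1 / \<epsilon>) * (f z - g z)\<^sup>2)" by (rule ennreal_leI)
      also have "\<dots> = ennreal (1 + \<epsilon>) * ennreal ((g z)\<^sup>2) + ennreal (1 + 1 / \<epsilon>) * ennreal ((f z - g z)\<^sup>2)"
        using \<epsilon> by (subst ennreal_plus) (auto simp: ennreal_mult)
      finally show "ennreal ((f z)\<^sup>2) \<le> ennreal (1 + \<epsilon>) * ennreal ((g z)\<^sup>2) + ennreal (1 + 1 / \<epsilon>) * ennreal ((f z - g z)\<^sup>2)" .
    qed
    thus ?thesis by (simp add: nn_integral_add nn_integral_cmult)
  qed
  let ?A = "\<integral>\<^sup>+z. ennreal ((a z)\<^sup>2) \<partial>N" and ?B = "\<integral>\<^sup>+z. ennreal ((b z)\<^sup>2) \<partial>N'"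
  have le: "?A \<le> ennreal (1 + \<epsilon>) * (ennreal (1 + \<epsilon>) * ?B)" if \<epsilon>: "0 < \<epsilon>" for \<epsilon>
  proof -
    let ?\<delta> = "\<lambda>n. \<integral>\<^sup>+z. ennreal ((an n z - a z)\<^sup>2) \<partial>N" and ?\<eta> = "\<lambda>n. \<integral>\<^sup>+z. ennreal ((bn n z - b z)\<^sup>2) \<partial>N'"
    have le: "?A \<le> ennreal (1 + \<epsilon>) * (ennreal (1 + \<epsilon>) * ?B + ennreal (1 + 1 / \<epsilon>) * ?\<eta> n) + ennreal (1 + 1 / \<epsilon>) * ?\<delta> n" for n
    proof -
      have "?A \<le> ennreal (1 + \<epsilon>) * (\<integral>\<^sup>+z. ennreal ((an n z)\<^sup>2) \<partial>N) + ennreal (1 + 1 / \<epsilon>) * (\<integral>\<^sup>+z. ennreal ((a z - an n z)\<^sup>2) \<partial>N)"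
        by (rule young) (use \<epsilon> in auto)
      also have "(\<integral>\<^sup>+z. ennreal ((a z - an n z)\<^sup>2) \<partial>N) = ?\<delta> n" by (simp add: power2_commute)
      also have "(\<integral>\<^sup>+z. ennreal ((an n z)\<^sup>2) \<partial>N) \<le> ennreal (1 + \<epsilon>) * ?B + ennreal (1 + 1 / \<epsilon>) * ?\<eta> n"
        unfolding eq by (rule young) (use \<epsilon> in auto)
      finally show ?thesis by (simp add: mult_left_mono add_right_mono)
    qed
    have "(\<lambda>n. ennreal (1 + \<epsilon>) * (ennreal (1 + \<epsilon>) * ?B + ennreal (1 + 1 / \<epsilon>) * ?\<eta> n) + ennreal (1 + 1 / \<epsilon>) * ?\<delta> n)
      \<longlonglongrightarrow> ennreal (1 + \<epsilon>) * (ennreal (1 + \<epsilon>) * ?B + ennreal (1 + 1 / \<epsilon>) * 0) + ennreal (1 + 1 / \<epsilon>) * 0"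
      by (intro tendsto_add ennreal_tendsto_cmult tendsto_const a b) auto
    from LIMSEQ_le_const[OF this] le show ?thesis by simp
  qed
  show ?thesis
  proof (cases "?B")
    case (real r)
    have "?A < \<infinity>" using le[of 1] real by (auto simp: ennreal_mult_less_top order.strict_trans1)
    then obtain s where s: "?A = ennreal s" "0 \<le> s" by (cases ?A) auto
    have "s \<le> (1 + inverse (real (Suc n))) * ((1 + inverse (real (Suc n))) * r)" for n
      using le[of "inverse (real (Suc n))"] real s by (simp add: ennreal_mult[symmetric] del: ennreal_plus)
    moreover have "(\<lambda>n. (1 + inverse (real (Suc n))) * ((1 + inverse (real (Suc n))) * r)) \<longlonglongrightarrow> (1 + 0) * ((1 + 0) * r)"
      by (intro tendsto_intros LIMSEQ_inverse_real_of_nat)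
    ultimately have "s \<le> r" using LIMSEQ_le_const by fastforce
    thus ?thesis using real s by (simp add: ennreal_leI)
  qed simp
qed

context white_noise
begin

lemma simple_predictable_iff: "simple_predictable M F \<phi> \<longleftrightarrow> (\<forall>x\<in>set \<phi>. valid_term x)"
  unfolding simple_predictable_def valid_term_def ..

definition term_value :: "(('a \<Rightarrow> real) \<times> real \<times> real \<times> real set) \<Rightarrow> (real \<times> real) \<times> 'a \<Rightarrow> real" where
  "term_value = (\<lambda>(X, a, b, A) (z, \<omega>). X \<omega> * indicator ({a<..b} \<times> A) z)"

definition term_integral :: "(('a \<Rightarrow> real) \<times> real \<times> real \<times> real set) \<Rightarrow> 'a \<Rightarrow> real" where
  "term_integral = (\<lambda>(X, a, b, A) \<omega>. X \<omega> * W ({a<..b} \<times> A) \<omega>)"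

lemma simple_value_eq: "simple_value \<phi> s y \<omega> = (\<Sum>x\<leftarrow>\<phi>. term_value x ((s, y), \<omega>))"
  unfolding simple_value_def term_value_def
  by (rule arg_cong[of _ _ sum_list], rule map_cong) (auto simp: indicator_def)

lemma simple_integral_eq: "simple_integral_W W \<phi> \<omega> = (\<Sum>x\<leftarrow>\<phi>. term_integral x \<omega>)"
  unfolding simple_integral_W_def term_integral_def
  by (rule arg_cong[of _ _ sum_list], rule map_cong) auto

sublocale half_plane_pair: pair_sigma_finite open_half_plane M
  by (intro pair_sigma_finite.intro sigma_finite_half_plane sigma_finite_measure_axioms)

lemma term_measurable:
  assumes "valid_term x"
  shows "term_value x \<in> borel_measurable (open_half_plane \<Otimes>\<^sub>M M)" "term_integral x \<in> borel_measurable M"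
proof -
  obtain X a b A where x: "x = (X, a, b, A)" by (cases x)
  have v: "0 \<le> a" "A \<in> sets borel" "emeasure lborel A < \<infinity>" "X \<in> borel_measurable (F a)"
    using assms by (auto simp: x valid_term_def)
  have [measurable]: "X \<in> borel_measurable M" by (rule past_measurable[OF v(4)])
  have R: "{a<..b} \<times> A \<in> noise_sets" by (rule rectangle_noise_sets[OF v(1-3)])
  have [measurable]: "W ({a<..b} \<times> A) \<in> borel_measurable M" by (rule noise_measurable[OF R])
  have [measurable]: "indicator ({a<..b} \<times> A) \<in> borel_measurable open_half_plane"
    using R unfolding open_half_plane_def noise_sets_def
    by (intro measurable_restrict_space1 borel_measurable_indicator) auto
  show "term_value x \<in> borel_measurable (open_half_plane \<Otimes>\<^sub>M M)"
    unfolding x term_value_def prod.case by measurable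
  show "term_integral x \<in> borel_measurable M"
    unfolding x term_integral_def prod.case by measurable
qed

text \<open>
  The isometry in polarised form, for single terms: both sides are \<open>E[X Y]\<close> times the area of the
  intersection of the two rectangles. These lie in the open half-plane since the time intervals are
  open on the left.
\<close>

lemma term_covariance:
  assumes x: "valid_term x" and y: "valid_term y"
  shows "integrable M (\<lambda>\<omega>. term_integral x \<omega> * term_integral y \<omega>)"
    "has_bochner_integral (open_half_plane \<Otimes>\<^sub>M M) (\<lambda>z. term_value x z * term_value y z)
      (expectation (\<lambda>\<omega>. term_integral x \<omega> * term_integral y \<omega>))"
proof -
  obtain X a b A where xX: "x = (X, a, b, A)" by (cases x)
  obtain Y a' b' B where yY: "y = (Y, a', b', B)" by (cases y)
  let ?R = "{a<..b} \<times> A" and ?S = "{a'<..b'} \<times> B"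
  let ?c = "expectation (\<lambda>\<omega>. X \<omega> * Y \<omega>) * measure lborel (?R \<inter> ?S)"
  have vx: "0 \<le> a" "A \<in> sets borel" "emeasure lborel A < \<infinity>" "X \<in> borel_measurable (F a)"
    using x by (auto simp: xX valid_term_def)
  have vy: "0 \<le> a'" "B \<in> sets borel" "emeasure lborel B < \<infinity>" "Y \<in> borel_measurable (F a')"
    using y by (auto simp: yY valid_term_def)
  have [measurable]: "X \<in> borel_measurable M" "Y \<in> borel_measurable M"
    by (rule past_measurable[OF vx(4)] past_measurable[OF vy(4)])+
  have 1: "has_bochner_integral M (\<lambda>\<omega>. term_integral x \<omega> * term_integral y \<omega>) ?c"
    using noise_term_covariance[of X a b A Y a' b' B] x y unfolding xX yY term_integral_def by simp
  obtain C D where C: "\<And>\<omega>. \<omega> \<in> space M \<Longrightarrow> \<bar>X \<omega>\<bar> \<le> C" and D: "\<And>\<omega>. \<omega> \<in> space M \<Longrightarrow> \<bar>Y \<omega>\<bar> \<le> D"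
    using x y by (auto simp: valid_term_def xX yY)
  have XY: "\<bar>X \<omega> * Y \<omega>\<bar> \<le> C * D" if "\<omega> \<in> space M" for \<omega>
    unfolding abs_mult using C[OF that] D[OF that] by (intro mult_mono) auto
  have iXY: "integrable M (\<lambda>\<omega>. X \<omega> * Y \<omega>)"
    using integrable_bounded_mult[of "\<lambda>\<omega>. X \<omega> * Y \<omega>" "C * D" "\<lambda>_. 1"] XY by simp
  have RS: "?R \<inter> ?S \<in> noise_sets"
    using noise_sets_subset[OF rectangle_noise_sets[OF vx(1-3)], of "?R \<inter> ?S"]
      rectangle_noise_sets[OF vx(1-3)] rectangle_noise_sets[OF vy(1-3)] unfolding noise_sets_def by blast
  have H: "{0<..} \<times> UNIV \<in> sets (lborel :: (real \<times> real) measure)"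
    unfolding lborel_prod[symmetric] by measurable
  have sub: "?R \<inter> ?S \<subseteq> {0<..} \<times> UNIV" using vx(1) by auto
  have RSh: "?R \<inter> ?S \<in> sets open_half_plane" "emeasure open_half_plane (?R \<inter> ?S) < \<infinity>"
      "measure open_half_plane (?R \<inter> ?S) = measure lborel (?R \<inter> ?S)"
    using H sub RS unfolding open_half_plane_def noise_sets_def
    by (auto simp: sets_restrict_space_iff emeasure_restrict_space measure_restrict_space)
  have h: "has_bochner_integral open_half_plane (indicator (?R \<inter> ?S)) (measure lborel (?R \<inter> ?S))"
    using has_bochner_integral_real_indicator[OF RSh(1,2)] unfolding RSh(3) .
  have "has_bochner_integral (open_half_plane \<Otimes>\<^sub>M M) (\<lambda>z. indicator (?R \<inter> ?S) (fst z) * (X (snd z) * Y (snd z)))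
    (integral\<^sup>L open_half_plane (indicator (?R \<inter> ?S)) * expectation (\<lambda>\<omega>. X \<omega> * Y \<omega>))"
    using half_plane_pair.has_bochner_integral_product[OF _ iXY] h by (simp add: has_bochner_integral_iff)
  also have "integral\<^sup>L open_half_plane (indicator (?R \<inter> ?S)) * expectation (\<lambda>\<omega>. X \<omega> * Y \<omega>) = ?c"
    using h by (simp add: has_bochner_integral_iff)
  also have "(\<lambda>z. indicator (?R \<inter> ?S) (fst z) * (X (snd z) * Y (snd z))) = (\<lambda>z. term_value x z * term_value y z)"
    by (auto simp: xX yY term_value_def indicator_inter_arith fun_eq_iff mult_ac)
  finally show "integrable M (\<lambda>\<omega>. term_integral x \<omega> * term_integral y \<omega>)"
    "has_bochner_integral (open_half_plane \<Otimes>\<^sub>M M) (\<lambda>z. term_value x z * term_value y z)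
      (expectation (\<lambda>\<omega>. term_integral x \<omega> * term_integral y \<omega>))"
    using 1 by (simp_all add: has_bochner_integral_iff)
qed

lemma simple_isometry:
  assumes "simple_predictable M F \<phi>"
  shows "(\<integral>\<^sup>+((s, y), \<omega>). ennreal ((simple_value \<phi> s y \<omega>)\<^sup>2) \<partial>(open_half_plane \<Otimes>\<^sub>M M))
      = (\<integral>\<^sup>+\<omega>. ennreal ((simple_integral_W W \<phi> \<omega>)\<^sup>2) \<partial>M)"
    and "(\<integral>\<^sup>+\<omega>. ennreal ((simple_integral_W W \<phi> \<omega>)\<^sup>2) \<partial>M) < \<infinity>"
proof -
  have v: "\<And>x. x \<in> set \<phi> \<Longrightarrow> valid_term x" using assms by (simp add: simple_predictable_iff)
  define c where "c = (\<lambda>x y. expectation (\<lambda>\<omega>. term_integral x \<omega> * term_integral y \<omega>))"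
  have c: "has_bochner_integral M (\<lambda>\<omega>. term_integral x \<omega> * term_integral y \<omega>) (c x y)"
    "has_bochner_integral (open_half_plane \<Otimes>\<^sub>M M) (\<lambda>z. term_value x z * term_value y z) (c x y)"
    if "x \<in> set \<phi>" "y \<in> set \<phi>" for x y
    using term_covariance[OF v v, OF that] by (simp_all add: c_def has_bochner_integral_iff)
  have 1: "has_bochner_integral M (\<lambda>\<omega>. (simple_integral_W W \<phi> \<omega>)\<^sup>2) (\<Sum>x\<leftarrow>\<phi>. \<Sum>y\<leftarrow>\<phi>. c x y)"
    unfolding simple_integral_eq power2_eq_square by (intro has_bochner_integral_sum_list_mult c)
  have 2: "has_bochner_integral (open_half_plane \<Otimes>\<^sub>M M) (\<lambda>((s, y), \<omega>). (simple_value \<phi> s y \<omega>)\<^sup>2) (\<Sum>x\<leftarrow>\<phi>. \<Sum>y\<leftarrow>\<phi>. c x y)"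
    using has_bochner_integral_sum_list_mult[of \<phi> \<phi> _ term_value c, OF c(2)]
    unfolding simple_value_eq power2_eq_square by (simp add: case_prod_beta')
  have 3: "(\<integral>\<^sup>+\<omega>. ennreal ((simple_integral_W W \<phi> \<omega>)\<^sup>2) \<partial>M) = ennreal (\<Sum>x\<leftarrow>\<phi>. \<Sum>y\<leftarrow>\<phi>. c x y)"
    using 1 by (subst nn_integral_eq_integral) (auto simp: has_bochner_integral_iff)
  have 4: "(\<integral>\<^sup>+z. ennreal ((\<lambda>((s, y), \<omega>). (simple_value \<phi> s y \<omega>)\<^sup>2) z) \<partial>(open_half_plane \<Otimes>\<^sub>M M)) = ennreal (\<Sum>x\<leftarrow>\<phi>. \<Sum>y\<leftarrow>\<phi>. c x y)"
    using 2 by (subst nn_integral_eq_integral) (auto simp: has_bochner_integral_iff)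
  show "(\<integral>\<^sup>+\<omega>. ennreal ((simple_integral_W W \<phi> \<omega>)\<^sup>2) \<partial>M) < \<infinity>" unfolding 3 by simp
  show "(\<integral>\<^sup>+((s, y), \<omega>). ennreal ((simple_value \<phi> s y \<omega>)\<^sup>2) \<partial>(open_half_plane \<Otimes>\<^sub>M M))
      = (\<integral>\<^sup>+\<omega>. ennreal ((simple_integral_W W \<phi> \<omega>)\<^sup>2) \<partial>M)"
    using 4 unfolding 3 by (simp add: case_prod_beta')
qed

lemma simple_measurable:
  assumes "simple_predictable M F \<phi>"
  shows "(\<lambda>((s, y), \<omega>). simple_value \<phi> s y \<omega>) \<in> borel_measurable (open_half_plane \<Otimes>\<^sub>M M)"
    "simple_integral_W W \<phi> \<in> borel_measurable M"
proof -
  have v: "\<And>x. x \<in> set \<phi> \<Longrightarrow> valid_term x" using assms by (simp add: simple_predictable_iff)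
  have *: "(\<lambda>z. \<Sum>x\<leftarrow>\<phi>. f x z) \<in> borel_measurable N" if "\<And>x. x \<in> set \<phi> \<Longrightarrow> f x \<in> borel_measurable N"
    for f :: "_ \<Rightarrow> 'n \<Rightarrow> real" and N
    using that by (induction \<phi>) auto
  show "(\<lambda>((s, y), \<omega>). simple_value \<phi> s y \<omega>) \<in> borel_measurable (open_half_plane \<Otimes>\<^sub>M M)"
  proof -
    have "(\<lambda>((s, y), \<omega>). simple_value \<phi> s y \<omega>) = (\<lambda>z. \<Sum>x\<leftarrow>\<phi>. term_value x z)"
      by (auto simp: simple_value_eq fun_eq_iff)
    with *[of term_value, OF term_measurable(1)[OF v]] show ?thesis by simp
  qed
  show "simple_integral_W W \<phi> \<in> borel_measurable M"
    using *[of term_integral, OF term_measurable(2)[OF v]] unfolding simple_integral_eq[abs_def] .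
qed

lemma simple_expectation:
  assumes "simple_predictable M F \<phi>"
  shows "expectation (simple_integral_W W \<phi>) = 0"
proof -
  have "has_bochner_integral M (term_integral x) 0" if x: "x \<in> set \<phi>" for x
  proof -
    obtain X a b A where xX: "x = (X, a, b, A)" by (cases x)
    have vx: "0 \<le> a" "A \<in> sets borel" "emeasure lborel A < \<infinity>" "X \<in> borel_measurable (F a)" "\<exists>C. \<forall>\<omega>\<in>space M. \<bar>X \<omega>\<bar> \<le> C"
      using x assms by (auto simp: xX valid_term_def simple_predictable_iff)
    then obtain C where C: "\<And>\<omega>. \<omega> \<in> space M \<Longrightarrow> \<bar>X \<omega>\<bar> \<le> C" by blast
    have R: "{a<..b} \<times> A \<in> noise_sets" by (rule rectangle_noise_sets[OF vx(1-3)])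
    have iX: "integrable M X" using integrable_bounded_mult[of X C "\<lambda>_. 1"] C past_measurable[OF vx(4)] by simp
    have WN: "W ({a<..b} \<times> A) \<in> borel_measurable (noise_after a)" by (intro measurable_noise_after R) auto
    show ?thesis
      using expectation_past_times_future[OF vx(1) vx(4) iX WN noise_moments(2)[OF R]] noise_moments(3)[OF R]
      unfolding xX term_integral_def by (simp add: has_bochner_integral_iff)
  qed
  from has_bochner_integral_sum_list[of \<phi> M term_integral "\<lambda>_. 0", OF this]
  show ?thesis unfolding simple_integral_eq[abs_def] by (simp add: has_bochner_integral_iff)
qed

lemma has_walsh_integral_add:
  assumes f: "has_walsh_integral M F W f I" and g: "has_walsh_integral M F W g J"
  shows "has_walsh_integral M F W (\<lambda>s y \<omega>. f s y \<omega> + g s y \<omega>) (\<lambda>\<omega>. I \<omega> + J \<omega>)"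
proof -
  have mf [measurable]: "(\<lambda>((s, y), \<omega>). f s y \<omega>) \<in> borel_measurable (open_half_plane \<Otimes>\<^sub>M M)"
    and mg [measurable]: "(\<lambda>((s, y), \<omega>). g s y \<omega>) \<in> borel_measurable (open_half_plane \<Otimes>\<^sub>M M)"
    and [measurable]: "I \<in> borel_measurable M" "J \<in> borel_measurable M"
    using f g by (auto simp: has_walsh_integral_def)
  obtain \<phi> \<psi> where p: "\<And>n. simple_predictable M F (\<phi> n)" "\<And>n. simple_predictable M F (\<psi> n)"
    and l: "(\<lambda>n. \<integral>\<^sup>+ ((s, y), \<omega>). ennreal ((simple_value (\<phi> n) s y \<omega> - f s y \<omega>)\<^sup>2) \<partial>(open_half_plane \<Otimes>\<^sub>M M)) \<longlonglongrightarrow> 0"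
        "(\<lambda>n. \<integral>\<^sup>+ \<omega>. ennreal ((simple_integral_W W (\<phi> n) \<omega> - I \<omega>)\<^sup>2) \<partial>M) \<longlonglongrightarrow> 0"
        "(\<lambda>n. \<integral>\<^sup>+ ((s, y), \<omega>). ennreal ((simple_value (\<psi> n) s y \<omega> - g s y \<omega>)\<^sup>2) \<partial>(open_half_plane \<Otimes>\<^sub>M M)) \<longlonglongrightarrow> 0"
        "(\<lambda>n. \<integral>\<^sup>+ \<omega>. ennreal ((simple_integral_W W (\<psi> n) \<omega> - J \<omega>)\<^sup>2) \<partial>M) \<longlonglongrightarrow> 0"
    using f g unfolding has_walsh_integral_def by blast
  note [measurable] = simple_measurable[OF p(1)] simple_measurable[OF p(2)]
  have le: "(\<integral>\<^sup>+z. ennreal ((a z + b z - (c z + d z))\<^sup>2) \<partial>N)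
    \<le> 2 * (\<integral>\<^sup>+z. ennreal ((a z - c z)\<^sup>2) \<partial>N) + 2 * (\<integral>\<^sup>+z. ennreal ((b z - d z)\<^sup>2) \<partial>N)"
    if [measurable]: "a \<in> borel_measurable N" "b \<in> borel_measurable N" "c \<in> borel_measurable N" "d \<in> borel_measurable N"
    for a b c d :: "'z \<Rightarrow> real" and N
  proof -
    have "(\<integral>\<^sup>+z. ennreal ((a z + b z - (c z + d z))\<^sup>2) \<partial>N) \<le> (\<integral>\<^sup>+z. 2 * ennreal ((a z - c z)\<^sup>2) + 2 * ennreal ((b z - d z)\<^sup>2) \<partial>N)"
    proof (intro nn_integral_mono)
      fix z
      have "0 \<le> ((a z - c z) - (b z - d z))\<^sup>2" by simp
      hence "(a z + b z - (c z + d z))\<^sup>2 \<le> 2 * (a z - c z)\<^sup>2 + 2 * (b z - d z)\<^sup>2"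
        by (simp add: power2_eq_square algebra_simps)
      hence "ennreal ((a z + b z - (c z + d z))\<^sup>2) \<le> ennreal (2 * (a z - c z)\<^sup>2 + 2 * (b z - d z)\<^sup>2)" by (rule ennreal_leI)
      also have "\<dots> = 2 * ennreal ((a z - c z)\<^sup>2) + 2 * ennreal ((b z - d z)\<^sup>2)"
        by (simp add: ennreal_mult)
      finally show "ennreal ((a z + b z - (c z + d z))\<^sup>2) \<le> 2 * ennreal ((a z - c z)\<^sup>2) + 2 * ennreal ((b z - d z)\<^sup>2)" .
    qed
    thus ?thesis by (simp add: nn_integral_add nn_integral_cmult)
  qed
  have lim: "(\<lambda>n. 2 * a n + 2 * b n) \<longlonglongrightarrow> (0::ennreal)" if "a \<longlonglongrightarrow> 0" "b \<longlonglongrightarrow> 0" for a b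
    using tendsto_add[OF ennreal_tendsto_cmult[OF _ that(1), of 2] ennreal_tendsto_cmult[OF _ that(2), of 2]] by simp
  have 1: "simple_value (\<phi> n @ \<psi> n) s y \<omega> = simple_value (\<phi> n) s y \<omega> + simple_value (\<psi> n) s y \<omega>" for n s y \<omega>
    by (simp add: simple_value_def)
  have 2: "simple_integral_W W (\<phi> n @ \<psi> n) \<omega> = simple_integral_W W (\<phi> n) \<omega> + simple_integral_W W (\<psi> n) \<omega>" for n \<omega>
    by (simp add: simple_integral_W_def)
  show ?thesis unfolding has_walsh_integral_def
  proof (intro conjI exI[of _ "\<lambda>n. \<phi> n @ \<psi> n"] allI)
    show "simple_predictable M F (\<phi> n @ \<psi> n)" for n
      using p by (auto simp: simple_predictable_iff)
    show "(\<lambda>n. \<integral>\<^sup>+ ((s, y), \<omega>). ennreal ((simple_value (\<phi> n @ \<psi> n) s y \<omega> - (f s y \<omega> + g s y \<omega>))\<^sup>2) \<partial>(open_half_plane \<Otimes>\<^sub>M M)) \<longlonglongrightarrow> 0"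
    proof (rule tendsto_sandwich[OF _ _ tendsto_const lim[OF l(1) l(3)]])
      show "\<forall>\<^sub>F n in sequentially. (\<integral>\<^sup>+ ((s, y), \<omega>). ennreal ((simple_value (\<phi> n @ \<psi> n) s y \<omega> - (f s y \<omega> + g s y \<omega>))\<^sup>2) \<partial>(open_half_plane \<Otimes>\<^sub>M M))
        \<le> 2 * (\<integral>\<^sup>+ ((s, y), \<omega>). ennreal ((simple_value (\<phi> n) s y \<omega> - f s y \<omega>)\<^sup>2) \<partial>(open_half_plane \<Otimes>\<^sub>M M))
         + 2 * (\<integral>\<^sup>+ ((s, y), \<omega>). ennreal ((simple_value (\<psi> n) s y \<omega> - g s y \<omega>)\<^sup>2) \<partial>(open_half_plane \<Otimes>\<^sub>M M))"
        using le[OF simple_measurable(1)[OF p(1)] simple_measurable(1)[OF p(2)] mf mg]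
        unfolding 1 by (intro always_eventually allI) (simp add: case_prod_beta')
    qed simp
    show "(\<lambda>n. \<integral>\<^sup>+ \<omega>. ennreal ((simple_integral_W W (\<phi> n @ \<psi> n) \<omega> - (I \<omega> + J \<omega>))\<^sup>2) \<partial>M) \<longlonglongrightarrow> 0"
    proof (rule tendsto_sandwich[OF _ _ tendsto_const lim[OF l(2) l(4)]])
      show "\<forall>\<^sub>F n in sequentially. (\<integral>\<^sup>+ \<omega>. ennreal ((simple_integral_W W (\<phi> n @ \<psi> n) \<omega> - (I \<omega> + J \<omega>))\<^sup>2) \<partial>M)
        \<le> 2 * (\<integral>\<^sup>+ \<omega>. ennreal ((simple_integral_W W (\<phi> n) \<omega> - I \<omega>)\<^sup>2) \<partial>M)
         + 2 * (\<integral>\<^sup>+ \<omega>. ennreal ((simple_integral_W W (\<psi> n) \<omega> - J \<omega>)\<^sup>2) \<partial>M)"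
        unfolding 2 by (intro always_eventually allI le) measurable
    qed simp
    show "(\<lambda>((s, y), \<omega>). f s y \<omega> + g s y \<omega>) \<in> borel_measurable (open_half_plane \<Otimes>\<^sub>M M)"
      using borel_measurable_add[OF mf mg] by (simp add: case_prod_beta')
    show "(\<lambda>\<omega>. I \<omega> + J \<omega>) \<in> borel_measurable M" by measurable
  qed
qed

text \<open>
  All four facts hold for simple fields and pass to the \<open>L\<^sup>2\<close> limit. The expectation is controlled by
  \<open>(E I)\<^sup>2 = (E[I\<^sub>n - I])\<^sup>2 \<le> E[(I\<^sub>n - I)\<^sup>2]\<close>, where \<open>I\<^sub>n\<close> are the simple integrals, which have mean zero.
\<close>

lemma
  assumes f: "has_walsh_integral M F W f I"
  shows Walsh_isometry: "(\<integral>\<^sup>+((s, y), \<omega>). ennreal ((f s y \<omega>)\<^sup>2) \<partial>(open_half_plane \<Otimes>\<^sub>M M)) = (\<integral>\<^sup>+\<omega>. ennreal ((I \<omega>)\<^sup>2) \<partial>M)"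
    and Walsh_square_integrable: "integrable M (\<lambda>\<omega>. (I \<omega>)\<^sup>2)"
    and Walsh_integrable: "integrable M I"
    and Walsh_expectation: "expectation I = 0"
proof -
  have mf: "(\<lambda>((s, y), \<omega>). f s y \<omega>) \<in> borel_measurable (open_half_plane \<Otimes>\<^sub>M M)" and mI [measurable]: "I \<in> borel_measurable M"
    using f by (auto simp: has_walsh_integral_def)
  obtain \<phi> where p: "\<And>n. simple_predictable M F (\<phi> n)"
    and l1: "(\<lambda>n. \<integral>\<^sup>+ ((s, y), \<omega>). ennreal ((simple_value (\<phi> n) s y \<omega> - f s y \<omega>)\<^sup>2) \<partial>(open_half_plane \<Otimes>\<^sub>M M)) \<longlonglongrightarrow> 0"
    and l2: "(\<lambda>n. \<integral>\<^sup>+ \<omega>. ennreal ((simple_integral_W W (\<phi> n) \<omega> - I \<omega>)\<^sup>2) \<partial>M) \<longlonglongrightarrow> 0"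
    using f unfolding has_walsh_integral_def by blast
  note m = simple_measurable[OF p]
  note [measurable] = m(2)
  let ?S = "\<lambda>n. simple_integral_W W (\<phi> n)"
  have l1': "(\<lambda>n. \<integral>\<^sup>+z. ennreal (((\<lambda>((s, y), \<omega>). simple_value (\<phi> n) s y \<omega>) z - (\<lambda>((s, y), \<omega>). f s y \<omega>) z)\<^sup>2) \<partial>(open_half_plane \<Otimes>\<^sub>M M)) \<longlonglongrightarrow> 0"
    using l1 by (simp add: case_prod_beta')
  have eq: "(\<integral>\<^sup>+z. ennreal (((\<lambda>((s, y), \<omega>). simple_value (\<phi> n) s y \<omega>) z)\<^sup>2) \<partial>(open_half_plane \<Otimes>\<^sub>M M)) = (\<integral>\<^sup>+\<omega>. ennreal ((?S n \<omega>)\<^sup>2) \<partial>M)" for n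
    using simple_isometry(1)[OF p[of n]] by (simp add: case_prod_beta')
  have "(\<integral>\<^sup>+z. ennreal (((\<lambda>((s, y), \<omega>). f s y \<omega>) z)\<^sup>2) \<partial>(open_half_plane \<Otimes>\<^sub>M M)) = (\<integral>\<^sup>+\<omega>. ennreal ((I \<omega>)\<^sup>2) \<partial>M)"
    by (intro antisym nn_integral_square_limit_le[OF mf m(1) mI m(2) eq l1' l2]
      nn_integral_square_limit_le[OF mI m(2) mf m(1) eq[symmetric] l2 l1'])
  thus "(\<integral>\<^sup>+((s, y), \<omega>). ennreal ((f s y \<omega>)\<^sup>2) \<partial>(open_half_plane \<Otimes>\<^sub>M M)) = (\<integral>\<^sup>+\<omega>. ennreal ((I \<omega>)\<^sup>2) \<partial>M)"
    by (simp add: case_prod_beta')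
  obtain n0 where n0: "(\<integral>\<^sup>+ \<omega>. ennreal ((?S n0 \<omega> - I \<omega>)\<^sup>2) \<partial>M) < 1"
    using order_tendstoD(2)[OF l2, of 1] by (auto simp: eventually_sequentially)
  have iS: "integrable M (\<lambda>\<omega>. (?S n \<omega>)\<^sup>2)" for n
    using simple_isometry(2)[OF p[of n]] by (intro integrableI_bounded) auto
  have iS1: "integrable M (?S n)" for n
    by (rule square_integrable_imp_integrable[OF _ iS]) simp
  have iD0: "integrable M (\<lambda>\<omega>. (?S n0 \<omega> - I \<omega>)\<^sup>2)"
    using n0 by (intro integrableI_bounded) (auto intro: order.strict_trans)
  have iDS: "integrable M (\<lambda>\<omega>. ?S n0 \<omega> * (?S n0 \<omega> - I \<omega>))"
    by (rule integrable_mult_square_integrable[OF _ _ iS iD0]) measurable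
  have "(I \<omega>)\<^sup>2 = (?S n0 \<omega> - I \<omega>)\<^sup>2 + (?S n0 \<omega>)\<^sup>2 - 2 * (?S n0 \<omega> * (?S n0 \<omega> - I \<omega>))" for \<omega>
    by (simp add: power2_eq_square algebra_simps)
  with iDS iD0 iS[of n0] show iI: "integrable M (\<lambda>\<omega>. (I \<omega>)\<^sup>2)" by simp
  show iI1: "integrable M I" by (rule square_integrable_imp_integrable[OF mI iI])
  have "ennreal ((expectation I)\<^sup>2) \<le> (\<integral>\<^sup>+ \<omega>. ennreal ((?S n \<omega> - I \<omega>)\<^sup>2) \<partial>M)" for n
  proof -
    have iSI: "integrable M (\<lambda>\<omega>. ?S n \<omega> * I \<omega>)"
      by (rule integrable_mult_square_integrable[OF _ _ iS iI]) measurable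
    have "(?S n \<omega> - I \<omega>)\<^sup>2 = (?S n \<omega>)\<^sup>2 + (I \<omega>)\<^sup>2 - 2 * (?S n \<omega> * I \<omega>)" for \<omega>
      by (simp add: power2_eq_square algebra_simps)
    with iSI iS[of n] iI have i2: "integrable M (\<lambda>\<omega>. (?S n \<omega> - I \<omega>)\<^sup>2)" by simp
    have i1: "integrable M (\<lambda>\<omega>. ?S n \<omega> - I \<omega>)" using iS1 iI1 by simp
    have "expectation (\<lambda>\<omega>. ?S n \<omega> - I \<omega>) = - expectation I"
      using iS1 iI1 simple_expectation[OF p[of n]] by simp
    hence "(expectation I)\<^sup>2 \<le> expectation (\<lambda>\<omega>. (?S n \<omega> - I \<omega>)\<^sup>2)"
      using variance_eq[OF i1 i2] variance_positive[of "\<lambda>\<omega>. ?S n \<omega> - I \<omega>"] by simp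
    also have "ennreal \<dots> = (\<integral>\<^sup>+ \<omega>. ennreal ((?S n \<omega> - I \<omega>)\<^sup>2) \<partial>M)"
      by (rule nn_integral_eq_integral[OF i2, symmetric]) simp
    finally show ?thesis by (simp add: ennreal_leI)
  qed
  hence "ennreal ((expectation I)\<^sup>2) \<le> 0" using LIMSEQ_le_const[OF l2] by blast
  thus "expectation I = 0" by (simp add: ennreal_eq_0_iff)
qed

text \<open>
  Polarisation of the isometry. Non-negativity of the product of the integrands lets the mixed term
  be an integral of a non-negative function. It holds in the application, where the integrands at
  \<open>(s, y)\<close> are non-negative multiples of the same random variable \<open>\<lambda> u(s, y)\<close>.
\<close>

lemma Walsh_covariance:
  assumes f: "has_walsh_integral M F W f I" and g: "has_walsh_integral M F W g J"
    and nonneg: "\<And>s y \<omega>. 0 \<le> f s y \<omega> * g s y \<omega>"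
  shows "integrable M (\<lambda>\<omega>. I \<omega> * J \<omega>)"
    and "(\<integral>\<^sup>+((s, y), \<omega>). ennreal (f s y \<omega> * g s y \<omega>) \<partial>(open_half_plane \<Otimes>\<^sub>M M)) = ennreal (expectation (\<lambda>\<omega>. I \<omega> * J \<omega>))"
    and "0 \<le> expectation (\<lambda>\<omega>. I \<omega> * J \<omega>)"
proof -
  note fg = has_walsh_integral_add[OF f g]
  define f' where "f' = (\<lambda>((s, y), \<omega>). f s y \<omega>)"
  define g' where "g' = (\<lambda>((s, y), \<omega>). g s y \<omega>)"
  have [measurable]: "f' \<in> borel_measurable (open_half_plane \<Otimes>\<^sub>M M)" "I \<in> borel_measurable M"
    "g' \<in> borel_measurable (open_half_plane \<Otimes>\<^sub>M M)" "J \<in> borel_measurable M"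
    using f g by (auto simp: has_walsh_integral_def f'_def g'_def)
  show IJ: "integrable M (\<lambda>\<omega>. I \<omega> * J \<omega>)"
    by (rule integrable_mult_square_integrable[OF _ _ Walsh_square_integrable[OF f] Walsh_square_integrable[OF g]]) measurable
  let ?E = "\<lambda>h. \<integral>\<^sup>+z. ennreal (h z) \<partial>(open_half_plane \<Otimes>\<^sub>M M)"
  have f2: "?E (\<lambda>z. (f' z)\<^sup>2) = ennreal (expectation (\<lambda>\<omega>. (I \<omega>)\<^sup>2))"
    using Walsh_isometry[OF f] nn_integral_eq_integral[OF Walsh_square_integrable[OF f]] by (simp add: f'_def case_prod_beta')
  have g2: "?E (\<lambda>z. (g' z)\<^sup>2) = ennreal (expectation (\<lambda>\<omega>. (J \<omega>)\<^sup>2))"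
    using Walsh_isometry[OF g] nn_integral_eq_integral[OF Walsh_square_integrable[OF g]] by (simp add: g'_def case_prod_beta')
  have "?E (\<lambda>z. (f' z + g' z)\<^sup>2) = ennreal (expectation (\<lambda>\<omega>. (I \<omega> + J \<omega>)\<^sup>2))"
    using Walsh_isometry[OF fg] nn_integral_eq_integral[OF Walsh_square_integrable[OF fg]] by (simp add: f'_def g'_def case_prod_beta')
  also have "expectation (\<lambda>\<omega>. (I \<omega> + J \<omega>)\<^sup>2) = expectation (\<lambda>\<omega>. (I \<omega>)\<^sup>2) + expectation (\<lambda>\<omega>. (J \<omega>)\<^sup>2) + 2 * expectation (\<lambda>\<omega>. I \<omega> * J \<omega>)"
    using IJ Walsh_square_integrable[OF f] Walsh_square_integrable[OF g] by (simp add: power2_sum mult.assoc)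
  finally have s1: "?E (\<lambda>z. (f' z + g' z)\<^sup>2) = ennreal (expectation (\<lambda>\<omega>. (I \<omega>)\<^sup>2) + expectation (\<lambda>\<omega>. (J \<omega>)\<^sup>2) + 2 * expectation (\<lambda>\<omega>. I \<omega> * J \<omega>))" .
  have nn: "0 \<le> f' z * g' z" for z using nonneg by (simp add: f'_def g'_def case_prod_beta')
  have "?E (\<lambda>z. (f' z + g' z)\<^sup>2) = (\<integral>\<^sup>+z. ennreal ((f' z)\<^sup>2) + ennreal ((g' z)\<^sup>2) + 2 * ennreal (f' z * g' z) \<partial>(open_half_plane \<Otimes>\<^sub>M M))"
  proof (intro nn_integral_cong)
    fix z
    have "ennreal ((f' z + g' z)\<^sup>2) = ennreal ((f' z)\<^sup>2 + (g' z)\<^sup>2 + 2 * (f' z * g' z))"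
      by (simp add: power2_sum mult.assoc)
    thus "ennreal ((f' z + g' z)\<^sup>2) = ennreal ((f' z)\<^sup>2) + ennreal ((g' z)\<^sup>2) + 2 * ennreal (f' z * g' z)"
      using nn[of z] by (simp add: ennreal_mult)
  qed
  also have "\<dots> = ?E (\<lambda>z. (f' z)\<^sup>2) + ?E (\<lambda>z. (g' z)\<^sup>2) + 2 * ?E (\<lambda>z. f' z * g' z)"
    by (simp add: nn_integral_add nn_integral_cmult)
  finally have s2: "ennreal (expectation (\<lambda>\<omega>. (I \<omega>)\<^sup>2)) + ennreal (expectation (\<lambda>\<omega>. (J \<omega>)\<^sup>2)) + 2 * ?E (\<lambda>z. f' z * g' z)
    = ennreal (expectation (\<lambda>\<omega>. (I \<omega>)\<^sup>2) + expectation (\<lambda>\<omega>. (J \<omega>)\<^sup>2) + 2 * expectation (\<lambda>\<omega>. I \<omega> * J \<omega>))"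
    unfolding s1 f2 g2 ..
  have "?E (\<lambda>z. f' z * g' z) \<noteq> \<infinity>" using s2 by (auto simp: ennreal_mult_eq_top_iff)
  then obtain r where r: "?E (\<lambda>z. f' z * g' z) = ennreal r" "0 \<le> r" by (cases "?E (\<lambda>z. f' z * g' z)") auto
  have p: "0 \<le> expectation (\<lambda>\<omega>. (I \<omega>)\<^sup>2)" "0 \<le> expectation (\<lambda>\<omega>. (J \<omega>)\<^sup>2)" by auto
  have q: "0 \<le> expectation (\<lambda>\<omega>. (I \<omega>)\<^sup>2) + expectation (\<lambda>\<omega>. (J \<omega>)\<^sup>2) + 2 * expectation (\<lambda>\<omega>. I \<omega> * J \<omega>)"
    unfolding \<open>expectation (\<lambda>\<omega>. (I \<omega> + J \<omega>)\<^sup>2) = _\<close>[symmetric] by simp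
  have "ennreal (expectation (\<lambda>\<omega>. (I \<omega>)\<^sup>2) + expectation (\<lambda>\<omega>. (J \<omega>)\<^sup>2) + 2 * r)
    = ennreal (expectation (\<lambda>\<omega>. (I \<omega>)\<^sup>2) + expectation (\<lambda>\<omega>. (J \<omega>)\<^sup>2) + 2 * expectation (\<lambda>\<omega>. I \<omega> * J \<omega>))"
    using s2 p r by (simp add: ennreal_mult)
  hence "r = expectation (\<lambda>\<omega>. I \<omega> * J \<omega>)"
    using p q r(2) by (subst (asm) ennreal_inj) auto
  with r show "(\<integral>\<^sup>+((s, y), \<omega>). ennreal (f s y \<omega> * g s y \<omega>) \<partial>(open_half_plane \<Otimes>\<^sub>M M)) = ennreal (expectation (\<lambda>\<omega>. I \<omega> * J \<omega>))"
    "0 \<le> expectation (\<lambda>\<omega>. I \<omega> * J \<omega>)"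
    by (simp_all add: f'_def g'_def case_prod_beta')
qed

end

section \<open>Integration against the initial measure\<close>

text \<open>
  The condition that \<open>M_H\<close> imposes on each part of the Jordan decomposition.
\<close>

definition gauss_finite :: "real measure \<Rightarrow> bool" where
  "gauss_finite m \<longleftrightarrow> sets m = sets borel \<and> (\<forall>a>0. (\<integral>\<^sup>+x. ennreal (exp (- a * x\<^sup>2)) \<partial>m) < \<infinity>)"

lemma M_H_gauss_finite:
  assumes "\<mu> \<in> M_H" shows "gauss_finite (fst \<mu>)" "gauss_finite (snd \<mu>)"
  using assms unfolding M_H_def gauss_finite_def jordan_pair_def variation_nn_integral_def
  by auto

lemma gauss_finite_sigma_finite:
  assumes "gauss_finite m"
  shows "sigma_finite_measure m"
proof
  have s: "sets m = sets borel" and f: "(\<integral>\<^sup>+x. ennreal (exp (- 1 * x\<^sup>2)) \<partial>m) < \<infinity>"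
    using assms zero_less_one unfolding gauss_finite_def by blast+
  have [measurable_cong]: "sets m = sets borel" by (rule s)
  have "emeasure m {- real n..real n} < \<infinity>" for n
  proof -
    have "emeasure m {- real n..real n} = (\<integral>\<^sup>+x. indicator {- real n..real n} x \<partial>m)"
      by (simp add: s)
    also have "\<dots> \<le> (\<integral>\<^sup>+x. ennreal (exp ((real n)\<^sup>2)) * ennreal (exp (- 1 * x\<^sup>2)) \<partial>m)"
    proof (intro nn_integral_mono)
      fix x
      have "1 \<le> exp ((real n)\<^sup>2) * exp (- 1 * x\<^sup>2)" if "x \<in> {- real n..real n}"
      proof -
        have "x\<^sup>2 \<le> (real n)\<^sup>2" using that by (intro abs_le_square_iff[THEN iffD1]) auto
        thus ?thesis unfolding exp_add[symmetric] by simp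
      qed
      thus "(indicator {- real n..real n} x :: ennreal) \<le> ennreal (exp ((real n)\<^sup>2)) * ennreal (exp (- 1 * x\<^sup>2))"
        by (auto simp: indicator_def ennreal_mult[symmetric] simp del: mult_minus1)
    qed
    also have "\<dots> = ennreal (exp ((real n)\<^sup>2)) * (\<integral>\<^sup>+x. ennreal (exp (- 1 * x\<^sup>2)) \<partial>m)"
      by (rule nn_integral_cmult) measurable
    also have "\<dots> < \<infinity>" using f by (simp add: ennreal_mult_less_top)
    finally show ?thesis .
  qed
  moreover have "(\<Union>n. {- real n..real n}) = UNIV"
  proof (intro set_eqI iffI UNIV_I)
    fix x :: real
    obtain n where "\<bar>x\<bar> \<le> real n" using real_arch_simple by blast
    thus "x \<in> (\<Union>n. {- real n..real n})" by (intro UN_I[of n]) auto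
  qed
  ultimately show "\<exists>A. countable A \<and> A \<subseteq> sets m \<and> \<Union>A = space m \<and> (\<forall>a\<in>A. emeasure m a \<noteq> \<infinity>)"
    by (intro exI[of _ "range (\<lambda>n. {- real n..real n})"])
      (use sets_eq_imp_space_eq[OF s] in \<open>auto simp: s less_top\<close>)
qed

text \<open>
  Since \<open>(x - z)\<^sup>2 \<ge> z\<^sup>2/2 - x\<^sup>2\<close>, the shifted Gaussian is dominated by a centred one of twice the variance.
\<close>

lemma heat_kernel_gauss_integrable:
  assumes m: "gauss_finite m" and "0 < \<nu>" "0 < t"
  shows "integrable m (\<lambda>z. heat_kernel \<nu> t (x - z))"
proof (rule integrableI_bounded)
  have [measurable_cong]: "sets m = sets borel" using m by (simp add: gauss_finite_def)
  show "(\<lambda>z. heat_kernel \<nu> t (x - z)) \<in> borel_measurable m" by measurable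
  define a where "a = 1 / (4 * \<nu> * t)"
  define C where "C = 1 / sqrt (2 * pi * \<nu> * t) * exp (x\<^sup>2 / (2 * \<nu> * t))"
  have a: "0 < a" and C: "0 \<le> C" using assms by (auto simp: a_def C_def)
  have "(\<integral>\<^sup>+z. ennreal (norm (heat_kernel \<nu> t (x - z))) \<partial>m) \<le> (\<integral>\<^sup>+z. ennreal C * ennreal (exp (- a * z\<^sup>2)) \<partial>m)"
  proof (intro nn_integral_mono)
    fix z
    have "- ((x - z)\<^sup>2 / (2 * \<nu> * t)) \<le> x\<^sup>2 / (2 * \<nu> * t) + - a * z\<^sup>2"
    proof -
      have "0 \<le> (2 * x - z)\<^sup>2 / (4 * \<nu> * t)" using assms by simp
      also have "(2 * x - z)\<^sup>2 / (4 * \<nu> * t) = (x - z)\<^sup>2 / (2 * \<nu> * t) + x\<^sup>2 / (2 * \<nu> * t) - a * z\<^sup>2"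
        using assms by (simp add: a_def field_simps power2_eq_square)
      finally show ?thesis by simp
    qed
    hence "exp (- ((x - z)\<^sup>2 / (2 * \<nu> * t))) \<le> exp (x\<^sup>2 / (2 * \<nu> * t)) * exp (- a * z\<^sup>2)"
      unfolding exp_add[symmetric] by simp
    hence "heat_kernel \<nu> t (x - z) \<le> C * exp (- a * z\<^sup>2)"
      unfolding heat_kernel_def C_def mult.assoc[of _ "exp _"] using assms by (intro mult_left_mono) auto
    thus "ennreal (norm (heat_kernel \<nu> t (x - z))) \<le> ennreal C * ennreal (exp (- a * z\<^sup>2))"
      using assms C by (simp add: heat_kernel_nonneg ennreal_mult[symmetric] ennreal_leI)
  qed
  also have "\<dots> = ennreal C * (\<integral>\<^sup>+z. ennreal (exp (- a * z\<^sup>2)) \<partial>m)"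
    by (rule nn_integral_cmult) measurable
  also have "\<dots> < \<infinity>" using m a unfolding gauss_finite_def by (simp add: ennreal_mult_less_top)
  finally show "(\<integral>\<^sup>+z. ennreal (norm (heat_kernel \<nu> t (x - z))) \<partial>m) < \<infinity>" .
qed

lemma
  assumes m: "gauss_finite m" and m': "gauss_finite m'" and \<nu>: "0 < \<nu>" and t: "0 < t"
  shows heat_kernel_pair_integral: "has_bochner_integral (m \<Otimes>\<^sub>M m') (\<lambda>(z1, z2). heat_kernel \<nu> t (x1 - z1) * heat_kernel \<nu> t (x2 - z2))
       ((\<integral>z. heat_kernel \<nu> t (x1 - z) \<partial>m) * (\<integral>z. heat_kernel \<nu> t (x2 - z) \<partial>m'))"
    and K_dag_integrable: "integrable (m \<Otimes>\<^sub>M m') (\<lambda>(z1, z2). K_dag \<nu> lam t (x1 - z1) (x2 - z2) y)"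
    and K_star_integrable: "integrable (m \<Otimes>\<^sub>M m') (\<lambda>(z1, z2). K_star \<nu> lam t (x1 - z1) (x2 - z2) y)"
proof -
  interpret pair_sigma_finite m m' by (intro pair_sigma_finite.intro gauss_finite_sigma_finite m m')
  have [measurable_cong]: "sets m = sets borel" "sets m' = sets borel" using m m' by (auto simp: gauss_finite_def)
  show 1: "has_bochner_integral (m \<Otimes>\<^sub>M m') (\<lambda>(z1, z2). heat_kernel \<nu> t (x1 - z1) * heat_kernel \<nu> t (x2 - z2))
       ((\<integral>z. heat_kernel \<nu> t (x1 - z) \<partial>m) * (\<integral>z. heat_kernel \<nu> t (x2 - z) \<partial>m'))"
    using has_bochner_integral_product[OF heat_kernel_gauss_integrable[OF m \<nu> t] heat_kernel_gauss_integrable[OF m' \<nu> t]]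
    by (simp add: case_prod_beta')
  obtain C where C: "0 \<le> C" "\<And>z1 z2 y. K_dag \<nu> lam t z1 z2 y \<le> C * (heat_kernel \<nu> t z1 * heat_kernel \<nu> t z2)"
    using K_dag_le[OF \<nu> t] by metis
  show 2: "integrable (m \<Otimes>\<^sub>M m') (\<lambda>(z1, z2). K_dag \<nu> lam t (x1 - z1) (x2 - z2) y)"
  proof (rule Bochner_Integration.integrable_bound)
    show "integrable (m \<Otimes>\<^sub>M m') (\<lambda>z. C * (\<lambda>(z1, z2). heat_kernel \<nu> t (x1 - z1) * heat_kernel \<nu> t (x2 - z2)) z)"
      using 1 by (intro integrable_mult_right) (simp add: has_bochner_integral_iff)
    show "AE z in m \<Otimes>\<^sub>M m'. norm ((\<lambda>(z1, z2). K_dag \<nu> lam t (x1 - z1) (x2 - z2) y) z)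
      \<le> norm (C * (\<lambda>(z1, z2). heat_kernel \<nu> t (x1 - z1) * heat_kernel \<nu> t (x2 - z2)) z)"
      using C(2) K_dag_nonneg[OF \<nu> t] by (intro AE_I2) (auto intro: order_trans[OF _ abs_ge_self])
  qed measurable
  show "integrable (m \<Otimes>\<^sub>M m') (\<lambda>(z1, z2). K_star \<nu> lam t (x1 - z1) (x2 - z2) y)"
    using Bochner_Integration.integrable_add[of _ _ "\<lambda>(z1, z2). K_dag \<nu> lam t (x1 - z1) (x2 - z2) y"] 1 2
    by (simp add: has_bochner_integral_iff K_star_def case_prod_beta')
qed

text \<open>
  The equation for point masses, integrated over the initial positions; everything is non-negative,
  so Tonelli's theorem exchanges the integrals and also yields the integrability.
\<close>

lemma pair_moment_Duhamel:
  assumes m: "gauss_finite m" and m': "gauss_finite m'" and \<nu>: "0 < \<nu>" and t: "0 < t"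
  shows "has_bochner_integral open_half_plane
     (\<lambda>(s, y). lam\<^sup>2 * joint_kernel \<nu> t x1 x2 s y * (\<integral>(z1, z2). K_star \<nu> lam s (y - z1) (y - z2) 0 \<partial>(m \<Otimes>\<^sub>M m')))
     (\<integral>(z1, z2). K_dag \<nu> lam t (x1 - z1) (x2 - z2) (x1 - x2) \<partial>(m \<Otimes>\<^sub>M m'))"
    and "(\<lambda>(s, y). \<integral>(z1, z2). K_star \<nu> lam s (y - z1) (y - z2) 0 \<partial>(m \<Otimes>\<^sub>M m')) \<in> borel_measurable open_half_plane"
proof -
  interpret pair_sigma_finite m m' by (intro pair_sigma_finite.intro gauss_finite_sigma_finite m m')
  have [measurable_cong]: "sets m = sets borel" "sets m' = sets borel" using m m' by (auto simp: gauss_finite_def)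
  interpret H: pair_sigma_finite open_half_plane "m \<Otimes>\<^sub>M m'"
    by (intro pair_sigma_finite.intro sigma_finite_half_plane P.sigma_finite_measure_axioms)
  let ?k = "\<lambda>s y. \<integral>(z1, z2). K_star \<nu> lam s (y - z1) (y - z2) 0 \<partial>(m \<Otimes>\<^sub>M m')"
  let ?J = "\<lambda>s y. lam\<^sup>2 * joint_kernel \<nu> t x1 x2 s y"
  have "(\<lambda>(s, y). ?k s y) \<in> borel_measurable (borel \<Otimes>\<^sub>M borel)"
    unfolding case_prod_beta' by measurable
  thus km: "(\<lambda>(s, y). ?k s y) \<in> borel_measurable open_half_plane" by (rule measurable_open_half_plane)
  have Jm: "(\<lambda>(s, y). ?J s y) \<in> borel_measurable open_half_plane"
    by (rule measurable_open_half_plane) measurable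
  have kJm: "(\<lambda>(s, y). ?J s y * ?k s y) \<in> borel_measurable open_half_plane"
    using borel_measurable_times[OF Jm km] by (simp add: case_prod_beta')
  have id: "(\<lambda>z. z) \<in> open_half_plane \<rightarrow>\<^sub>M (borel \<Otimes>\<^sub>M borel)"
    unfolding open_half_plane_def borel_prod by (intro measurable_restrict_space1) simp
  have meas: "(\<lambda>((s, y), (z1, z2)). ennreal (?J s y * K_star \<nu> lam s (y - z1) (y - z2) 0)) \<in> borel_measurable (open_half_plane \<Otimes>\<^sub>M (m \<Otimes>\<^sub>M m'))"
  proof -
    have "(\<lambda>((s, y), (z1, z2)). ennreal (?J s y * K_star \<nu> lam s (y - z1) (y - z2) 0)) \<in> borel_measurable ((borel \<Otimes>\<^sub>M borel) \<Otimes>\<^sub>M (m \<Otimes>\<^sub>M m'))"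
      unfolding case_prod_beta' by measurable
    from measurable_compose[OF measurable_Pair[OF measurable_compose[OF measurable_fst id] measurable_snd] this]
    show ?thesis by simp
  qed
  have Jn: "0 \<le> ?J s y" for s y using joint_kernel_nonneg[OF \<nu>] by simp
  have kn: "0 \<le> ?k s y" if "0 < s" for s y
    using K_star_nonneg[OF \<nu> that] by (intro integral_nonneg_AE) auto
  have nn: "0 \<le> ?J s y * ?k s y" for s y
    using Jn[of s y] kn[of s y] by (cases "0 < s") (auto simp: joint_kernel_def)
  have "(\<integral>\<^sup>+(s, y). ennreal (?J s y * ?k s y) \<partial>open_half_plane)
    = (\<integral>\<^sup>+p. \<integral>\<^sup>+q. (\<lambda>((s, y), (z1, z2)). ennreal (?J s y * K_star \<nu> lam s (y - z1) (y - z2) 0)) (p, q) \<partial>(m \<Otimes>\<^sub>M m') \<partial>open_half_plane)"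
  proof (intro nn_integral_cong)
    fix z assume z: "z \<in> space open_half_plane"
    obtain s y where sy: "z = (s, y)" by (cases z)
    with z have s: "0 < s" by (auto simp: open_half_plane_def space_restrict_space)
    have i: "integrable (m \<Otimes>\<^sub>M m') (\<lambda>(z1, z2). K_star \<nu> lam s (y - z1) (y - z2) 0)"
      by (rule K_star_integrable[OF m m' \<nu> s])
    have "(\<integral>\<^sup>+q. ennreal (?J s y * (\<lambda>(z1, z2). K_star \<nu> lam s (y - z1) (y - z2) 0) q) \<partial>(m \<Otimes>\<^sub>M m')) = ennreal (\<integral>q. ?J s y * (\<lambda>(z1, z2). K_star \<nu> lam s (y - z1) (y - z2) 0) q \<partial>(m \<Otimes>\<^sub>M m'))"
      using Jn K_star_nonneg[OF \<nu> s] i by (intro nn_integral_eq_integral integrable_mult_right AE_I2) (auto simp: case_prod_beta')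
    thus "(case z of (s, y) \<Rightarrow> ennreal (?J s y * ?k s y)) = (\<integral>\<^sup>+q. (\<lambda>((s, y), (z1, z2)). ennreal (?J s y * K_star \<nu> lam s (y - z1) (y - z2) 0)) (z, q) \<partial>(m \<Otimes>\<^sub>M m'))"
      by (simp add: sy case_prod_beta')
  qed
  also have "\<dots> = (\<integral>\<^sup>+q. \<integral>\<^sup>+p. (\<lambda>((s, y), (z1, z2)). ennreal (?J s y * K_star \<nu> lam s (y - z1) (y - z2) 0)) (p, q) \<partial>open_half_plane \<partial>(m \<Otimes>\<^sub>M m'))"
    by (rule H.Fubini[OF meas, symmetric])
  also have "\<dots> = (\<integral>\<^sup>+(z1, z2). ennreal (K_dag \<nu> lam t (x1 - z1) (x2 - z2) (x1 - x2)) \<partial>(m \<Otimes>\<^sub>M m'))"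
    using K_star_Duhamel_half_plane[OF \<nu> t, of lam x1 x2]
    by (intro nn_integral_cong) (auto simp: case_prod_beta')
  also have "\<dots> = ennreal (\<integral>(z1, z2). K_dag \<nu> lam t (x1 - z1) (x2 - z2) (x1 - x2) \<partial>(m \<Otimes>\<^sub>M m'))"
    using nn_integral_eq_integral[OF K_dag_integrable[OF m m' \<nu> t, of lam x1 x2 "x1 - x2"]] K_dag_nonneg[OF \<nu> t]
    by (simp add: case_prod_beta')
  finally have eq: "(\<integral>\<^sup>+(s, y). ennreal (?J s y * ?k s y) \<partial>open_half_plane) = \<dots>" .
  show "has_bochner_integral open_half_plane (\<lambda>(s, y). ?J s y * ?k s y)
     (\<integral>(z1, z2). K_dag \<nu> lam t (x1 - z1) (x2 - z2) (x1 - x2) \<partial>(m \<Otimes>\<^sub>M m'))"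
    by (rule has_bochner_integral_nn_integral[OF kJm])
      (use nn eq K_dag_nonneg[OF \<nu> t] in \<open>auto simp: case_prod_beta' intro!: integral_nonneg_AE\<close>)
qed

lemma signed_K_star_split:
  assumes \<mu>: "\<mu> \<in> M_H" and \<nu>: "0 < \<nu>" and t: "0 < t"
  shows "signed_integrable2 \<mu> (\<lambda>z1 z2. K_dag \<nu> lam t (x1 - z1) (x2 - z2) y)"
    and "signed_integrable2 \<mu> (\<lambda>z1 z2. K_star \<nu> lam t (x1 - z1) (x2 - z2) y)"
    and "signed_integral2 \<mu> (\<lambda>z1 z2. K_star \<nu> lam t (x1 - z1) (x2 - z2) y)
      = J0 \<nu> \<mu> t x1 * J0 \<nu> \<mu> t x2 + signed_integral2 \<mu> (\<lambda>z1 z2. K_dag \<nu> lam t (x1 - z1) (x2 - z2) y)"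
proof -
  note G = M_H_gauss_finite[OF \<mu>]
  show "signed_integrable2 \<mu> (\<lambda>z1 z2. K_dag \<nu> lam t (x1 - z1) (x2 - z2) y)"
    "signed_integrable2 \<mu> (\<lambda>z1 z2. K_star \<nu> lam t (x1 - z1) (x2 - z2) y)"
    unfolding signed_integrable2_def using G K_dag_integrable[OF _ _ \<nu> t] K_star_integrable[OF _ _ \<nu> t] by auto
  have *: "(\<integral>(z1, z2). K_star \<nu> lam t (x1 - z1) (x2 - z2) y \<partial>(m \<Otimes>\<^sub>M m')) =
    (\<integral>z. heat_kernel \<nu> t (x1 - z) \<partial>m) * (\<integral>z. heat_kernel \<nu> t (x2 - z) \<partial>m') + (\<integral>(z1, z2). K_dag \<nu> lam t (x1 - z1) (x2 - z2) y \<partial>(m \<Otimes>\<^sub>M m'))"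
    if m: "gauss_finite m" and m': "gauss_finite m'" for m m'
  proof -
    have "(\<integral>(z1, z2). K_star \<nu> lam t (x1 - z1) (x2 - z2) y \<partial>(m \<Otimes>\<^sub>M m')) =
      (\<integral>(z1, z2). heat_kernel \<nu> t (x1 - z1) * heat_kernel \<nu> t (x2 - z2) \<partial>(m \<Otimes>\<^sub>M m')) + (\<integral>(z1, z2). K_dag \<nu> lam t (x1 - z1) (x2 - z2) y \<partial>(m \<Otimes>\<^sub>M m'))"
      using heat_kernel_pair_integral[OF m m' \<nu> t, of x1 x2] K_dag_integrable[OF m m' \<nu> t, of lam x1 x2 y]
      by (subst Bochner_Integration.integral_add[symmetric]) (auto simp: has_bochner_integral_iff K_star_def case_prod_beta')
    thus ?thesis using heat_kernel_pair_integral[OF m m' \<nu> t, of x1 x2] by (simp add: has_bochner_integral_iff)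
  qed
  show "signed_integral2 \<mu> (\<lambda>z1 z2. K_star \<nu> lam t (x1 - z1) (x2 - z2) y)
      = J0 \<nu> \<mu> t x1 * J0 \<nu> \<mu> t x2 + signed_integral2 \<mu> (\<lambda>z1 z2. K_dag \<nu> lam t (x1 - z1) (x2 - z2) y)"
    unfolding signed_integral2_def *[OF G(1) G(1)] *[OF G(1) G(2)] *[OF G(2) G(1)] *[OF G(2) G(2)] J0_def signed_integral_def
    by (simp add: algebra_simps)
qed

lemma signed_moment_Duhamel:
  assumes \<mu>: "\<mu> \<in> M_H" and \<nu>: "0 < \<nu>" and t: "0 < t"
  shows "has_bochner_integral open_half_plane
     (\<lambda>(s, y). lam\<^sup>2 * joint_kernel \<nu> t x1 x2 s y * signed_integral2 \<mu> (\<lambda>z1 z2. K_star \<nu> lam s (y - z1) (y - z2) 0))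
     (signed_integral2 \<mu> (\<lambda>z1 z2. K_dag \<nu> lam t (x1 - z1) (x2 - z2) (x1 - x2)))"
    and "(\<lambda>(s, y). signed_integral2 \<mu> (\<lambda>z1 z2. K_star \<nu> lam s (y - z1) (y - z2) 0)) \<in> borel_measurable open_half_plane"
proof -
  note G = M_H_gauss_finite[OF \<mu>]
  note D = pair_moment_Duhamel(1)[OF _ _ \<nu> t, where lam=lam and ?x1.0=x1 and ?x2.0=x2]
  have eq: "(\<lambda>(s, y). lam\<^sup>2 * joint_kernel \<nu> t x1 x2 s y * signed_integral2 \<mu> (\<lambda>z1 z2. K_star \<nu> lam s (y - z1) (y - z2) 0))
    = (\<lambda>z. (\<lambda>(s, y). lam\<^sup>2 * joint_kernel \<nu> t x1 x2 s y * (\<integral>(z1, z2). K_star \<nu> lam s (y - z1) (y - z2) 0 \<partial>(fst \<mu> \<Otimes>\<^sub>M fst \<mu>))) z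
         + (\<lambda>(s, y). lam\<^sup>2 * joint_kernel \<nu> t x1 x2 s y * (\<integral>(z1, z2). K_star \<nu> lam s (y - z1) (y - z2) 0 \<partial>(snd \<mu> \<Otimes>\<^sub>M snd \<mu>))) z
         - (\<lambda>(s, y). lam\<^sup>2 * joint_kernel \<nu> t x1 x2 s y * (\<integral>(z1, z2). K_star \<nu> lam s (y - z1) (y - z2) 0 \<partial>(fst \<mu> \<Otimes>\<^sub>M snd \<mu>))) z
         - (\<lambda>(s, y). lam\<^sup>2 * joint_kernel \<nu> t x1 x2 s y * (\<integral>(z1, z2). K_star \<nu> lam s (y - z1) (y - z2) 0 \<partial>(snd \<mu> \<Otimes>\<^sub>M fst \<mu>))) z)"
    by (auto simp: fun_eq_iff signed_integral2_def algebra_simps)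
  show "has_bochner_integral open_half_plane
     (\<lambda>(s, y). lam\<^sup>2 * joint_kernel \<nu> t x1 x2 s y * signed_integral2 \<mu> (\<lambda>z1 z2. K_star \<nu> lam s (y - z1) (y - z2) 0))
     (signed_integral2 \<mu> (\<lambda>z1 z2. K_dag \<nu> lam t (x1 - z1) (x2 - z2) (x1 - x2)))"
    unfolding eq unfolding signed_integral2_def
    by (intro has_bochner_integral_add has_bochner_integral_diff D G)
  have eq: "(\<lambda>(s, y). signed_integral2 \<mu> (\<lambda>z1 z2. K_star \<nu> lam s (y - z1) (y - z2) 0))
    = (\<lambda>z. (\<lambda>(s, y). \<integral>(z1, z2). K_star \<nu> lam s (y - z1) (y - z2) 0 \<partial>(fst \<mu> \<Otimes>\<^sub>M fst \<mu>)) z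
         + (\<lambda>(s, y). \<integral>(z1, z2). K_star \<nu> lam s (y - z1) (y - z2) 0 \<partial>(snd \<mu> \<Otimes>\<^sub>M snd \<mu>)) z
         - (\<lambda>(s, y). \<integral>(z1, z2). K_star \<nu> lam s (y - z1) (y - z2) 0 \<partial>(fst \<mu> \<Otimes>\<^sub>M snd \<mu>)) z
         - (\<lambda>(s, y). \<integral>(z1, z2). K_star \<nu> lam s (y - z1) (y - z2) 0 \<partial>(snd \<mu> \<Otimes>\<^sub>M fst \<mu>)) z)"
    by (auto simp: fun_eq_iff signed_integral2_def)
  show "(\<lambda>(s, y). signed_integral2 \<mu> (\<lambda>z1 z2. K_star \<nu> lam s (y - z1) (y - z2) 0)) \<in> borel_measurable open_half_plane"
    unfolding eq by (intro borel_measurable_add borel_measurable_diff pair_moment_Duhamel(2)[OF _ _ \<nu> t] G)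
qed

section \<open>The two-point correlation function\<close>

context white_noise
begin

lemma mild_solution_covariance:
  assumes \<nu>: "0 < \<nu>" and u: "mild_solution M F W \<nu> lam \<mu> u" and t: "0 < t"
  shows "integrable M (\<lambda>\<omega>. u t x1 \<omega> * u t x2 \<omega>)"
    and "(\<integral>\<^sup>+((s, y), \<omega>). ennreal (lam\<^sup>2 * joint_kernel \<nu> t x1 x2 s y * (u s y \<omega>)\<^sup>2) \<partial>(open_half_plane \<Otimes>\<^sub>M M))
      = ennreal (expectation (\<lambda>\<omega>. u t x1 \<omega> * u t x2 \<omega>) - J0 \<nu> \<mu> t x1 * J0 \<nu> \<mu> t x2)"
    and "J0 \<nu> \<mu> t x1 * J0 \<nu> \<mu> t x2 \<le> expectation (\<lambda>\<omega>. u t x1 \<omega> * u t x2 \<omega>)"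
proof -
  define f where "f = (\<lambda>x s y \<omega>. indicator {0<..<t} s * (heat_kernel \<nu> (t - s) (x - y) * (lam * u s y \<omega>)))"
  have um: "u t x \<in> borel_measurable M" for x
    using u t past_measurable unfolding mild_solution_def by blast
  have "\<exists>I. has_walsh_integral M F W (f x) I \<and> (AE \<omega> in M. u t x \<omega> = J0 \<nu> \<mu> t x + I \<omega>)" for x
    using u t unfolding mild_solution_def f_def by blast
  then obtain I where I: "\<And>x. has_walsh_integral M F W (f x) (I x)"
    and ae: "\<And>x. AE \<omega> in M. u t x \<omega> = J0 \<nu> \<mu> t x + I x \<omega>" by metis
  have Im: "I x \<in> borel_measurable M" for x using I[of x] by (simp add: has_walsh_integral_def)
  have f_mult: "f x1 s y \<omega> * f x2 s y \<omega> = lam\<^sup>2 * joint_kernel \<nu> t x1 x2 s y * (u s y \<omega>)\<^sup>2" for s y \<omega>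
    by (auto simp: f_def joint_kernel_def indicator_def power2_eq_square)
  have nonneg: "0 \<le> f x1 s y \<omega> * f x2 s y \<omega>" for s y \<omega>
    unfolding f_mult using joint_kernel_nonneg[OF \<nu>] by simp
  note cov = Walsh_covariance[OF I I nonneg]
  have ae2: "AE \<omega> in M. u t x1 \<omega> * u t x2 \<omega> = J0 \<nu> \<mu> t x1 * J0 \<nu> \<mu> t x2 + J0 \<nu> \<mu> t x1 * I x2 \<omega> + J0 \<nu> \<mu> t x2 * I x1 \<omega> + I x1 \<omega> * I x2 \<omega>"
    using ae[of x1] ae[of x2] by eventually_elim (simp add: algebra_simps)
  note i = cov(1) Walsh_integrable[OF I]
  note m = um[measurable] Im[measurable]
  show "integrable M (\<lambda>\<omega>. u t x1 \<omega> * u t x2 \<omega>)"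
    using i m by (subst integrable_cong_AE[OF _ _ ae2]) auto
  have "expectation (\<lambda>\<omega>. u t x1 \<omega> * u t x2 \<omega>) =
    expectation (\<lambda>\<omega>. J0 \<nu> \<mu> t x1 * J0 \<nu> \<mu> t x2 + J0 \<nu> \<mu> t x1 * I x2 \<omega> + J0 \<nu> \<mu> t x2 * I x1 \<omega> + I x1 \<omega> * I x2 \<omega>)"
    by (rule integral_cong_AE[OF _ _ ae2]) (use m in measurable)
  also have "\<dots> = J0 \<nu> \<mu> t x1 * J0 \<nu> \<mu> t x2 + expectation (\<lambda>\<omega>. I x1 \<omega> * I x2 \<omega>)"
    using i Walsh_expectation[OF I] prob_space by simp
  finally have e: "expectation (\<lambda>\<omega>. u t x1 \<omega> * u t x2 \<omega>) = \<dots>" .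
  show "(\<integral>\<^sup>+((s, y), \<omega>). ennreal (lam\<^sup>2 * joint_kernel \<nu> t x1 x2 s y * (u s y \<omega>)\<^sup>2) \<partial>(open_half_plane \<Otimes>\<^sub>M M))
      = ennreal (expectation (\<lambda>\<omega>. u t x1 \<omega> * u t x2 \<omega>) - J0 \<nu> \<mu> t x1 * J0 \<nu> \<mu> t x2)"
    using cov(2) unfolding e f_mult by simp
  show "J0 \<nu> \<mu> t x1 * J0 \<nu> \<mu> t x2 \<le> expectation (\<lambda>\<omega>. u t x1 \<omega> * u t x2 \<omega>)"
    unfolding e using cov(3) by simp
qed

text \<open>
  The stochastic integrals at \<open>(t, x1)\<close> and \<open>(t, x2)\<close> have mean zero, so only their covariance is added
  to \<open>J0 * J0\<close>; integrating over the probability space first turns it into an integral of \<open>E[u\<^sup>2]\<close>.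
\<close>

lemma mild_solution_Duhamel:
  assumes \<nu>: "0 < \<nu>" and u: "mild_solution M F W \<nu> lam \<mu> u"
  shows "0 < t \<Longrightarrow> has_bochner_integral open_half_plane
      (\<lambda>(s, y). lam\<^sup>2 * joint_kernel \<nu> t x1 x2 s y * expectation (\<lambda>\<omega>. (u s y \<omega>)\<^sup>2))
      (expectation (\<lambda>\<omega>. u t x1 \<omega> * u t x2 \<omega>) - J0 \<nu> \<mu> t x1 * J0 \<nu> \<mu> t x2)"
    and "(\<lambda>(s, y). expectation (\<lambda>\<omega>. (u s y \<omega>)\<^sup>2)) \<in> borel_measurable open_half_plane"
proof -
  have um: "(\<lambda>((s, y), \<omega>). u s y \<omega>) \<in> borel_measurable (open_half_plane \<Otimes>\<^sub>M M)"
    using u unfolding mild_solution_def by blast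
  have u2: "(\<lambda>((s, y), \<omega>). (u s y \<omega>)\<^sup>2) \<in> borel_measurable (open_half_plane \<Otimes>\<^sub>M M)"
    using borel_measurable_power[OF um, of 2] by (simp add: case_prod_beta')
  show gm: "(\<lambda>(s, y). expectation (\<lambda>\<omega>. (u s y \<omega>)\<^sup>2)) \<in> borel_measurable open_half_plane"
    using borel_measurable_lebesgue_integral[of "\<lambda>z \<omega>. (u (fst z) (snd z) \<omega>)\<^sup>2" open_half_plane] u2
    by (simp add: case_prod_beta')
  assume t: "0 < t"
  let ?J = "\<lambda>s y. lam\<^sup>2 * joint_kernel \<nu> t x1 x2 s y"
  let ?g = "\<lambda>s y. expectation (\<lambda>\<omega>. (u s y \<omega>)\<^sup>2)"
  have Jm: "(\<lambda>(s, y). ?J s y) \<in> borel_measurable open_half_plane"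
    by (rule measurable_open_half_plane) measurable
  have Jn: "0 \<le> ?J s y" for s y using joint_kernel_nonneg[OF \<nu>] by simp
  have m: "(\<lambda>((s, y), \<omega>). ennreal (?J s y * (u s y \<omega>)\<^sup>2)) \<in> borel_measurable (open_half_plane \<Otimes>\<^sub>M M)"
    using measurable_compose[OF borel_measurable_times[OF measurable_compose[OF measurable_fst Jm] u2] measurable_ennreal]
    by (simp add: case_prod_beta')
  have "(\<integral>\<^sup>+((s, y), \<omega>). ennreal (?J s y * (u s y \<omega>)\<^sup>2) \<partial>(open_half_plane \<Otimes>\<^sub>M M))
    = (\<integral>\<^sup>+z. \<integral>\<^sup>+\<omega>. (\<lambda>((s, y), \<omega>). ennreal (?J s y * (u s y \<omega>)\<^sup>2)) (z, \<omega>) \<partial>M \<partial>open_half_plane)"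
    by (rule nn_integral_fst[OF m, symmetric])
  also have "\<dots> = (\<integral>\<^sup>+(s, y). ennreal (?J s y * ?g s y) \<partial>open_half_plane)"
  proof (intro nn_integral_cong)
    fix z assume z: "z \<in> space open_half_plane"
    obtain s y where sy: "z = (s, y)" by (cases z)
    with z have s: "0 < s" by (auto simp: open_half_plane_def space_restrict_space)
    have i: "integrable M (\<lambda>\<omega>. (u s y \<omega>)\<^sup>2)"
      using mild_solution_covariance(1)[OF \<nu> u s, of y y] by (simp add: power2_eq_square)
    have "(\<integral>\<^sup>+\<omega>. ennreal (?J s y * (u s y \<omega>)\<^sup>2) \<partial>M) = ennreal (expectation (\<lambda>\<omega>. ?J s y * (u s y \<omega>)\<^sup>2))"
      using i Jn by (intro nn_integral_eq_integral integrable_mult_right AE_I2) auto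
    thus "(\<integral>\<^sup>+\<omega>. (\<lambda>((s, y), \<omega>). ennreal (?J s y * (u s y \<omega>)\<^sup>2)) (z, \<omega>) \<partial>M) = (case z of (s, y) \<Rightarrow> ennreal (?J s y * ?g s y))"
      by (simp add: sy)
  qed
  finally have eq: "(\<integral>\<^sup>+(s, y). ennreal (?J s y * ?g s y) \<partial>open_half_plane)
    = ennreal (expectation (\<lambda>\<omega>. u t x1 \<omega> * u t x2 \<omega>) - J0 \<nu> \<mu> t x1 * J0 \<nu> \<mu> t x2)"
    using mild_solution_covariance(2)[OF \<nu> u t, of x1 x2] by simp
  have Jgm: "(\<lambda>(s, y). ?J s y * ?g s y) \<in> borel_measurable open_half_plane"
    using borel_measurable_times[OF Jm gm] by (simp add: case_prod_beta')
  show "has_bochner_integral open_half_plane (\<lambda>(s, y). ?J s y * ?g s y)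
      (expectation (\<lambda>\<omega>. u t x1 \<omega> * u t x2 \<omega>) - J0 \<nu> \<mu> t x1 * J0 \<nu> \<mu> t x2)"
    by (rule has_bochner_integral_nn_integral[OF Jgm])
      (use Jn eq mild_solution_covariance(3)[OF \<nu> u t, of x1 x2] in \<open>auto simp: case_prod_beta' mult.assoc[symmetric] intro!: mult_nonneg_nonneg\<close>)
qed

text \<open>
  Both sides solve the same Volterra equation, so the modulus \<open>D\<close> of their difference satisfies the
  homogeneous inequality. The integral in it is finite because the difference of the two equations
  holds with absolutely convergent integrals.
\<close>

lemma second_moment_eq:
  assumes \<nu>: "0 < \<nu>" and \<mu>: "\<mu> \<in> M_H" and u: "mild_solution M F W \<nu> lam \<mu> u" and t: "0 < t"
  shows "expectation (\<lambda>\<omega>. (u t x \<omega>)\<^sup>2) = signed_integral2 \<mu> (\<lambda>z1 z2. K_star \<nu> lam t (x - z1) (x - z2) 0)"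
proof -
  let ?g = "\<lambda>s y. expectation (\<lambda>\<omega>. (u s y \<omega>)\<^sup>2)"
  let ?h = "\<lambda>s y. signed_integral2 \<mu> (\<lambda>z1 z2. K_star \<nu> lam s (y - z1) (y - z2) 0)"
  let ?D = "\<lambda>s y. ennreal \<bar>?g s y - ?h s y\<bar>"
  let ?J = "\<lambda>t x s y. lam\<^sup>2 * joint_kernel \<nu> t x x s y"
  have Jn: "0 \<le> ?J t x s y" for t x s y using joint_kernel_nonneg[OF \<nu>] by simp
  have Dm: "(\<lambda>(s, y). ?D s y) \<in> borel_measurable open_half_plane"
    using measurable_compose[OF borel_measurable_abs[OF borel_measurable_diff[OF mild_solution_Duhamel(2)[OF \<nu> u] signed_moment_Duhamel(2)[OF \<mu> \<nu> zero_less_one]]] measurable_ennreal]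
    by (simp add: case_prod_beta')
  have diff: "has_bochner_integral open_half_plane (\<lambda>(s, y). ?J t x s y * (?g s y - ?h s y)) (?g t x - ?h t x)" if t: "0 < t" for t x
  proof -
    have "?h t x = J0 \<nu> \<mu> t x * J0 \<nu> \<mu> t x + signed_integral2 \<mu> (\<lambda>z1 z2. K_dag \<nu> lam t (x - z1) (x - z2) 0)"
      by (rule signed_K_star_split[OF \<mu> \<nu> t])
    moreover have "has_bochner_integral open_half_plane (\<lambda>z. (\<lambda>(s, y). ?J t x s y * ?g s y) z - (\<lambda>(s, y). ?J t x s y * ?h s y) z)
      ((?g t x - J0 \<nu> \<mu> t x * J0 \<nu> \<mu> t x) - signed_integral2 \<mu> (\<lambda>z1 z2. K_dag \<nu> lam t (x - z1) (x - z2) 0))"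
      using has_bochner_integral_diff[OF mild_solution_Duhamel(1)[OF \<nu> u t, of x x] signed_moment_Duhamel(1)[OF \<mu> \<nu> t, of lam x x]]
      by (simp add: power2_eq_square)
    ultimately show ?thesis by (simp add: case_prod_beta' right_diff_distrib algebra_simps)
  qed
  have abs_eq: "(\<integral>\<^sup>+z. ennreal (norm ((\<lambda>(s, y). ?J t x s y * (?g s y - ?h s y)) z)) \<partial>open_half_plane)
      = (\<integral>\<^sup>+(s, y). ennreal (?J t x s y) * ?D s y \<partial>open_half_plane)" for t x
    unfolding case_prod_beta' real_norm_def abs_mult[of "lam\<^sup>2 * _"] abs_of_nonneg[OF Jn]
    by (simp add: ennreal_mult' Jn)
  have "?D t x = 0"
  proof (rule Volterra_inequality_imp_zero[OF \<nu> Dm _ _ t])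
    fix t x :: real assume t: "0 < t"
    have i: "integrable open_half_plane (\<lambda>(s, y). ?J t x s y * (?g s y - ?h s y))"
      and e: "(\<integral>z. (\<lambda>(s, y). ?J t x s y * (?g s y - ?h s y)) z \<partial>open_half_plane) = ?g t x - ?h t x"
      using diff[OF t, of x] by (auto simp: has_bochner_integral_iff)
    show "?D t x \<le> (\<integral>\<^sup>+(s, y). ennreal (?J t x s y) * ?D s y \<partial>open_half_plane)"
      using integral_norm_bound_ennreal[OF i] unfolding e abs_eq by simp
    show "(\<integral>\<^sup>+(s, y). ennreal (?J t x s y) * ?D s y \<partial>open_half_plane) < \<infinity>"
      using i unfolding integrable_iff_bounded abs_eq by simp
  qed
  thus ?thesis by (simp add: ennreal_eq_0_iff)
qed

lemma two_point_correlation: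
  assumes \<nu>: "0 < \<nu>" and \<mu>: "\<mu> \<in> M_H" and u: "mild_solution M F W \<nu> lam \<mu> u" and t: "0 < t"
  shows "expectation (\<lambda>\<omega>. u t x1 \<omega> * u t x2 \<omega>) = J0 \<nu> \<mu> t x1 * J0 \<nu> \<mu> t x2 +
    signed_integral2 \<mu> (\<lambda>z1 z2. K_dag \<nu> lam t (x1 - z1) (x2 - z2) (x1 - x2))"
proof -
  let ?g = "\<lambda>s y. expectation (\<lambda>\<omega>. (u s y \<omega>)\<^sup>2)"
  let ?h = "\<lambda>s y. signed_integral2 \<mu> (\<lambda>z1 z2. K_star \<nu> lam s (y - z1) (y - z2) 0)"
  have "(\<integral>(s, y). lam\<^sup>2 * joint_kernel \<nu> t x1 x2 s y * ?g s y \<partial>open_half_plane) = (\<integral>(s, y). lam\<^sup>2 * joint_kernel \<nu> t x1 x2 s y * ?h s y \<partial>open_half_plane)"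
  proof (intro Bochner_Integration.integral_cong refl, clarify)
    fix s y assume "(s, y) \<in> space open_half_plane"
    hence s: "0 < s" by (auto simp: open_half_plane_def space_restrict_space)
    show "lam\<^sup>2 * joint_kernel \<nu> t x1 x2 s y * ?g s y = lam\<^sup>2 * joint_kernel \<nu> t x1 x2 s y * ?h s y"
      unfolding second_moment_eq[OF \<nu> \<mu> u s] ..
  qed
  thus ?thesis
    using mild_solution_Duhamel(1)[OF \<nu> u t, of x1 x2] signed_moment_Duhamel(1)[OF \<mu> \<nu> t, of lam x1 x2]
    by (simp add: has_bochner_integral_iff)
qed

end

theorem theorem2p1:
  fixes M :: "'a measure" and F :: "real \<Rightarrow> 'a measure"
    and W :: "(real \<times> real) set \<Rightarrow> 'a \<Rightarrow> real"
    and \<nu> lam :: real and \<mu> :: signed_measure and u :: "real \<Rightarrow> real \<Rightarrow> 'a \<Rightarrow> real"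
  assumes "white_noise M F W"
    and "\<nu> > 0" and "\<mu> \<in> M_H"
    and "mild_solution M F W \<nu> lam \<mu> u"
  shows "(\<forall>t>0. \<forall>x1 x2.
           integrable M (\<lambda>\<omega>. u t x1 \<omega> * u t x2 \<omega>) \<and>
           signed_integrable2 \<mu> (\<lambda>z1 z2. K_star \<nu> lam t (x1 - z1) (x2 - z2) (x1 - x2)) \<and>
           (\<integral>\<omega>. u t x1 \<omega> * u t x2 \<omega> \<partial>M) =
             signed_integral2 \<mu> (\<lambda>z1 z2. K_star \<nu> lam t (x1 - z1) (x2 - z2) (x1 - x2)) \<and>
           signed_integrable2 \<mu> (\<lambda>z1 z2. K_dag \<nu> lam t (x1 - z1) (x2 - z2) (x1 - x2)) \<and>
           (\<integral>\<omega>. u t x1 \<omega> * u t x2 \<omega> \<partial>M) =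
             J0 \<nu> \<mu> t x1 * J0 \<nu> \<mu> t x2 +
             signed_integral2 \<mu> (\<lambda>z1 z2. K_dag \<nu> lam t (x1 - z1) (x2 - z2) (x1 - x2))) \<and>
         (\<forall>t>0. \<forall>z1 z2 y.
           K_star \<nu> lam t z1 z2 y =
             heat_kernel (\<nu> / 2) t ((z1 + z2) / 2) *
             (heat_kernel (2 * \<nu>) t (z1 - z2) +
              lam^2 / (2 * \<nu>)
              * exp (lam^2 / (4 * \<nu>) * (lam^2 * t - 2 * (\<bar>y\<bar> + \<bar>y - (z1 - z2)\<bar>)))
              * Phi ((lam^2 * t - (\<bar>y\<bar> + \<bar>y - (z1 - z2)\<bar>)) / sqrt (2 * \<nu> * t)))) \<and>
         (\<forall>t>0. \<forall>x.
           (Lp_norm M 2 (u t x))\<^sup>2 =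
             signed_integral2 \<mu> (\<lambda>z1 z2. K_star \<nu> lam t (x - z1) (x - z2) 0))"
proof -
  interpret white_noise M F W by fact
  note \<nu> = assms(2) and \<mu> = assms(3) and u = assms(4)
  show ?thesis
  proof (intro conjI allI impI)
    fix t x1 x2 :: real assume t: "0 < t"
    show "integrable M (\<lambda>\<omega>. u t x1 \<omega> * u t x2 \<omega>)"
      by (rule mild_solution_covariance[OF \<nu> u t])
    show "signed_integrable2 \<mu> (\<lambda>z1 z2. K_star \<nu> lam t (x1 - z1) (x2 - z2) (x1 - x2))"
      "signed_integrable2 \<mu> (\<lambda>z1 z2. K_dag \<nu> lam t (x1 - z1) (x2 - z2) (x1 - x2))"
      by (rule signed_K_star_split[OF \<mu> \<nu> t])+
    show "(\<integral>\<omega>. u t x1 \<omega> * u t x2 \<omega> \<partial>M) = signed_integral2 \<mu> (\<lambda>z1 z2. K_star \<nu> lam t (x1 - z1) (x2 - z2) (x1 - x2))"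
      unfolding signed_K_star_split(3)[OF \<mu> \<nu> t] by (rule two_point_correlation[OF \<nu> \<mu> u t])
    show "(\<integral>\<omega>. u t x1 \<omega> * u t x2 \<omega> \<partial>M) = J0 \<nu> \<mu> t x1 * J0 \<nu> \<mu> t x2 +
             signed_integral2 \<mu> (\<lambda>z1 z2. K_dag \<nu> lam t (x1 - z1) (x2 - z2) (x1 - x2))"
      by (rule two_point_correlation[OF \<nu> \<mu> u t])
  next
    fix t z1 z2 y :: real assume t: "0 < t"
    show "K_star \<nu> lam t z1 z2 y = heat_kernel (\<nu> / 2) t ((z1 + z2) / 2) *
             (heat_kernel (2 * \<nu>) t (z1 - z2) +
              lam^2 / (2 * \<nu>)
              * exp (lam^2 / (4 * \<nu>) * (lam^2 * t - 2 * (\<bar>y\<bar> + \<bar>y - (z1 - z2)\<bar>)))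
              * Phi ((lam^2 * t - (\<bar>y\<bar> + \<bar>y - (z1 - z2)\<bar>)) / sqrt (2 * \<nu> * t)))"
      unfolding K_star_def K_dag_def heat_kernel_mult[OF \<nu> t] by (simp only: distrib_left mult_ac)
  next
    fix t x :: real assume t: "0 < t"
    have "(\<integral>\<omega>. \<bar>u t x \<omega>\<bar> powr 2 \<partial>M) = (\<integral>\<omega>. (u t x \<omega>)\<^sup>2 \<partial>M)"
      by (intro Bochner_Integration.integral_cong) (auto simp: powr_numeral)
    moreover have "0 \<le> (\<integral>\<omega>. (u t x \<omega>)\<^sup>2 \<partial>M)" by simp
    ultimately have "(Lp_norm M 2 (u t x))\<^sup>2 = (\<integral>\<omega>. (u t x \<omega>)\<^sup>2 \<partial>M)"
      unfolding Lp_norm_def by (simp add: powr_half_sqrt)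
    thus "(Lp_norm M 2 (u t x))\<^sup>2 = signed_integral2 \<mu> (\<lambda>z1 z2. K_star \<nu> lam t (x - z1) (x - z2) 0)"
      unfolding second_moment_eq[OF \<nu> \<mu> u t] .
  qed
qed

end
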